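(* Let $\Xi(x)$ be a nonzero even doubly-periodic (periods $2\omega_1,2\omega_3$) solution of $$\left\{\frac{d^3}{dx^3}-4(v(x)-E)\frac{d}{dx}-2\frac{dv(x)}{dx}\right\}\Xi(x)=0$$ of the form $$\Xi(x)=c_0+\sum_{i=0}^3\sum_{j=0}^{l_i-1}b^{(i)}_j\wp(x+\omega_i)^{l_i-j}+\sum_{i'=1}^M\sum_{j=0}^{r_{i'}-1}\frac{d^{(i')}_j}{(\wp(x)-\wp(\delta_{i'}))^{r_{i'}-j}},$$ let $Q=\Xi^2(E-v)+\frac12\Xi\,\Xi''-\frac14(\Xi')^2$ (independent of $x$), and let $\Lambda_g(x)=\Psi_g(x)\sqrt{\Xi(x)}\exp\int\frac{\sqrt{-Q}\,dx}{\Xi(x)}$. Set $\tilde l_0=l_0+\sum_{i'=1}^Mr_{i'}$ and $\tilde l_i=l_i$ $(i=1,2,3)$. Then $\Lambda_g(x)$ is expressed either as $$\text{(A)}\quad \Lambda_g(x)=\exp(\kappa x)\left(\sum_{i=0}^3\sum_{j=0}^{\tilde l_i-1}\tilde b^{(i)}_j\left(\frac{d}{dx}\right)^j\Phi_i(x,\alpha)\right)$$ for some values $\alpha$, $\kappa$ and $\tilde b^{(i)}_j$ $(i=0,\dots,3,\ j=0,\dots,\tilde l_i-1)$, or as $$\text{(B)}\quad \Lambda_g(x)=\exp(\bar\kappa x)\left(\bar c+\sum_{i=0}^3\sum_{j=0}^{\tilde l_i-2}\bar b^{(i)}_j\left(\frac{d}{dx}\right)^j\wp(x+\omega_i)+\sum_{i=1}^3\bar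 c_i\frac{\wp'(x)}{\wp(x)-e_i}\right)$$ for some values $\bar\kappa$, $\bar c$, $\bar c_i$ $(i=1,2,3)$ and $\bar b^{(i)}_j$ $(i=0,\dots,3,\ j=0,\dots,\tilde l_i-2)$. If $\Lambda_g(x)$ is expressed as (A), then $$\Lambda_g(x+2\omega_j)=\exp(-2\eta_j\alpha+2\omega_j\zeta(\alpha)+2\kappa\omega_j)\Lambda_g(x),\quad(j=1,3);$$ otherwise (expression (B)) $$\Lambda_g(x+2\omega_j)=\exp(2\bar\kappa\omega_j)\Lambda_g(x),\quad(j=1,3).$$
   Context: $\wp,\sigma,\zeta$ are the Weierstrass functions with periods $(2\omega_1,2\omega_3)$ ($\omega_1,\omega_3$ linearly independent over $\mathbb{R}$), $\omega_0=0$, $\omega_2=-\omega_1-\omega_3$, $e_i=\wp(\omega_i)$, $\eta_i=\zeta(\omega_i)$ $(i=1,2,3)$. For $\alpha\notin2\omega_1\mathbb{Z}\oplus2\omega_3\mathbb{Z}$, $$\Phi_i(x,\alpha)=\frac{\sigma(x+\omega_i-\alpha)}{\sigma(x+\omega_i)}\exp(\zeta(\alpha)x)\quad(i=0,1,2,3).$$ $M\ge0$ is an integer, $l_i\in\mathbb{Z}_{\ge0}$, $r_{i'}\in\mathbb{Z}_{>0}$; $b_1,\dots,b_M\in\mathbb{C}\setminus\{e_1,e_2,e_3\}$ are pairwise distinct, $\wp(\delta_{i'})=b_{i'}$; $E,s_1,\dots,s_M\in\mathbb{C}$. Set $$v(x)=\sum_{i=0}^3l_i(l_i+1)\wp(x+\omega_i)+\sum_{i'=1}^M\left(\frac{r_{i'}}2\Big(\frac{r_{i'}}2+1\Big)(\wp(x-\delta_{i'})+\wp(x+\delta_{i'}))+\frac{s_{i'}}{\wp(x)-\wp(\delta_{i'})}\right),\qquad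 \Psi_g(x)=\prod_{i'=1}^M(\wp(x)-\wp(\delta_{i'}))^{r_{i'}/2}.$$ Standing assumption: for every $i'$, the singular points $x=\pm\delta_{i'}$ of the second-order linear ODE satisfied by $f_g=f\Psi_g$ (where $f$ ranges over the solutions of $-f''+vf=Ef$) are apparent, i.e. the exponents there are integers and there are no logarithmic solutions (equivalently, the local monodromy is the identity). Under this assumption such a $\Xi$ exists, and $\Lambda_g$ (defined with fixed branches) is a solution of the ODE for $f_g$, meromorphic on $\mathbb{C}$. *)

theory Defs
  imports "HOL-Complex_Analysis.Complex_Analysis"
begin

section \<open>Weierstrass functions\<close>

text \<open>
  Throughout, \<open>\<omega> i\<close> (\<open>i = 0,1,2,3\<close>) are the half-periods; only \<open>\<omega> 1\<close> and \<open>\<omega> 3\<close> enter the lattice.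
  At lattice points the series below have no mathematical meaning
  (HOL sets \<open>1 / 0 = 0\<close>), so \<open>\<wp>\<close> and \<open>\<zeta>\<close> may only be evaluated off the lattice.
\<close>

definition period_lattice :: "(nat \<Rightarrow> complex) \<Rightarrow> complex set" where
  "period_lattice \<omega> = {2 * of_int m * \<omega> 1 + 2 * of_int n * \<omega> 3 | m n. True}"

definition weierstrass_p :: "(nat \<Rightarrow> complex) \<Rightarrow> complex \<Rightarrow> complex" where
  "weierstrass_p \<omega> z =
     1 / z ^ 2 + (\<Sum>\<^sub>\<infinity>w\<in>period_lattice \<omega> - {0}. 1 / (z - w) ^ 2 - 1 / w ^ 2)"

definition weierstrass_zeta :: "(nat \<Rightarrow> complex) \<Rightarrow> complex \<Rightarrow> complex" where
  "weierstrass_zeta \<omega> z =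
     1 / z + (\<Sum>\<^sub>\<infinity>w\<in>period_lattice \<omega> - {0}. 1 / (z - w) + 1 / w + z / w ^ 2)"

text \<open>
  \<open>\<sigma>(z) = z \<Prod> (1 - z/w) exp (z/w + (z/w)\<^sup>2/2)\<close>, the product running over the nonzero lattice
  points \<open>w\<close>. It converges absolutely, so the enumeration used does not matter.
\<close>
definition weierstrass_sigma :: "(nat \<Rightarrow> complex) \<Rightarrow> complex \<Rightarrow> complex" where
  "weierstrass_sigma \<omega> z =
     z * (\<Prod>n. weierstrass_factor 2 (z / from_nat_into (period_lattice \<omega> - {0}) n))"

definition Phi :: "(nat \<Rightarrow> complex) \<Rightarrow> nat \<Rightarrow> complex \<Rightarrow> complex \<Rightarrow> complex" where
  "Phi \<omega> i \<alpha> x = weierstrass_sigma \<omega> (x + \<omega> i - \<alpha>) / weierstrass_sigma \<omega> (x + \<omega> i)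
                  * exp (weierstrass_zeta \<omega> \<alpha> * x)"


section \<open>The potential and the differential equations\<close>

definition potential ::
  "(nat \<Rightarrow> complex) \<Rightarrow> (nat \<Rightarrow> nat) \<Rightarrow> nat \<Rightarrow> (nat \<Rightarrow> nat) \<Rightarrow> (nat \<Rightarrow> complex) \<Rightarrow> (nat \<Rightarrow> complex)
   \<Rightarrow> complex \<Rightarrow> complex" where
  "potential \<omega> l M r s \<delta> x =
     (\<Sum>i\<le>3. of_nat (l i * (l i + 1)) * weierstrass_p \<omega> (x + \<omega> i))
     + (\<Sum>k=1..M. of_nat (r k) / 2 * (of_nat (r k) / 2 + 1)
                    * (weierstrass_p \<omega> (x - \<delta> k) + weierstrass_p \<omega> (x + \<delta> k))
                  + s k / (weierstrass_p \<omega> x - weierstrass_p \<omega> (\<delta> k)))"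

text \<open>The points where \<open>\<Psi>\<^sub>g\<close> or a coefficient of one of the differential equations may be singular:
  the half-periods and \<open>\<plusminus>\<delta>\<^sub>k\<close>, modulo the lattice.\<close>
definition singular_points :: "(nat \<Rightarrow> complex) \<Rightarrow> nat \<Rightarrow> (nat \<Rightarrow> complex) \<Rightarrow> complex set" where
  "singular_points \<omega> M \<delta> =
     {x. (\<exists>i\<le>3. x + \<omega> i \<in> period_lattice \<omega>) \<or>
         (\<exists>k\<in>{1..M}. x - \<delta> k \<in> period_lattice \<omega> \<or> x + \<delta> k \<in> period_lattice \<omega>)}"

text \<open>The logarithmic derivative of \<open>\<Psi>\<^sub>g = \<Prod>k. (\<wp> - \<wp>(\<delta>\<^sub>k)) powr (r\<^sub>k/2)\<close>; it does not depend on the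
  choice of branch.\<close>
definition Psi_logderiv ::
  "(nat \<Rightarrow> complex) \<Rightarrow> nat \<Rightarrow> (nat \<Rightarrow> nat) \<Rightarrow> (nat \<Rightarrow> complex) \<Rightarrow> complex \<Rightarrow> complex" where
  "Psi_logderiv \<omega> M r \<delta> x =
     (\<Sum>k=1..M. of_nat (r k) / 2 * deriv (weierstrass_p \<omega>) x
                  / (weierstrass_p \<omega> x - weierstrass_p \<omega> (\<delta> k)))"

text \<open>
  Put \<open>u = \<Psi>\<^sub>g' / \<Psi>\<^sub>g\<close>. Substituting \<open>f = f\<^sub>g / \<Psi>\<^sub>g\<close> in \<open>- f'' + v f = E f\<close> gives
  \<open>f\<^sub>g'' - 2 u f\<^sub>g' + (E - v - u' + u\<^sup>2) f\<^sub>g = 0\<close>. The next two definitions are its coefficients.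
\<close>
definition ode_P ::
  "(nat \<Rightarrow> complex) \<Rightarrow> nat \<Rightarrow> (nat \<Rightarrow> nat) \<Rightarrow> (nat \<Rightarrow> complex) \<Rightarrow> complex \<Rightarrow> complex" where
  "ode_P \<omega> M r \<delta> x = - 2 * Psi_logderiv \<omega> M r \<delta> x"

definition ode_R ::
  "(nat \<Rightarrow> complex) \<Rightarrow> (nat \<Rightarrow> nat) \<Rightarrow> nat \<Rightarrow> (nat \<Rightarrow> nat) \<Rightarrow> (nat \<Rightarrow> complex) \<Rightarrow> (nat \<Rightarrow> complex)
   \<Rightarrow> complex \<Rightarrow> complex \<Rightarrow> complex" where
  "ode_R \<omega> l M r s \<delta> E x =
     E - potential \<omega> l M r s \<delta> x - deriv (Psi_logderiv \<omega> M r \<delta>) x + Psi_logderiv \<omega> M r \<delta> x ^ 2"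

definition solves_ode ::
  "(complex \<Rightarrow> complex) \<Rightarrow> (complex \<Rightarrow> complex) \<Rightarrow> complex set \<Rightarrow> (complex \<Rightarrow> complex) \<Rightarrow> bool" where
  "solves_ode P R S f \<longleftrightarrow>
     f holomorphic_on S \<and> (\<forall>x\<in>S. deriv (deriv f) x + P x * deriv f x + R x * f x = 0)"

text \<open>The exponents of \<open>f'' + P f' + R f = 0\<close> at a regular singular point \<open>a\<close>: the roots of the
  indicial equation.\<close>
definition exponents_at ::
  "(complex \<Rightarrow> complex) \<Rightarrow> (complex \<Rightarrow> complex) \<Rightarrow> complex \<Rightarrow> complex set" where
  "exponents_at P R a =
     {\<rho>. \<rho> * (\<rho> - 1) + Lim (at a) (\<lambda>x. (x - a) * P x) * \<rho> + Lim (at a) (\<lambda>x. (x - a) ^ 2 * R x) = 0}"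

text \<open>Integer exponents and no logarithmic solutions. Given integer exponents, solutions near \<open>a\<close> are
  free of logarithms iff they are all single-valued, that is, iff some punctured disc around \<open>a\<close>
  carries two linearly independent single-valued solutions.\<close>
definition apparent_singularity ::
  "(complex \<Rightarrow> complex) \<Rightarrow> (complex \<Rightarrow> complex) \<Rightarrow> complex \<Rightarrow> bool" where
  "apparent_singularity P R a \<longleftrightarrow>
     exponents_at P R a \<subseteq> \<int> \<and>
     (\<exists>\<epsilon>>0. \<exists>f g. solves_ode P R (ball a \<epsilon> - {a}) f \<and> solves_ode P R (ball a \<epsilon> - {a}) g \<and>
        (\<forall>c d. (\<forall>x\<in>ball a \<epsilon> - {a}. c * f x + d * g x = 0) \<longrightarrow> c = 0 \<and> d = 0))"


section \<open>The function \<open>\<Lambda>\<^sub>g\<close> and the two expressions\<close>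

text \<open>
  The germ of \<open>\<Psi>\<^sub>g sqrt(\<Xi>) exp (\<integral> q/\<Xi> dx)\<close> on the domain \<open>U\<close> for one fixed choice of branches:
  \<open>p k\<close> is a branch of the square root of \<open>\<wp> - \<wp>(\<delta>\<^sub>k)\<close>, \<open>t\<close> one of the square root of \<open>\<Xi>\<close>, \<open>F\<close> a
  primitive of \<open>q / \<Xi>\<close>; \<open>q\<close> is a square root of \<open>- Q\<close>.
\<close>
definition Lambda_branch ::
  "(nat \<Rightarrow> complex) \<Rightarrow> nat \<Rightarrow> (nat \<Rightarrow> nat) \<Rightarrow> (nat \<Rightarrow> complex) \<Rightarrow> (complex \<Rightarrow> complex) \<Rightarrow> complex
   \<Rightarrow> complex set \<Rightarrow> (complex \<Rightarrow> complex) \<Rightarrow> bool" where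
  "Lambda_branch \<omega> M r \<delta> \<Xi> q U g \<longleftrightarrow>
     open U \<and> connected U \<and> U \<noteq> {} \<and> U \<inter> singular_points \<omega> M \<delta> = {} \<and> (\<forall>x\<in>U. \<Xi> x \<noteq> 0) \<and>
     (\<exists>p t F.
        (\<forall>k\<in>{1..M}. p k holomorphic_on U \<and>
           (\<forall>x\<in>U. p k x ^ 2 = weierstrass_p \<omega> x - weierstrass_p \<omega> (\<delta> k))) \<and>
        t holomorphic_on U \<and> (\<forall>x\<in>U. t x ^ 2 = \<Xi> x) \<and>
        (\<forall>x\<in>U. (F has_field_derivative q / \<Xi> x) (at x)) \<and>
        (\<forall>x\<in>U. g x = (\<Prod>k=1..M. p k x ^ r k) * t x * exp (F x)))"

definition l_tilde :: "(nat \<Rightarrow> nat) \<Rightarrow> nat \<Rightarrow> (nat \<Rightarrow> nat) \<Rightarrow> nat \<Rightarrow> nat" where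
  "l_tilde l M r i = (if i = 0 then l 0 + (\<Sum>k=1..M. r k) else l i)"

text \<open>
  Equality with (A), resp. (B), is equality of meromorphic functions: it is stated at all \<open>x\<close> that are
  not half-periods modulo the lattice, the only possible poles of the right-hand sides.
\<close>
definition half_period_points :: "(nat \<Rightarrow> complex) \<Rightarrow> complex set" where
  "half_period_points \<omega> = {x. \<exists>i\<le>3. x + \<omega> i \<in> period_lattice \<omega>}"

definition expression_A ::
  "(nat \<Rightarrow> complex) \<Rightarrow> (nat \<Rightarrow> nat) \<Rightarrow> (complex \<Rightarrow> complex) \<Rightarrow> complex \<Rightarrow> complex
   \<Rightarrow> (nat \<Rightarrow> nat \<Rightarrow> complex) \<Rightarrow> bool" where
  "expression_A \<omega> lt \<Lambda> \<alpha> \<kappa> b \<longleftrightarrow>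
     \<alpha> \<notin> period_lattice \<omega> \<and>
     (\<forall>x. x \<notin> half_period_points \<omega> \<longrightarrow>
        \<Lambda> x = exp (\<kappa> * x) * (\<Sum>i\<le>3. \<Sum>j<lt i. b i j * (deriv ^^ j) (Phi \<omega> i \<alpha>) x))"

text \<open>The sum over \<open>j = 0, \<dots>, lt i - 2\<close> is empty if \<open>lt i \<le> 1\<close>, as is \<open>{..< lt i - 1}\<close> with
  truncated subtraction.\<close>
definition expression_B ::
  "(nat \<Rightarrow> complex) \<Rightarrow> (nat \<Rightarrow> nat) \<Rightarrow> (complex \<Rightarrow> complex) \<Rightarrow> complex \<Rightarrow> complex
   \<Rightarrow> (nat \<Rightarrow> nat \<Rightarrow> complex) \<Rightarrow> (nat \<Rightarrow> complex) \<Rightarrow> bool" where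
  "expression_B \<omega> lt \<Lambda> \<kappa> c b cc \<longleftrightarrow>
     (\<forall>x. x \<notin> half_period_points \<omega> \<longrightarrow>
        \<Lambda> x = exp (\<kappa> * x) *
          (c + (\<Sum>i\<le>3. \<Sum>j<lt i - 1. b i j * (deriv ^^ j) (\<lambda>y. weierstrass_p \<omega> (y + \<omega> i)) x)
             + (\<Sum>i=1..3. cc i * deriv (weierstrass_p \<omega>) x
                               / (weierstrass_p \<omega> x - weierstrass_p \<omega> (\<omega> i)))))"

end

theory Submission
  imports Defs
begin

text \<open>
  Write \<open>f = sqrt \<Xi> \<cdot> exp (\<integral> q / \<Xi>)\<close>. Its logarithmic derivative is \<open>y = \<Xi>' / (2 \<Xi>) + q / \<Xi>\<close>, and the
  formula that defines \<open>Q\<close>, together with \<open>q\<^sup>2 = - Q\<close>, says exactly that \<open>y' + y\<^sup>2 = v - E\<close>. So the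
  logarithmic derivative of \<open>\<Lambda>\<^sub>g = \<Psi>\<^sub>g f\<close> is the elliptic function \<open>Y = y + u\<close> with
  \<open>u = \<Psi>\<^sub>g' / \<Psi>\<^sub>g\<close>, and everything can be read off from its poles.

  \<^emph>\<open>Residues.\<close> If \<open>(x - a)\<^sup>2 (v x - E)\<close> tends to \<open>\<ell> (\<ell> + 1)\<close> at \<open>a\<close>, the Riccati equation leaves \<open>y\<close> at
  most a simple pole there, with residue \<open>- \<ell>\<close> or \<open>\<ell> + 1\<close> (\<open>riccati_exponent\<close>). Here \<open>\<ell> = l\<^sub>i\<close> at
  the half-period \<open>\<omega>\<^sub>i\<close>, \<open>\<ell> = r\<^sub>k / 2\<close> at \<open>\<plusminus>\<delta>\<^sub>k\<close>, and \<open>\<ell> = 0\<close> elsewhere; \<open>u\<close> contributes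
  \<open>- (r\<^sub>1 + \<dots> + r\<^sub>M)\<close> at \<open>0\<close> and \<open>r\<^sub>k / 2\<close> at \<open>\<plusminus>\<delta>\<^sub>k\<close>. Hence all residues of \<open>Y\<close> are integers, at
  least \<open>- l_tilde i\<close> at \<open>\<omega>\<^sub>i\<close> and nonnegative away from the half-periods (\<open>exponent_integral\<close>).

  \<^emph>\<open>Integration.\<close> Let \<open>n\<^sub>a\<close> be these residues, \<open>a\<close> running over the poles modulo the lattice. By
  Liouville's theorem \<open>Y x - \<Sum> n\<^sub>a \<zeta> (x - a)\<close> is a polynomial of degree at most one. As
  \<open>\<omega>\<^sub>1 \<eta>\<^sub>3 \<noteq> \<omega>\<^sub>3 \<eta>\<^sub>1\<close> (\<open>legendre_nondegenerate\<close>), comparing quasi-periods shows that it is a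
  constant \<open>\<kappa>\<close> and that \<open>\<Sum> n\<^sub>a = 0\<close>. So \<open>\<Lambda>\<^sub>g\<close> is a multiple of \<open>exp (\<kappa> x) \<cdot> \<Prod> \<sigma> (x - a) ^ n\<^sub>a\<close>. It is
  meromorphic, its poles are half-periods of order at most \<open>l_tilde i\<close>, and
  \<open>\<Lambda>\<^sub>g (x + 2 \<omega>\<^sub>j) = exp (2 \<omega>\<^sub>j \<kappa> - 2 \<eta>\<^sub>j \<alpha>) \<Lambda>\<^sub>g x\<close> with \<open>\<alpha> = \<Sum> n\<^sub>a a\<close>
  (\<open>elliptic_logderiv_integrate\<close>).

  \<^emph>\<open>Expansion.\<close> If \<open>\<alpha>\<close> is not a period, the functions \<open>\<Phi>\<^sub>i(x, \<alpha>)\<close>, times a suitable exponential, have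
  the multipliers of \<open>\<Lambda>\<^sub>g\<close>, and their derivatives realise every principal part. What remains after
  removing all poles, divided by \<open>\<Phi>\<^sub>0\<close>, is an elliptic function with at most one simple pole and a
  zero at \<open>0\<close>; it vanishes, and this is (A) (\<open>expression_A_exists\<close>). If \<open>\<alpha>\<close> is a period, the
  multipliers are those of an exponential, and dividing by it makes \<open>\<Lambda>\<^sub>g\<close> elliptic. The derivatives of
  \<open>\<wp> (x + \<omega>\<^sub>i)\<close> remove the poles of order at least two, \<open>\<wp>' / (\<wp> - e\<^sub>i)\<close> the simple poles at
  \<open>\<omega>\<^sub>1, \<omega>\<^sub>2, \<omega>\<^sub>3\<close>, and again at most one simple pole is left, so the rest is constant: this is (B)
  (\<open>expression_B_exists\<close>). The stated multipliers are those of the right-hand sides of (A) and (B); they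
  agree with those of \<open>\<Lambda>\<^sub>g\<close> because \<open>\<Lambda>\<^sub>g\<close> does not vanish identically.

  The facts on \<open>\<wp>\<close>, \<open>\<zeta>\<close> and \<open>\<sigma>\<close> are derived from their defining series and product. Contour integrals
  are avoided: Liouville's theorem for functions that are periodic up to additive constants does the
  work of the residue theorem on a period parallelogram.
\<close>

section \<open>The period lattice\<close>

locale half_periods =
  fixes \<omega> :: "nat \<Rightarrow> complex"
  assumes omega_0: "\<omega> 0 = 0" and omega_2: "\<omega> 2 = - \<omega> 1 - \<omega> 3"
    and omega_neq: "\<omega> 1 \<noteq> \<omega> 3" and omega_indep: "independent {\<omega> 1, \<omega> 3}"
begin

abbreviation Lat :: "complex set" where "Lat \<equiv> period_lattice \<omega>"
abbreviation wp :: "complex \<Rightarrow> complex" where "wp \<equiv> weierstrass_p \<omega>"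
abbreviation wz :: "complex \<Rightarrow> complex" where "wz \<equiv> weierstrass_zeta \<omega>"
abbreviation ws :: "complex \<Rightarrow> complex" where "ws \<equiv> weierstrass_sigma \<omega>"

definition of_coords :: "real \<times> real \<Rightarrow> complex" where
  "of_coords p = of_real (fst p) * (2 * \<omega> 1) + of_real (snd p) * (2 * \<omega> 3)"

lemma linear_of_coords: "linear of_coords"
  by (rule linearI) (auto simp: of_coords_def algebra_simps scaleR_conv_of_real)

lemma inj_of_coords: "inj of_coords"
proof -
  have "p = 0" if "of_coords p = 0" for p
  proof -
    obtain a b where p: "p = (a, b)" by (cases p)
    have *: "a *\<^sub>R \<omega> 1 + b *\<^sub>R \<omega> 3 = 0"
    proof -
      have "2 * (of_real a * \<omega> 1 + of_real b * \<omega> 3) = of_coords p"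
        by (simp add: p of_coords_def algebra_simps)
      also have "\<dots> = 0" by fact
      finally show ?thesis
        by (simp only: scaleR_conv_of_real mult_eq_0_iff) simp
    qed
    have "a = 0 \<and> b = 0"
    proof (rule ccontr)
      assume "\<not> ?thesis"
      moreover have "(\<Sum>v\<in>{\<omega> 1, \<omega> 3}. (if v = \<omega> 1 then a else b) *\<^sub>R v) = 0"
        using * omega_neq by simp
      ultimately have "dependent {\<omega> 1, \<omega> 3}"
        using omega_neq 
        by (subst dependent_finite) (auto intro!: exI[of _ "\<lambda>v. if v = \<omega> 1 then a else b"])
      thus False using omega_indep by blast
    qed
    thus ?thesis by (simp add: p zero_prod_def)
  qed
  thus ?thesis using linear_injective_0[OF linear_of_coords] by blast
qed

lemma surj_of_coords: "surj of_coords"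
  using eucl.linear_injective_imp_surjective[of of_coords] linear_of_coords inj_of_coords
  by (auto simp: linear_conv_bounded_linear)

lemma Lat_eq: "Lat = {of_coords (of_int m, of_int n) | m n. True}"
proof -
  have "2 * of_int m * \<omega> 1 + 2 * of_int n * \<omega> 3 = of_coords (of_int m, of_int n)" for m n
    by (simp add: of_coords_def algebra_simps)
  thus ?thesis unfolding period_lattice_def by simp
qed

lemma Lat_0 [simp]: "0 \<in> Lat"
  unfolding period_lattice_def by (auto intro!: exI[of _ 0])

lemma Lat_add: "w \<in> Lat \<Longrightarrow> v \<in> Lat \<Longrightarrow> w + v \<in> Lat"
proof -
  assume "w \<in> Lat" "v \<in> Lat"
  then obtain m n m' n' where "w = 2 * of_int m * \<omega> 1 + 2 * of_int n * \<omega> 3"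
    "v = 2 * of_int m' * \<omega> 1 + 2 * of_int n' * \<omega> 3"
    unfolding period_lattice_def by blast
  hence "w + v = 2 * of_int (m+m') * \<omega> 1 + 2 * of_int (n+n') * \<omega> 3"
    by (simp add: algebra_simps)
  thus ?thesis unfolding period_lattice_def by blast
qed

lemma Lat_uminus: "w \<in> Lat \<Longrightarrow> - w \<in> Lat"
proof -
  assume "w \<in> Lat"
  then obtain m n where "w = 2 * of_int m * \<omega> 1 + 2 * of_int n * \<omega> 3"
    unfolding period_lattice_def by blast
  hence "- w = 2 * of_int (-m) * \<omega> 1 + 2 * of_int (-n) * \<omega> 3"
    by (simp add: algebra_simps)
  thus ?thesis unfolding period_lattice_def by blast
qed

lemma Lat_diff: "w \<in> Lat \<Longrightarrow> v \<in> Lat \<Longrightarrow> w - v \<in> Lat"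
  using Lat_add[of w "-v"] Lat_uminus by simp

lemma Lat_uminus_iff [simp]: "- w \<in> Lat \<longleftrightarrow> w \<in> Lat"
  using Lat_uminus[of w] Lat_uminus[of "-w"] by auto

lemma Lat_add_iff: "w \<in> Lat \<Longrightarrow> z + w \<in> Lat \<longleftrightarrow> z \<in> Lat"
  using Lat_add[of z w] Lat_diff[of "z+w" w] by auto

lemma Lat_diff_iff: "w \<in> Lat \<Longrightarrow> z - w \<in> Lat \<longleftrightarrow> z \<in> Lat"
  using Lat_add_iff[of "-w" z] by simp

lemma Lat_diff_commute: "a - b \<in> Lat \<longleftrightarrow> b - a \<in> Lat"
  using Lat_uminus_iff[of "a - b"] by simp

lemma two_omega_in_Lat: "j \<in> {1, 3} \<Longrightarrow> 2 * \<omega> j \<in> Lat"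
  unfolding period_lattice_def by (auto intro: exI[of _ 0] exI[of _ 1])

lemma two_omega_in_Lat': "i \<le> 3 \<Longrightarrow> 2 * \<omega> i \<in> Lat"
proof -
  assume "i \<le> 3"
  hence "i = 0 \<or> i = 1 \<or> i = 2 \<or> i = 3" by auto
  moreover have "2 * \<omega> 2 = - (2 * \<omega> 1) - 2 * \<omega> 3" by (simp add: omega_2)
  ultimately show ?thesis 
    using two_omega_in_Lat[of 1] two_omega_in_Lat[of 3] Lat_diff[of "-(2 * \<omega> 1)" "2 * \<omega> 3"]
    by (auto simp: omega_0)
qed

lemma of_coords_in_Lat_iff: "of_coords (a, b) \<in> Lat \<longleftrightarrow> a \<in> \<int> \<and> b \<in> \<int>"
proof
  assume "of_coords (a, b) \<in> Lat"
  then obtain m n :: int where "of_coords (a,b) = of_coords (of_int m, of_int n)"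
    unfolding Lat_eq by auto
  hence "(a, b) = (of_int m, of_int n)" using inj_of_coords by (simp add: inj_def)
  thus "a \<in> \<int> \<and> b \<in> \<int>" by auto
next
  assume "a \<in> \<int> \<and> b \<in> \<int>"
  thus "of_coords (a, b) \<in> Lat" unfolding Lat_eq by (auto elim!: Ints_cases)
qed

text \<open>
  The half-periods have the coordinates \<open>(0,0)\<close>, \<open>(1/2,0)\<close>, \<open>(-1/2,-1/2)\<close>, \<open>(0,1/2)\<close>, which
  are incongruent modulo the integers.
\<close>
lemma omega_diff_notin_Lat:
  assumes "i \<le> 3" "j \<le> 3" "i \<noteq> j"
  shows "\<omega> i - \<omega> j \<notin> Lat"
proof -
  have eqs: "\<omega> 0 = of_coords (0,0)" "\<omega> 1 = of_coords (1/2,0)" "\<omega> 2 = of_coords (-1/2,-1/2)" "\<omega> 3 = of_coords (0,1/2)"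
    by (auto simp: of_coords_def omega_0 omega_2)
  have sub: "of_coords p - of_coords q = of_coords (p - q)" for p q
    using linear_diff[OF linear_of_coords, of p q] by simp
  have h: "1/2 \<notin> (\<int> :: real set)" "-(1/2) \<notin> (\<int> :: real set)"
     by (auto elim!: Ints_cases simp: field_simps)
  have "i = 0 \<or> i = 1 \<or> i = 2 \<or> i = 3" "j = 0 \<or> j = 1 \<or> j = 2 \<or> j = 3" using assms by auto
  with \<open>i \<noteq> j\<close> h show ?thesis
    by (elim disjE; simp only: eqs sub diff_Pair of_coords_in_Lat_iff; simp)
qed

lemma omega_notin_Lat: "i \<in> {1..3} \<Longrightarrow> \<omega> i \<notin> Lat"
  using omega_diff_notin_Lat[of i 0] by (auto simp: omega_0)

text \<open>
  A half-open period parallelogram. That it contains only one point of each residue class is used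
  to count every pole once, that it lies in a compact set to bound periodic functions.
\<close>
lemma fundamental_domain:
  obtains R K where "R \<subseteq> K" "compact K" "\<And>z. \<exists>w\<in>Lat. z + w \<in> R" 
    "\<And>a b. a \<in> R \<Longrightarrow> b \<in> R \<Longrightarrow> a - b \<in> Lat \<Longrightarrow> a = b"
proof
  show "of_coords ` ({0..<1} \<times> {0..<1}) \<subseteq> of_coords ` (cbox (0,0) (1,1))"
    by (intro image_mono) (auto simp: cbox_Pair_eq)
  show "compact (of_coords ` (cbox (0,0) (1,1)))"
    by (intro compact_continuous_image linear_continuous_on linear_conv_bounded_linear[THEN iffD1] linear_of_coords compact_cbox)
  fix z
  obtain a b where z: "z = of_coords (a, b)" using surj_of_coords by (metis surjE surj_pair)
  have "of_coords (a,b) + of_coords (of_int (-\<lfloor>a\<rfloor>), of_int (-\<lfloor>b\<rfloor>)) = of_coords (frac a, frac b)"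
    using linear_add[OF linear_of_coords, of "(a,b)" "(of_int (-\<lfloor>a\<rfloor>), of_int (-\<lfloor>b\<rfloor>))"] by (simp add: frac_def)
  moreover have "(frac a, frac b) \<in> {0..<1} \<times> {0..<1}"
    by (auto simp: frac_lt_1)
  moreover have "of_coords (of_int (-\<lfloor>a\<rfloor>), of_int (-\<lfloor>b\<rfloor>)) \<in> Lat" by (simp add: of_coords_in_Lat_iff)
  ultimately show "\<exists>w\<in>Lat. z + w \<in> of_coords ` ({0..<1} \<times> {0..<1})"
    unfolding z by (metis image_eqI)
next
  fix a b assume ab: "a \<in> of_coords ` ({0..<1} \<times> {0..<1})" "b \<in> of_coords ` ({0..<1} \<times> {0..<1})" "a - b \<in> Lat"
  then obtain p q p' q' where *: "a = of_coords (p, q)" "b = of_coords (p', q')" 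
    "0 \<le> p" "p < 1" "0 \<le> q" "q < 1" "0 \<le> p'" "p' < 1" "0 \<le> q'" "q' < 1" by auto
  have "of_coords (p - p', q - q') \<in> Lat"
    using ab(3) linear_diff[OF linear_of_coords, of "(p, q)" "(p', q')"] by (simp add: *)
  hence i: "p - p' \<in> \<int>" "q - q' \<in> \<int>" by (auto simp: of_coords_in_Lat_iff)
  have small: "x = 0" if "x \<in> \<int>" "-1 < x" "x < 1" for x :: real
    using that by (auto elim!: Ints_cases)
  have "p - p' = 0" by (rule small[OF i(1)]) (use * in linarith)+
  moreover have "q - q' = 0" by (rule small[OF i(2)]) (use * in linarith)+
  ultimately have "p = p'" "q = q'" by auto
  thus "a = b" by (simp add: *)
qed

lemma summable_on_int_powr: "(\<lambda>m::int. (1 + \<bar>of_int m\<bar>) powr (-3/2) :: real) summable_on UNIV"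
proof -
  have "summable (\<lambda>n::nat. of_nat n powr (-3/2) :: real)" by (simp add: summable_real_powr_iff)
  hence "summable (\<lambda>n::nat. of_nat (Suc n) powr (-3/2) :: real)" by (subst summable_Suc_iff)
  hence s: "(\<lambda>n::nat. (1 + real n) powr (-3/2)) summable_on UNIV"
    by (subst summable_on_UNIV_nonneg_real_iff) (auto simp: add_ac)
  have "(\<lambda>m::int. (1 + \<bar>of_int m\<bar>) powr (-3/2) :: real) summable_on (range int)"
    by (subst summable_on_reindex) (use s in \<open>auto simp: o_def\<close>)
  moreover have "(\<lambda>m::int. (1 + \<bar>of_int m\<bar>) powr (-3/2) :: real) summable_on (range (\<lambda>n. - int n))"
    by (subst summable_on_reindex) (use s in \<open>auto simp: o_def inj_def\<close>)
  ultimately have "(\<lambda>m::int. (1 + \<bar>of_int m\<bar>) powr (-3/2) :: real) summable_on (range int \<union> range (\<lambda>n. - int n))"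
    by (rule summable_on_union)
  also have "range int \<union> range (\<lambda>n. - int n) = UNIV"
    by (metis (no_types, lifting) UNIV_eq_I UnI1 UnI2 int_cases2 rangeI)
  finally show ?thesis .
qed

text \<open>
  Since \<open>\<omega>\<^sub>1, \<omega>\<^sub>3\<close> are independent, the norm of the lattice point with coordinates \<open>(m, n)\<close>
  dominates a multiple of the Euclidean norm of \<open>(m, n)\<close>, hence of \<open>sqrt ((1 + |m|) (1 + |n|))\<close>. This
  reduces the double sum to a product of two convergent single sums.
\<close>
lemma summable_Lat_cube: "(\<lambda>w. 1 / norm w ^ 3) summable_on (Lat - {0})"
proof -
  obtain B where B: "B > 0" "\<And>x. B * norm x \<le> norm (of_coords x)"
    using linear_inj_bounded_below_pos[OF linear_of_coords inj_of_coords] by blast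
  define G where "G = (\<lambda>p::int\<times>int. of_coords (of_int (fst p), of_int (snd p)))"
  have injG: "inj_on G (UNIV - {(0,0)})"
    by (auto simp: G_def inj_on_def dest!: injD[OF inj_of_coords])
  have imG: "Lat - {0} = G ` (UNIV - {(0,0)})"
  proof -
    have "G p = 0 \<longleftrightarrow> p = (0,0)" for p
    proof -
      have "G p = 0 \<longleftrightarrow> of_coords (of_int (fst p), of_int (snd p)) = of_coords (0,0)" by (simp add: G_def of_coords_def)
      also have "\<dots> \<longleftrightarrow> (of_int (fst p), of_int (snd p)) = (0::real,0::real)" using inj_of_coords by (metis injD)
      finally show ?thesis by (cases p) auto
    qed
    moreover have "Lat = range G" unfolding Lat_eq by (auto simp: G_def image_def)
    ultimately show ?thesis by auto
  qed
  define h where "h = (\<lambda>m::int. (1 + \<bar>of_int m\<bar>) powr (-3/2) :: real)"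
  have "(\<lambda>x. case x of (m, n) \<Rightarrow> h m * h n) summable_on UNIV \<times> UNIV"
  proof (rule summable_on_SigmaI)
    show "((\<lambda>n. case (m, n) of (m, n) \<Rightarrow> h m * h n) has_sum (h m * infsum h UNIV)) UNIV" for m
      using has_sum_cmult_right[OF has_sum_infsum[OF summable_on_int_powr], of "h m"] by (simp add: h_def)
    show "(\<lambda>m. h m * infsum h UNIV) summable_on UNIV"
      using summable_on_cmult_left[OF summable_on_int_powr] by (simp add: h_def)
  qed (auto simp: h_def)
  hence s1: "(\<lambda>x. case x of (m, n) \<Rightarrow> h m * h n) summable_on UNIV - {(0,0)}"
    by (rule summable_on_subset_banach) auto
  have "(\<lambda>p. 1 / norm (G p) ^ 3) summable_on UNIV - {(0,0)}"
  proof (rule summable_on_comparison_test)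
    show "(\<lambda>x. 8 / B ^ 3 * (case x of (m, n) \<Rightarrow> h m * h n)) summable_on UNIV - {(0,0)}"
      by (intro summable_on_cmult_right s1)
  next
    fix p :: "int \<times> int" assume "p \<in> UNIV - {(0,0)}"
    then obtain m n where p: "p = (m, n)" and nz: "m \<noteq> 0 \<or> n \<noteq> 0" by (cases p) auto
    define N where "N = norm (real_of_int m, real_of_int n)"
    have N: "\<bar>real_of_int m\<bar> \<le> N" "\<bar>real_of_int n\<bar> \<le> N" 
      unfolding N_def using norm_fst_le[of "real_of_int m" "real_of_int n"] norm_snd_le[of "real_of_int n" "real_of_int m"] by auto
    have N1: "N \<ge> 1"
    proof -
      have "\<bar>real_of_int m\<bar> \<ge> 1 \<or> \<bar>real_of_int n\<bar> \<ge> 1" using nz by linarith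
      thus ?thesis using N by linarith
    qed
    have "(1 + \<bar>real_of_int m\<bar>) * (1 + \<bar>real_of_int n\<bar>) \<le> (2 * N) * (2 * N)"
      using N N1 by (intro mult_mono) auto
    also have "\<dots> = (2 * N) powr 2" using N1 by (simp add: power2_eq_square)
    finally have "((1 + \<bar>real_of_int m\<bar>) * (1 + \<bar>real_of_int n\<bar>)) powr (3/2) \<le> ((2 * N) powr 2) powr (3/2)"
      by (intro powr_mono2) auto
    also have "\<dots> = (2 * N) powr 3" by (subst powr_powr) simp
    also have "\<dots> = 8 * N ^ 3" using N1 by (subst powr_numeral) (auto simp: power_mult_distrib)
    finally have a: "((1 + \<bar>real_of_int m\<bar>) * (1 + \<bar>real_of_int n\<bar>)) powr (3/2) \<le> 8 * N ^ 3" .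
    have hh: "h m * h n = 1 / ((1 + \<bar>real_of_int m\<bar>) * (1 + \<bar>real_of_int n\<bar>)) powr (3/2)"
      by (simp add: h_def powr_minus_divide powr_mult)
    have "1 / norm (G p) ^ 3 \<le> 1 / (B * N) ^ 3"
    proof -
      have "0 < B * N" using B N1 by simp
      moreover have "B * N \<le> norm (G p)" using B(2) by (simp add: N_def G_def p)
      ultimately show ?thesis by (intro frac_le power_mono) (auto simp del: zero_less_mult_iff)
    qed
    also have "\<dots> = 8 / B ^ 3 * (1 / (8 * N ^ 3))" using B N1 by (simp add: field_simps)
    also have "\<dots> \<le> 8 / B ^ 3 * (h m * h n)"
      unfolding hh using a B N1 by (intro mult_left_mono divide_left_mono) (auto intro!: mult_pos_pos)
    finally show "1 / norm (G p) ^ 3 \<le> 8 / B ^ 3 * (case p of (m, n) \<Rightarrow> h m * h n)" by (simp add: p)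
  qed auto
  thus ?thesis unfolding imG by (subst summable_on_reindex[OF injG]) (simp add: o_def)
qed

end

section \<open>The Weierstrass functions as lattice sums and products\<close>

text \<open>
  A derivative written as \<open>a * f x\<close> exhibits \<open>a\<close> as a logarithmic derivative, also at zeros of \<open>f\<close>.
  Logarithmic derivatives add, subtract and scale under products, quotients and powers.
\<close>
lemma logderiv_mult:
  fixes f g :: "complex \<Rightarrow> complex"
  assumes "(f has_field_derivative a * f x) (at x)" "(g has_field_derivative b * g x) (at x)"
  shows "((\<lambda>x. f x * g x) has_field_derivative (a + b) * (f x * g x)) (at x)"
  using DERIV_mult[OF assms] by (simp add: algebra_simps)

lemma logderiv_divide:
  fixes f g :: "complex \<Rightarrow> complex"
  assumes "(f has_field_derivative a * f x) (at x)" "(g has_field_derivative b * g x) (at x)" "g x \<noteq> 0"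
  shows "((\<lambda>x. f x / g x) has_field_derivative (a - b) * (f x / g x)) (at x)"
proof -
  have "(a * f x * g x - f x * (b * g x)) / (g x * g x) = (a - b) * (f x / g x)"
    using assms(3) by (simp add: algebra_simps diff_divide_distrib)
  thus ?thesis using DERIV_divide[OF assms] by (simp only:)
qed

lemma logderiv_power:
  fixes f :: "complex \<Rightarrow> complex"
  assumes "(f has_field_derivative a * f x) (at x)"
  shows "((\<lambda>x. f x ^ n) has_field_derivative (of_nat n * a) * f x ^ n) (at x)"
proof -
  have "of_nat n * (a * f x * f x ^ (n - Suc 0)) = (of_nat n * a) * f x ^ n"
    by (cases n) (simp_all add: mult_ac)
  thus ?thesis using DERIV_power[OF assms, of n] by (simp only:)
qed

lemma logderiv_exp: "((\<lambda>x. exp (c * x)) has_field_derivative c * exp (c * x)) (at x)" for c :: complex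
  unfolding mult.commute[of c "exp (c * x)"] by (rule DERIV_fun_exp[OF DERIV_cmult_Id])

lemma logderiv_prod:
  fixes f :: "'a \<Rightarrow> complex \<Rightarrow> complex"
  assumes "finite A" "\<And>a. a \<in> A \<Longrightarrow> (f a has_field_derivative d a * f a x) (at x)"
  shows "((\<lambda>x. \<Prod>a\<in>A. f a x) has_field_derivative (\<Sum>a\<in>A. d a) * (\<Prod>a\<in>A. f a x)) (at x)"
  using assms
proof (induction A rule: finite_induct)
  case (insert b A)
  have "((\<lambda>x. f b x * (\<Prod>a\<in>A. f a x)) has_field_derivative (d b + (\<Sum>a\<in>A. d a)) * (f b x * (\<Prod>a\<in>A. f a x))) (at x)"
    by (intro logderiv_mult insert) auto
  thus ?case using insert.hyps by simp
qed auto

context half_periods begin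

definition lat_enum :: "nat \<Rightarrow> complex" where "lat_enum = from_nat_into (Lat - {0})"

lemma countable_Lat: "countable Lat"
proof -
  have "Lat = (\<lambda>(m,n). of_coords (of_int m, of_int n)) ` UNIV"
    unfolding Lat_eq by (auto simp: image_def)
  thus ?thesis by simp
qed

lemma infinite_Lat: "infinite Lat"
proof
  assume "finite Lat"
  hence "finite ((\<lambda>m::int. of_coords (of_int m, 0)) ` UNIV)"
    by (rule finite_subset[rotated]) (auto simp: of_coords_in_Lat_iff)
  moreover have "inj (\<lambda>m::int. of_coords (of_int m, 0))"
    by (auto simp: inj_def dest: injD[OF inj_of_coords])
  ultimately show False using finite_imageD by fastforce
qed

lemma bij_lat_enum: "bij_betw lat_enum UNIV (Lat - {0})"
  unfolding lat_enum_def using countable_Lat infinite_Lat by (intro bij_betw_from_nat_into) auto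

lemma range_lat_enum: "range lat_enum = Lat - {0}"
  using bij_lat_enum by (simp add: bij_betw_def)

lemma summable_lat_enum: "summable (\<lambda>n. 1 / norm (lat_enum n) ^ 3)"
proof -
  have "(\<lambda>n. 1 / norm (lat_enum n) ^ 3) summable_on UNIV"
    using summable_on_reindex_bij_betw[OF bij_lat_enum, of "\<lambda>w. 1 / norm w ^ 3"] summable_Lat_cube by simp
  thus ?thesis by (rule summable_on_imp_summable)
qed

lemma filterlim_lat_enum: "filterlim lat_enum at_infinity at_top"
proof -
  have nz: "lat_enum n \<noteq> 0" for n using range_lat_enum by (metis Diff_iff insertI1 rangeI)
  have "(\<lambda>n. 1 / norm (lat_enum n) ^ 3) \<longlonglongrightarrow> 0" by (rule summable_LIMSEQ_zero[OF summable_lat_enum])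
  hence "filterlim (\<lambda>n. inverse (1 / norm (lat_enum n) ^ 3)) at_top sequentially"
    by (rule filterlim_inverse_at_top) (use nz in auto)
  hence lim: "filterlim (\<lambda>n. norm (lat_enum n) ^ 3) at_top sequentially" by simp
  have "eventually (\<lambda>n. norm (lat_enum n) > R) sequentially" for R
  proof -
    have "eventually (\<lambda>n. norm (lat_enum n) ^ 3 > \<bar>R\<bar> ^ 3) sequentially"
      using lim unfolding filterlim_at_top_dense by (rule spec)
    thus ?thesis
    proof eventually_elim
      case (elim n)
      hence "\<bar>R\<bar> < norm (lat_enum n)" by (rule power_less_imp_less_base) simp
      thus ?case by simp
    qed
  qed
  hence "filterlim (\<lambda>n. norm (lat_enum n)) at_top sequentially"
    by (simp add: filterlim_at_top_dense)
  thus ?thesis by (rule filterlim_norm_at_top_imp_at_infinity)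
qed

text \<open>
  So \<open>W.f\<close> is \<open>\<sigma> z / z\<close>, an entire function with simple zeros at the nonzero periods.
\<close>
sublocale W: weierstrass_product lat_enum "\<lambda>_. 2"
proof
  show "lat_enum n \<noteq> 0" for n using range_lat_enum by (metis Diff_iff insertI1 rangeI)
  show "summable (\<lambda>n. (r / norm (lat_enum n)) ^ Suc 2)" if "r > 0" for r :: real
    using summable_mult[OF summable_lat_enum, of "r ^ 3"] by (simp add: power_divide eval_nat_numeral)
qed (rule filterlim_lat_enum)

lemma ws_eq: "ws z = z * W.f z"
  unfolding weierstrass_sigma_def W.f_def lat_enum_def[symmetric] ..

lemma ws_eq_0_iff: "ws z = 0 \<longleftrightarrow> z \<in> Lat"
  using W.zero[of z] range_lat_enum by (auto simp: ws_eq)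

lemma ws_holomorphic: "ws holomorphic_on A"
proof -
  have "ws = (\<lambda>z. z * W.f z)" using ws_eq by auto
  thus ?thesis by (auto intro!: holomorphic_intros)
qed

text \<open>
  The nonzero lattice points are the zeros of an entire function.
\<close>
lemma not_islimpt_Lat: "\<not> z islimpt Lat"
proof -
  have "Lat = insert 0 (range lat_enum)" unfolding range_lat_enum by auto
  thus ?thesis using W.not_islimpt_range_a[of z] by (simp add: islimpt_insert)
qed

lemma closed_Lat: "closed Lat"
  using not_islimpt_Lat closed_limpt by blast

lemma open_Lat_compl: "open (- Lat)"
  using closed_Lat by (simp add: open_Compl)

text \<open>
  Identifies the unordered lattice sums of the definitions with series along the enumeration that
  occurs in the product for \<open>\<sigma>\<close>.
\<close>
lemma Lat_has_sum:
  fixes t :: "complex \<Rightarrow> complex"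
  assumes "eventually (\<lambda>n. norm (t (lat_enum n)) \<le> C / norm (lat_enum n) ^ 3) sequentially"
  shows "(\<lambda>n. t (lat_enum n)) sums (\<Sum>\<^sub>\<infinity>w\<in>Lat - {0}. t w)" "t summable_on (Lat - {0})"
proof -
  have sn: "summable (\<lambda>n. norm (t (lat_enum n)))"
    by (rule summable_comparison_test_ev[OF _ summable_mult[OF summable_lat_enum, of C]])
       (use assms in simp)
  have hs: "((\<lambda>n. t (lat_enum n)) has_sum (\<Sum>n. t (lat_enum n))) UNIV"
    by (rule norm_summable_imp_has_sum[OF sn summable_sums[OF summable_norm_cancel[OF sn]]])
  hence *: "(t has_sum (\<Sum>n. t (lat_enum n))) (Lat - {0})"
    using has_sum_reindex_bij_betw[OF bij_lat_enum, of t] by simp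
  show "t summable_on (Lat - {0})" using * by (auto simp: summable_on_def)
  have "(\<Sum>n. t (lat_enum n)) = (\<Sum>\<^sub>\<infinity>w\<in>Lat - {0}. t w)" using * by (simp add: infsumI)
  thus "(\<lambda>n. t (lat_enum n)) sums (\<Sum>\<^sub>\<infinity>w\<in>Lat - {0}. t w)"
    using has_sum_imp_sums[OF hs] by simp
qed

lemma eventually_lat_enum_large: "eventually (\<lambda>n. norm (lat_enum n) > R) sequentially"
  using filterlim_lat_enum by (metis filterlim_at_infinity_imp_norm_at_top filterlim_at_top_dense)

text \<open>
  For \<open>z\<close> in a fixed disc, all but finitely many lattice points \<open>w\<close> are at least twice as far from \<open>0\<close>.
  Only these matter for convergence.
\<close>
lemma far_lattice_point:
  fixes z w :: complex
  assumes "norm z \<le> R" "norm w > 2 * R"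
  shows "R \<ge> 0" "w \<noteq> 0" "z \<noteq> w" "norm (z - w) \<ge> norm w / 2"
proof -
  show R0: "R \<ge> 0" using assms(1) norm_ge_zero order_trans by blast
  show w: "w \<noteq> 0" using assms R0 by auto
  show zw: "norm (z - w) \<ge> norm w / 2"
    using norm_triangle_ineq2[of w z] assms by (simp add: norm_minus_commute)
  show "z \<noteq> w" using zw w by auto
qed

lemma zeta_term_bound:
  fixes z w :: complex
  assumes "norm z \<le> R" "norm w > 2 * R" 
  shows "norm (1 / (z - w) + 1 / w + z / w ^ 2) \<le> (2 * R ^ 2) / norm w ^ 3"
proof -
  note far = far_lattice_point[OF assms]
  have "1 / (z - w) + 1 / w + z / w ^ 2 = z ^ 2 / (w ^ 2 * (z - w))"
    using far by (simp add: divide_simps) (simp add: power2_eq_square algebra_simps)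
  also have "norm \<dots> = norm z ^ 2 / (norm w ^ 2 * norm (z - w))"
    by (simp add: norm_divide norm_mult norm_power)
  also have "\<dots> \<le> R ^ 2 / (norm w ^ 2 * (norm w / 2))"
    using assms far by (intro frac_le power_mono mult_left_mono) auto
  also have "\<dots> = (2 * R ^ 2) / norm w ^ 3" by (simp add: power2_eq_square power3_eq_cube)
  finally show ?thesis .
qed

lemma wp_term_bound:
  fixes z w :: complex
  assumes "norm z \<le> R" "norm w > 2 * R" 
  shows "norm (1 / (z - w) ^ 2 - 1 / w ^ 2) \<le> (12 * R) / norm w ^ 3"
proof -
  note far = far_lattice_point[OF assms]
  have "1 / (z - w) ^ 2 - 1 / w ^ 2 = (z * (2 * w - z)) / (w ^ 2 * (z - w) ^ 2)"
    using far by (simp add: divide_simps) (simp add: power2_eq_square algebra_simps)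
  also have "norm \<dots> = norm z * norm (2 * w - z) / (norm w ^ 2 * norm (z - w) ^ 2)"
    by (simp add: norm_divide norm_mult norm_power)
  also have "\<dots> \<le> R * (3 * norm w) / (norm w ^ 2 * (norm w / 2) ^ 2)"
  proof (intro frac_le mult_mono power_mono mult_left_mono)
    show "norm (2 * w - z) \<le> 3 * norm w"
      using norm_triangle_ineq4[of "2 * w" z] assms far by (simp add: norm_mult)
  qed (use assms far in auto)
  also have "\<dots> = (12 * R) / norm w ^ 3" using far by (simp add: field_simps eval_nat_numeral)
  finally show ?thesis .
qed

lemma cube_term_bound:
  fixes z w :: complex
  assumes "norm z \<le> R" "norm w > 2 * R" 
  shows "norm (1 / (z - w) ^ 3) \<le> 8 / norm w ^ 3"
proof -
  note far = far_lattice_point[OF assms]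
  have "norm (1 / (z - w) ^ 3) = 1 / norm (z - w) ^ 3" by (simp add: norm_divide norm_power)
  also have "\<dots> \<le> 1 / (norm w / 2) ^ 3"
    using far by (intro divide_left_mono power_mono mult_pos_pos) auto
  also have "\<dots> = 8 / norm w ^ 3" by (simp add: field_simps eval_nat_numeral)
  finally show ?thesis .
qed

lemma wz_sums: "(\<lambda>n. 1 / (z - lat_enum n) + 1 / lat_enum n + z / lat_enum n ^ 2) sums (wz z - 1 / z)"
  using Lat_has_sum(1)[of "\<lambda>w. 1 / (z - w) + 1 / w + z / w ^ 2" "2 * norm z ^ 2"]
    eventually_mono[OF eventually_lat_enum_large[of "2 * norm z"] zeta_term_bound[OF order.refl]]
  by (simp add: weierstrass_zeta_def)

lemma wp_sums: "(\<lambda>n. 1 / (z - lat_enum n) ^ 2 - 1 / lat_enum n ^ 2) sums (wp z - 1 / z ^ 2)"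
  using Lat_has_sum(1)[of "\<lambda>w. 1 / (z - w) ^ 2 - 1 / w ^ 2" "12 * norm z"]
    eventually_mono[OF eventually_lat_enum_large[of "2 * norm z"] wp_term_bound[OF order.refl]]
  by (simp add: weierstrass_p_def)

lemma cube_sums: 
  "(\<lambda>n. 1 / (z - lat_enum n) ^ 3) sums (\<Sum>\<^sub>\<infinity>w\<in>Lat-{0}. 1 / (z - w) ^ 3)"
  "(\<lambda>w. 1 / (z - w) ^ 3) summable_on (Lat-{0})"
  using Lat_has_sum[of "\<lambda>w. 1 / (z - w) ^ 3" "8"]
    eventually_mono[OF eventually_lat_enum_large[of "2 * norm z"] cube_term_bound[OF order.refl]]
  by simp_all

definition zeta_partial :: "nat \<Rightarrow> complex \<Rightarrow> complex" where
  "zeta_partial N z = 1 / z + (\<Sum>n<N. 1 / (z - lat_enum n) + 1 / lat_enum n + z / lat_enum n ^ 2)"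

lemma lat_enum_nz [simp]: "lat_enum n \<noteq> 0" using W.a_nonzero .

lemma lat_enum_Lat [simp]: "lat_enum n \<in> Lat" using range_lat_enum by blast

lemma zeta_partial_holo: "zeta_partial N holomorphic_on - Lat"
  unfolding zeta_partial_def by (intro holomorphic_intros) auto

text \<open>
  Locally uniform convergence of this one series suffices: by Weierstrass' theorem its first and
  second derivatives converge along with it, and these are the series for \<open>- \<wp>\<close> and \<open>- \<wp>'\<close>.
\<close>
lemma uniform_limit_zeta_partial: "uniform_limit (ball 0 R - Lat) zeta_partial wz sequentially"
proof -
  have "uniform_limit (ball 0 R - Lat) (\<lambda>N z. \<Sum>n<N. 1 / (z - lat_enum n) + 1 / lat_enum n + z / lat_enum n ^ 2)
     (\<lambda>z. \<Sum>n. 1 / (z - lat_enum n) + 1 / lat_enum n + z / lat_enum n ^ 2) sequentially"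
  proof (rule Weierstrass_m_test_ev)
    show "\<forall>\<^sub>F n in sequentially. \<forall>z\<in>ball 0 R - Lat. 
       norm (1 / (z - lat_enum n) + 1 / lat_enum n + z / lat_enum n ^ 2) \<le> 2 * R ^ 2 * (1 / norm (lat_enum n) ^ 3)"
      using eventually_lat_enum_large[of "2 * R"]
    proof eventually_elim
      case (elim n)
      show ?case using zeta_term_bound[OF _ elim] by (auto intro: less_imp_le)
    qed
  qed (intro summable_mult summable_lat_enum)
  hence "uniform_limit (ball 0 R - Lat) (\<lambda>N z. 1 / z + (\<Sum>n<N. 1 / (z - lat_enum n) + 1 / lat_enum n + z / lat_enum n ^ 2))
     (\<lambda>z. 1 / z + (\<Sum>n. 1 / (z - lat_enum n) + 1 / lat_enum n + z / lat_enum n ^ 2)) sequentially"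
    by (intro uniform_limit_intros)
  moreover have "(\<Sum>n. 1 / (z - lat_enum n) + 1 / lat_enum n + z / lat_enum n ^ 2) = wz z - 1 / z" for z
    using wz_sums sums_unique by metis
  ultimately show ?thesis by (simp add: zeta_partial_def[abs_def])
qed

lemma wz_holomorphic: "wz holomorphic_on - Lat"
proof (rule holomorphic_uniform_sequence[OF open_Lat_compl zeta_partial_holo])
  fix z assume "z \<in> - Lat"
  then obtain d where d: "d > 0" "cball z d \<subseteq> - Lat"
    using open_Lat_compl open_contains_cball by blast
  have "cball z d \<subseteq> ball 0 (norm z + d + 1) - Lat" 
  proof
    fix x assume x: "x \<in> cball z d"
    have "norm x \<le> norm z + norm (x - z)" using norm_triangle_ineq[of z "x - z"] by simp
    moreover have "x \<notin> Lat" using x d by blast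
    moreover have "norm (x - z) \<le> d" using x by (simp add: dist_norm norm_minus_commute)
    ultimately show "x \<in> ball 0 (norm z + d + 1) - Lat" by auto
  qed
  thus "\<exists>d>0. cball z d \<subseteq> - Lat \<and> uniform_limit (cball z d) zeta_partial wz sequentially"
    using d uniform_limit_on_subset[OF uniform_limit_zeta_partial] by blast
qed

lemma DERIV_inverse_square:
  fixes z w :: complex
  assumes "z \<noteq> w"
  shows "((\<lambda>z. 1 / (z - w) ^ 2) has_field_derivative - 2 * (1 / (z - w) ^ 3)) (at z)"
proof -
  define u where "u = z - w"
  have u: "u \<noteq> 0" using assms by (simp add: u_def)
  have "((\<lambda>z. inverse ((z - w) ^ 2)) has_field_derivative 
     - (inverse ((z - w) ^ 2) * (2 * (z - w)) * inverse ((z - w) ^ 2))) (at z)"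
    by (rule derivative_eq_intros refl | use assms in simp)+
  also have "- (inverse ((z - w) ^ 2) * (2 * (z - w)) * inverse ((z - w) ^ 2)) = - 2 * (1 / (z - w) ^ 3)"
    unfolding u_def[symmetric] using u by (simp add: field_simps power2_eq_square power3_eq_cube)
  finally show ?thesis by (simp add: inverse_eq_divide)
qed

lemma DERIV_inverse_shift:
  fixes z w :: complex
  assumes "z \<noteq> w"
  shows "((\<lambda>z. 1 / (z - w)) has_field_derivative - (1 / (z - w) ^ 2)) (at z)"
proof -
  have "((\<lambda>z. inverse (z - w)) has_field_derivative - (inverse (z - w) * 1 * inverse (z - w))) (at z)"
    by (rule derivative_eq_intros refl | use assms in simp)+
  thus ?thesis by (simp add: inverse_eq_divide power2_eq_square)
qed

lemma zeta_partial_deriv: 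
  assumes "z \<notin> Lat"
  shows "(zeta_partial N has_field_derivative (- 1 / z ^ 2 + (\<Sum>n<N. - (1 / (z - lat_enum n) ^ 2 - 1 / lat_enum n ^ 2)))) (at z)"
proof -
  have [simp]: "z \<noteq> 0" using assms Lat_0 by blast
  have [simp]: "z \<noteq> lat_enum n" for n using assms lat_enum_Lat by blast
  have "((\<lambda>z. 1 / (z - w) + 1 / w + z / w ^ 2) has_field_derivative - (1 / (z - w) ^ 2 - 1 / w ^ 2)) (at z)" 
    if "z \<noteq> w" for w
    using DERIV_add[OF DERIV_add[OF DERIV_inverse_shift[OF that] DERIV_const[of "1 / w"]] 
       DERIV_cdivide[OF DERIV_ident, of "w ^ 2"]] by simp
  hence "((\<lambda>z. \<Sum>n<N. 1 / (z - lat_enum n) + 1 / lat_enum n + z / lat_enum n ^ 2) has_field_derivative 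
       (\<Sum>n<N. - (1 / (z - lat_enum n) ^ 2 - 1 / lat_enum n ^ 2))) (at z)"
    by (intro DERIV_sum) simp
  moreover have "((\<lambda>z. 1 / z) has_field_derivative - 1 / z ^ 2) (at z)"
    using DERIV_inverse_shift[of z 0] by simp
  ultimately show ?thesis unfolding zeta_partial_def by (intro DERIV_add)
qed

lemma zeta_partial_deriv2: 
  assumes "z \<notin> Lat"
  shows "deriv (deriv (zeta_partial N)) z = 2 / z ^ 3 + (\<Sum>n<N. 2 * (1 / (z - lat_enum n) ^ 3))"
proof -
  have [simp]: "z \<noteq> 0" using assms Lat_0 by blast
  have [simp]: "z \<noteq> lat_enum n" for n using assms lat_enum_Lat by blast
  have "deriv (deriv (zeta_partial N)) z = deriv (\<lambda>z. - 1 / z ^ 2 + (\<Sum>n<N. - (1 / (z - lat_enum n) ^ 2 - 1 / lat_enum n ^ 2))) z"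
  proof (rule deriv_cong_ev)
    have "eventually (\<lambda>z. z \<in> - Lat) (nhds z)"
      using assms open_Lat_compl by (intro eventually_nhds_in_open) auto
    thus "\<forall>\<^sub>F z in nhds z. deriv (zeta_partial N) z = - 1 / z ^ 2 + (\<Sum>n<N. - (1 / (z - lat_enum n) ^ 2 - 1 / lat_enum n ^ 2))"
      by eventually_elim (rule DERIV_imp_deriv[OF zeta_partial_deriv], simp)
  qed auto
  also have "\<dots> = 2 / z ^ 3 + (\<Sum>n<N. 2 * (1 / (z - lat_enum n) ^ 3))"
  proof (rule DERIV_imp_deriv)
    have "((\<lambda>z. - (1 / (z - w) ^ 2 - 1 / w ^ 2)) has_field_derivative - (- 2 * (1 / (z - w) ^ 3) - 0)) (at z)" 
      if "z \<noteq> w" for w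
      by (intro DERIV_minus DERIV_diff DERIV_inverse_square that DERIV_const)
    hence "((\<lambda>z. - (1 / (z - w) ^ 2 - 1 / w ^ 2)) has_field_derivative 2 * (1 / (z - w) ^ 3)) (at z)" 
      if "z \<noteq> w" for w using that by simp
    hence "((\<lambda>z. \<Sum>n<N. - (1 / (z - lat_enum n) ^ 2 - 1 / lat_enum n ^ 2)) has_field_derivative 
       (\<Sum>n<N. 2 * (1 / (z - lat_enum n) ^ 3))) (at z)"
      by (intro DERIV_sum) simp
    moreover have "((\<lambda>z. - 1 / z ^ 2) has_field_derivative 2 / z ^ 3) (at z)"
      using DERIV_minus[OF DERIV_inverse_square[of z 0]] by simp
    ultimately show "((\<lambda>z. - 1 / z ^ 2 + (\<Sum>n<N. - (1 / (z - lat_enum n) ^ 2 - 1 / lat_enum n ^ 2))) has_field_derivative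
        2 / z ^ 3 + (\<Sum>n<N. 2 * (1 / (z - lat_enum n) ^ 3))) (at z)"
      by (intro DERIV_add)
  qed
  finally show ?thesis .
qed

lemma deriv_wz_and_deriv_wp:
  assumes "z \<notin> Lat"
  shows "deriv wz z = - wp z" "deriv (deriv wz) z = 2 / z ^ 3 + 2 * (\<Sum>\<^sub>\<infinity>w\<in>Lat-{0}. 1 / (z - w) ^ 3)"
proof -
  define A where "A = ball 0 (norm z + 1) - Lat"
  have A: "open A" "z \<in> A" 
    using assms closed_Lat by (auto simp: A_def)
  have holo: "\<forall>\<^sub>F n in sequentially. zeta_partial n holomorphic_on A"
    by (intro always_eventually allI holomorphic_on_subset[OF zeta_partial_holo]) (auto simp: A_def)
  have ul: "uniform_limit A zeta_partial wz sequentially" unfolding A_def by (rule uniform_limit_zeta_partial)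
  have "(\<lambda>N. (deriv ^^ 1) (zeta_partial N) z) \<longlonglongrightarrow> (deriv ^^ 1) wz z"
    by (rule higher_deriv_complex_uniform_limit[OF ul holo _ A]) auto
  hence 1: "(\<lambda>N. deriv (zeta_partial N) z) \<longlonglongrightarrow> deriv wz z" by simp
  have "(\<lambda>N. - 1 / z ^ 2 + (\<Sum>n<N. - (1 / (z - lat_enum n) ^ 2 - 1 / lat_enum n ^ 2))) \<longlonglongrightarrow> - 1 / z ^ 2 + - (wp z - 1 / z ^ 2)"
    using sums_minus[OF wp_sums[of z]] by (intro tendsto_add tendsto_const) (simp add: sums_def)
  hence "(\<lambda>N. deriv (zeta_partial N) z) \<longlonglongrightarrow> - wp z"
    using DERIV_imp_deriv[OF zeta_partial_deriv[OF assms]] by simp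
  with 1 show "deriv wz z = - wp z" using LIMSEQ_unique by blast
  have "(\<lambda>N. (deriv ^^ 2) (zeta_partial N) z) \<longlonglongrightarrow> (deriv ^^ 2) wz z"
    by (rule higher_deriv_complex_uniform_limit[OF ul holo _ A]) auto
  hence 2: "(\<lambda>N. deriv (deriv (zeta_partial N)) z) \<longlonglongrightarrow> deriv (deriv wz) z" by (simp add: eval_nat_numeral)
  have "(\<lambda>N. 2 / z ^ 3 + (\<Sum>n<N. 2 * (1 / (z - lat_enum n) ^ 3))) \<longlonglongrightarrow> 2 / z ^ 3 + 2 * (\<Sum>\<^sub>\<infinity>w\<in>Lat-{0}. 1 / (z - w) ^ 3)"
    using sums_mult[OF cube_sums(1)[of z], of 2] by (intro tendsto_add tendsto_const) (simp add: sums_def)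
  hence "(\<lambda>N. deriv (deriv (zeta_partial N)) z) \<longlonglongrightarrow> 2 / z ^ 3 + 2 * (\<Sum>\<^sub>\<infinity>w\<in>Lat-{0}. 1 / (z - w) ^ 3)"
    using zeta_partial_deriv2[OF assms] by simp
  with 2 show "deriv (deriv wz) z = 2 / z ^ 3 + 2 * (\<Sum>\<^sub>\<infinity>w\<in>Lat-{0}. 1 / (z - w) ^ 3)"
    using LIMSEQ_unique by blast
qed

lemma wz_deriv: "z \<notin> Lat \<Longrightarrow> (wz has_field_derivative - wp z) (at z)"
  using holomorphic_derivI[OF wz_holomorphic open_Lat_compl, of z] deriv_wz_and_deriv_wp(1)[of z] by simp

lemma wp_holomorphic: "wp holomorphic_on - Lat"
proof -
  have "(\<lambda>z. - deriv wz z) holomorphic_on - Lat"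
    by (intro holomorphic_intros wz_holomorphic open_Lat_compl)
  thus ?thesis by (rule holomorphic_transform) (simp add: deriv_wz_and_deriv_wp)
qed

lemma wp_deriv: 
  assumes "z \<notin> Lat" 
  shows "(wp has_field_derivative (- 2 * (\<Sum>\<^sub>\<infinity>w\<in>Lat. 1 / (z - w) ^ 3))) (at z)"
proof -
  have "deriv wp z = deriv (\<lambda>z. - deriv wz z) z"
  proof (rule deriv_cong_ev)
    have "eventually (\<lambda>z. z \<in> - Lat) (nhds z)"
      using assms open_Lat_compl by (intro eventually_nhds_in_open) auto
    thus "\<forall>\<^sub>F z in nhds z. wp z = - deriv wz z"
      by eventually_elim (auto simp: deriv_wz_and_deriv_wp)
  qed auto
  also have "\<dots> = - deriv (deriv wz) z"
    using holomorphic_derivI[OF holomorphic_deriv[OF wz_holomorphic open_Lat_compl] open_Lat_compl, of z] assms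
    by (intro DERIV_imp_deriv derivative_intros) auto
  also have "\<dots> = - 2 * ((\<Sum>\<^sub>\<infinity>w\<in>Lat-{0}. 1 / (z - w) ^ 3) + 1 / (z - 0) ^ 3)"
    using assms by (simp add: deriv_wz_and_deriv_wp)
  also have "(\<Sum>\<^sub>\<infinity>w\<in>Lat-{0}. 1 / (z - w) ^ 3) + 1 / (z - 0) ^ 3 = (\<Sum>\<^sub>\<infinity>w\<in>insert 0 (Lat-{0}). 1 / (z - w) ^ 3)"
    using infsum_insert[OF cube_sums(2)[of z], of 0] by (simp del: insert_Diff_single)
  also have "insert 0 (Lat-{0}) = Lat" by auto
  finally show ?thesis
    using holomorphic_derivI[OF wp_holomorphic open_Lat_compl, of z] assms by simp
qed

lemma Wf_eq_0_iff: "W.f z = 0 \<longleftrightarrow> z \<in> Lat - {0}"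
  using range_lat_enum by (simp add: W.zero)

text \<open>
  Termwise logarithmic differentiation of the product. The point \<open>z = 0\<close> is included, where the term
  \<open>1 / z\<close> is \<open>0\<close> by convention; this is what gives the behaviour of \<open>\<zeta>\<close> near its pole.
\<close>
lemma Wf_logderiv:
  assumes "W.f z \<noteq> 0"
  shows "(W.f has_field_derivative (wz z - 1 / z) * W.f z) (at z)"
proof -
  have zn: "z \<noteq> lat_enum n" for n using assms W.zero[of z] by blast
  have f0: "W.f z \<noteq> 0" by fact
  have "(\<lambda>k. deriv (\<lambda>z. weierstrass_factor 2 (z / lat_enum k)) z / weierstrass_factor 2 (z / lat_enum k)) sums (deriv W.f z / W.f z)"
  proof (rule logderiv_prodinf_complex_uniform_limit)
    have "uniform_limit (cball 0 (norm z + 1)) (\<lambda>N z. \<Prod>n<N. weierstrass_factor 2 (z / lat_enum n)) W.f sequentially"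
      by (rule W.uniform_limit) (auto intro: add_nonneg_pos)
    thus "uniform_limit (ball 0 (norm z + 1)) (\<lambda>N z. \<Prod>n<N. weierstrass_factor 2 (z / lat_enum n)) W.f sequentially"
      by (rule uniform_limit_on_subset) auto
  qed (use f0 in \<open>auto intro!: holomorphic_intros\<close>)
  also have "(\<lambda>k. deriv (\<lambda>z. weierstrass_factor 2 (z / lat_enum k)) z / weierstrass_factor 2 (z / lat_enum k)) =
     (\<lambda>k. 1 / (z - lat_enum k) + 1 / lat_enum k + z / lat_enum k ^ 2)"
  proof
    fix k
    have fac: "(\<lambda>z. weierstrass_factor 2 (z / lat_enum k)) = (\<lambda>z. (1 - z / lat_enum k) * exp (z / lat_enum k + (z / lat_enum k) ^ 2 / 2))"
    proof -
      have "{1..2::nat} = {1, 2}" by auto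
      thus ?thesis by (simp add: weierstrass_factor_def)
    qed
    have "((\<lambda>z. weierstrass_factor 2 (z / lat_enum k)) has_field_derivative 
       (1 / (z - lat_enum k) + 1 / lat_enum k + z / lat_enum k ^ 2) * weierstrass_factor 2 (z / lat_enum k)) (at z)"
      unfolding fac fun_cong[OF fac]
      by (rule derivative_eq_intros refl | simp)+ 
         (use zn[of k] in \<open>simp add: divide_simps power2_eq_square; simp add: algebra_simps\<close>)
    moreover have "weierstrass_factor 2 (z / lat_enum k) \<noteq> 0" using zn[of k] by simp
    ultimately show "deriv (\<lambda>z. weierstrass_factor 2 (z / lat_enum k)) z / weierstrass_factor 2 (z / lat_enum k) =
      1 / (z - lat_enum k) + 1 / lat_enum k + z / lat_enum k ^ 2"
      by (simp add: DERIV_imp_deriv)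
  qed
  finally have "deriv W.f z / W.f z = wz z - 1 / z" using wz_sums sums_unique2 by blast
  hence "deriv W.f z = (wz z - 1 / z) * W.f z" using f0 by (simp add: divide_eq_eq)
  thus ?thesis
    using holomorphic_derivI[OF W.holomorphic[of UNIV] open_UNIV, of z] by simp
qed

lemma ws_logderiv:
  assumes "z \<notin> Lat" 
  shows "(ws has_field_derivative wz z * ws z) (at z)"
proof -
  have z0: "z \<noteq> 0" using assms Lat_0 by blast
  have d: "(W.f has_field_derivative (wz z - 1 / z) * W.f z) (at z)"
    using assms by (intro Wf_logderiv) (simp add: Wf_eq_0_iff)
  from DERIV_mult[OF DERIV_ident d] have "((\<lambda>z. z * W.f z) has_field_derivative wz z * (z * W.f z)) (at z)"
    using z0 by (simp add: field_simps)
  moreover have "ws = (\<lambda>z. z * W.f z)" using ws_eq by auto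
  ultimately show ?thesis by simp
qed

end

section \<open>Liouville theorem and quasi-periods\<close>

lemma eventually_at_shift:
  fixes z w :: complex
  shows "eventually P (at (z + w)) \<longleftrightarrow> eventually (\<lambda>x. P (x + w)) (at z)"
  using filtermap_at_shift[of "-w" z] by (simp flip: eventually_filtermap[of P "\<lambda>x. x + w"])

lemma tendsto_at_shift:
  fixes z w :: complex
  shows "(f \<longlongrightarrow> l) (at (z + w)) \<longleftrightarrow> ((\<lambda>x. f (x + w)) \<longlongrightarrow> l) (at z)"
  unfolding tendsto_def eventually_at_shift ..

lemma not_islimpt_imp_closed: "(\<And>z. \<not> z islimpt T) \<Longrightarrow> closed (T :: complex set)"
  using closed_limpt by blast

lemma eventually_notin_discrete:
  "\<not> z islimpt T \<Longrightarrow> eventually (\<lambda>x. x \<notin> T) (at (z :: complex))"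
  by (simp add: islimpt_conv_frequently_at frequently_def)

lemma isolated_singularity_off_discrete:
  assumes "\<And>z. \<not> z islimpt T" "f holomorphic_on - T"
  shows "isolated_singularity_at f z"
proof (rule isolated_singularity_at_holomorphic)
  have "\<not> y islimpt (T - {z})" for y using assms(1) islimpt_subset by blast
  thus "open (- (T - {z}))" using not_islimpt_imp_closed open_Compl by blast
  show "f holomorphic_on - (T - {z}) - {z}" by (rule holomorphic_on_subset[OF assms(2)]) auto
qed auto

text \<open>
  The product extends analytically by the value \<open>0\<close>, and its difference quotient at \<open>z\<close> is \<open>f\<close>.
\<close>
lemma lim_cancel_factor:
  assumes "isolated_singularity_at f z" "((\<lambda>x. (x - z) * f x) \<longlongrightarrow> 0) (at z)"
  shows "\<exists>c. (f \<longlongrightarrow> c) (at z)"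
proof -
  define k where "k = (\<lambda>x. if x = z then 0 else (x - z) * f x)"
  have "isolated_singularity_at (\<lambda>x. (x - z) * f x) z"
    using assms(1) by (intro singularity_intros) (auto intro: isolated_singularity_at_analytic analytic_intros)
  hence "k analytic_on {z}" unfolding k_def using assms(2) by (rule removable_singularity')
  hence "k field_differentiable (at z)" using analytic_on_imp_differentiable_at by blast
  then obtain c where "(k has_field_derivative c) (at z)" using field_differentiable_def by blast
  hence "((\<lambda>x. (k x - k z) / (x - z)) \<longlongrightarrow> c) (at z)" by (simp add: has_field_derivative_iff)
  moreover have "eventually (\<lambda>x. (k x - k z) / (x - z) = f x) (at z)"
    by (auto simp: eventually_at_filter k_def)
  ultimately have "(f \<longlongrightarrow> c) (at z)" by (rule Lim_transform_eventually)
  thus ?thesis by blast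
qed

context half_periods begin

lemma Lat_induct [consumes 1, case_names zero period add uminus]:
  assumes "w \<in> Lat" "P 0" "\<And>j. j \<in> {1, 3} \<Longrightarrow> P (2 * \<omega> j)"
    "\<And>v w. v \<in> Lat \<Longrightarrow> w \<in> Lat \<Longrightarrow> P v \<Longrightarrow> P w \<Longrightarrow> P (v + w)" 
    "\<And>w. w \<in> Lat \<Longrightarrow> P w \<Longrightarrow> P (- w)"
  shows "P w"
proof -
  have nat: "P (of_nat n * (2 * \<omega> j)) \<and> of_nat n * (2 * \<omega> j) \<in> Lat" if "j \<in> {1, 3}" for j n
  proof (induction n)
    case (Suc n)
    thus ?case using assms(3)[OF that] assms(4)[OF two_omega_in_Lat[OF that], of "of_nat n * (2 * \<omega> j)"] 
        Lat_add[OF two_omega_in_Lat[OF that], of "of_nat n * (2 * \<omega> j)"] by (simp add: algebra_simps)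
  qed (use assms(2) in auto)
  have int: "P (of_int m * (2 * \<omega> j)) \<and> of_int m * (2 * \<omega> j) \<in> Lat" if "j \<in> {1, 3}" for j m
    using nat[OF that, of "nat \<bar>m\<bar>"] assms(5)[of "of_nat (nat \<bar>m\<bar>) * (2 * \<omega> j)"] 
    by (cases "m \<ge> 0") auto
  obtain m n where "w = 2 * of_int m * \<omega> 1 + 2 * of_int n * \<omega> 3"
    using assms(1) unfolding period_lattice_def by blast
  hence "w = of_int m * (2 * \<omega> 1) + of_int n * (2 * \<omega> 3)" by simp
  thus ?thesis using int[of 1 m] int[of 3 n] assms(4) by simp
qed

text \<open>
  Periodicity up to constants passes from the two generators to all periods. The set \<open>T\<close> need not be
  invariant under translation, so the relation is only claimed near each point, off the point itself.
\<close>
lemma quasi_periodic_Lat: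
  fixes f :: "complex \<Rightarrow> complex"
  assumes T: "\<And>z. \<not> z islimpt T"
    and per: "\<And>j x. j \<in> {1, 3} \<Longrightarrow> x \<notin> T \<Longrightarrow> x + 2 * \<omega> j \<notin> T \<Longrightarrow> f (x + 2 * \<omega> j) = f x + c j"
    and w: "w \<in> Lat"
  shows "\<exists>d. (\<forall>z. eventually (\<lambda>x. f (x + w) = f x + d) (at z)) \<and> (c 1 = 0 \<and> c 3 = 0 \<longrightarrow> d = 0)"
proof -
  have ev: "eventually (\<lambda>x. x \<notin> T) (at z)" for z using eventually_notin_discrete T by blast
  show ?thesis
    using w
  proof (induction w rule: Lat_induct)
    case zero thus ?case by (auto intro!: exI[of _ 0])
  next
    case (period j)
    have "eventually (\<lambda>x. f (x + 2 * \<omega> j) = f x + c j) (at z)" for z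
      using ev[of z] ev[of "z + 2 * \<omega> j", unfolded eventually_at_shift]
      by eventually_elim (use per period in auto)
    thus ?case using period by (intro exI[of _ "c j"]) auto
  next
    case (add v w)
    then obtain a d where c: "\<And>z. eventually (\<lambda>x. f (x + v) = f x + a) (at z)" and
       d: "\<And>z. eventually (\<lambda>x. f (x + w) = f x + d) (at z)" and 0: "c 1 = 0 \<and> c 3 = 0 \<longrightarrow> a = 0 \<and> d = 0" by blast
    have "eventually (\<lambda>x. f (x + (v + w)) = f x + (a + d)) (at z)" for z
      using c[of z] d[of "z + v", unfolded eventually_at_shift]
      by eventually_elim (simp add: add_ac)
    thus ?case using 0 by (intro exI[of _ "a + d"]) auto
  next
    case (uminus w)
    then obtain a where c: "\<And>z. eventually (\<lambda>x. f (x + w) = f x + a) (at z)" and 0: "c 1 = 0 \<and> c 3 = 0 \<longrightarrow> a = 0" by blast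
    have "eventually (\<lambda>x. f (x + (- w)) = f x + (- a)) (at z)" for z
      using c[of "z + (- w)", unfolded eventually_at_shift]
      by eventually_elim (simp add: add_ac)
    thus ?case using 0 by (intro exI[of _ "- a"]) auto
  qed
qed

text \<open>
  The hypothesis on \<open>x - z\<close> makes every singularity removable; it is only required at one translate
  of each point because the others follow by periodicity. The derivative of the resulting entire
  function is periodic, hence bounded, hence constant.
\<close>
lemma elliptic_liouville:
  assumes T: "\<And>z. \<not> z islimpt T" and holo: "f holomorphic_on - T"
    and per: "\<And>j x. j \<in> {1, 3} \<Longrightarrow> x \<notin> T \<Longrightarrow> x + 2 * \<omega> j \<notin> T \<Longrightarrow> f (x + 2 * \<omega> j) = f x + c j"
    and sing: "\<And>z. \<exists>w\<in>Lat. ((\<lambda>x. (x - (z + w)) * f x) \<longlongrightarrow> 0) (at (z + w))"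
  obtains c1 c0 where "\<And>x. x \<notin> T \<Longrightarrow> f x = c1 * x + c0" "\<And>j. j \<in> {1,3} \<Longrightarrow> c1 * (2 * \<omega> j) = c j"
proof -
  have ev: "eventually (\<lambda>x. x \<notin> T) (at z)" for z using eventually_notin_discrete T by blast
  have per': "\<exists>c. \<forall>z. eventually (\<lambda>x. f (x + w) = f x + c) (at z)" if "w \<in> Lat" for w
    using quasi_periodic_Lat[where f = f and T = T and c = c, OF T per that] by blast
  have iso: "isolated_singularity_at f z" for z using isolated_singularity_off_discrete[OF T holo] .
  have lim: "\<exists>l. (f \<longlongrightarrow> l) (at z)" for z
  proof (rule lim_cancel_factor[OF iso])
    obtain w where w: "w \<in> Lat" "((\<lambda>x. (x - (z + w)) * f x) \<longlongrightarrow> 0) (at (z + w))" using sing by blast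
    obtain c where c: "eventually (\<lambda>x. f (x + w) = f x + c) (at z)" using per'[OF w(1)] by blast
    have "((\<lambda>x. (x - z) * f (x + w) - (x - z) * c) \<longlongrightarrow> 0 - (z - z) * c) (at z)"
      using w(2) unfolding tendsto_at_shift by (intro tendsto_intros) simp
    moreover have "eventually (\<lambda>x. (x - z) * f (x + w) - (x - z) * c = (x - z) * f x) (at z)"
      using c by eventually_elim (simp add: algebra_simps)
    ultimately have "((\<lambda>x. (x - z) * f x) \<longlongrightarrow> 0 - (z - z) * c) (at z)"
      by (rule Lim_transform_eventually)
    thus "((\<lambda>x. (x - z) * f x) \<longlongrightarrow> 0) (at z)" by simp
  qed
  define F where "F = remove_sings f"
  have Fan: "F analytic_on {z}" for z 
    unfolding F_def using lim[of z] remove_sings_analytic_at[OF iso] by blast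
  hence Fan': "F analytic_on UNIV" using analytic_on_analytic_at by blast
  hence Fholo: "F holomorphic_on UNIV" using analytic_imp_holomorphic by blast
  have Feq: "F x = f x" if "x \<notin> T" for x
  proof -
    have "open (- T)" using not_islimpt_imp_closed[OF T] by (simp add: open_Compl)
    hence "f analytic_on {x}" using holo that holomorphic_on_imp_analytic_at by blast
    thus ?thesis unfolding F_def by simp
  qed
  have Fcont: "(F \<longlongrightarrow> F z) (at z)" for z using Fan analytic_at_imp_isCont isContD by blast
  have Fper: "\<exists>c. \<forall>z. F (z + w) = F z + c" if w: "w \<in> Lat" for w
  proof -
    obtain c where c: "\<And>z. eventually (\<lambda>x. f (x + w) = f x + c) (at z)" using per'[OF w] by blast
    have "F (z + w) = F z + c" for z
    proof (rule tendsto_unique)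
      show "((\<lambda>x. F (x + w)) \<longlongrightarrow> F (z + w)) (at z)" using Fcont[of "z + w"] unfolding tendsto_at_shift .
      have "((\<lambda>x. F x + c) \<longlongrightarrow> F z + c) (at z)" by (intro tendsto_intros Fcont)
      moreover have "eventually (\<lambda>x. F x + c = F (x + w)) (at z)"
        using c[of z] ev[of z] ev[of "z + w", unfolded eventually_at_shift]
        by eventually_elim (simp add: Feq)
      ultimately show "((\<lambda>x. F (x + w)) \<longlongrightarrow> F z + c) (at z)" by (rule Lim_transform_eventually)
    qed auto
    thus ?thesis by blast
  qed
  have dF: "(F has_field_derivative deriv F z) (at z)" for z
    using Fholo holomorphic_derivI by blast
  have dFper: "deriv F (z + w) = deriv F z" if w: "w \<in> Lat" for z w
  proof -
    obtain c where c: "\<And>z. F (z + w) = F z + c" using Fper[OF w] by blast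
    have "((\<lambda>x. F (x + w)) has_field_derivative deriv F (z + w)) (at z)"
      using dF[of "z + w"] by (simp add: DERIV_shift)
    moreover have "((\<lambda>x. F x + c) has_field_derivative deriv F z) (at z)"
      using DERIV_add[OF dF[of z] DERIV_const[of c]] by simp
    ultimately show ?thesis unfolding c using DERIV_unique by blast
  qed
  have "deriv F constant_on UNIV"
  proof (rule Liouville_theorem)
    show holo': "deriv F holomorphic_on UNIV" by (intro holomorphic_deriv Fholo) auto
    obtain R K where R: "R \<subseteq> K" "compact K" "\<And>z. \<exists>w\<in>Lat. z + w \<in> R" 
      using fundamental_domain by (metis (no_types, lifting))
    hence K: "compact K" "\<And>z. \<exists>w\<in>Lat. z + w \<in> K" by blast+
    have "bounded (deriv F ` K)"
      by (intro compact_imp_bounded compact_continuous_image K holomorphic_on_imp_continuous_on holomorphic_on_subset[OF holo']) auto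
    moreover have "range (deriv F) \<subseteq> deriv F ` K"
    proof safe
      fix z
      obtain w where "w \<in> Lat" "z + w \<in> K" using K by blast
      thus "deriv F z \<in> deriv F ` K" using dFper[of w z] by (metis image_eqI)
    qed
    ultimately show "bounded (range (deriv F))" using bounded_subset by blast
  qed
  then obtain c1 where c1: "deriv F z = c1" for z unfolding constant_on_def by auto
  have "((\<lambda>x. F x - c1 * x) has_field_derivative 0) (at z)" for z
    using DERIV_diff[OF dF[of z, unfolded c1] DERIV_cmult_Id[of c1]] by simp
  then obtain c0 where "F x - c1 * x = c0" for x
    using has_field_derivative_zero_constant[of UNIV "\<lambda>x. F x - c1 * x"] by auto
  hence F: "F x = c1 * x + c0" for x by (simp add: algebra_simps)
  show ?thesis
  proof (rule that)
    show "f x = c1 * x + c0" if "x \<notin> T" for x using Feq[OF that] F by simp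
    show "c1 * (2 * \<omega> j) = c j" if j: "j \<in> {1,3}" for j
    proof -
      have "eventually (\<lambda>x. x \<notin> T \<and> x + 2 * \<omega> j \<notin> T) (at 0)"
        using ev[of 0] ev[of "0 + 2 * \<omega> j", unfolded eventually_at_shift] by eventually_elim auto
      hence "\<exists>x. x \<notin> T \<and> x + 2 * \<omega> j \<notin> T" 
        using eventually_happens trivial_limit_at by blast
      then obtain x where "x \<notin> T" "x + 2 * \<omega> j \<notin> T" by blast
      hence "c1 * (x + 2 * \<omega> j) + c0 = c1 * x + c0 + c j" using per[OF j, of x] Feq F by metis
      thus ?thesis by (simp add: algebra_simps)
    qed
  qed
qed

text \<open>
  A linear function with a nonzero period is constant.
\<close>
lemma elliptic_constant:
  assumes holo: "f holomorphic_on - Lat"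
    and per: "\<And>j x. j \<in> {1, 3} \<Longrightarrow> x \<notin> Lat \<Longrightarrow> f (x + 2 * \<omega> j) = f x"
    and sing: "((\<lambda>x. x * f x) \<longlongrightarrow> 0) (at 0)"
  obtains c where "\<And>x. x \<notin> Lat \<Longrightarrow> f x = c"
proof -
  obtain c1 c0 where c: "\<And>x. x \<notin> Lat \<Longrightarrow> f x = c1 * x + c0" "\<And>j. j \<in> {1,3} \<Longrightarrow> c1 * (2 * \<omega> j) = 0"
  proof (rule elliptic_liouville[OF not_islimpt_Lat holo, of "\<lambda>_. 0"])
    show "\<exists>w\<in>Lat. ((\<lambda>x. (x - (z + w)) * f x) \<longlongrightarrow> 0) (at (z + w))" for z
    proof (cases "z \<in> Lat")
      case True
      thus ?thesis using sing by (intro bexI[of _ "- z"]) auto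
    next
      case False
      have "isCont f z" using holo open_Lat_compl False 
        by (meson Compl_iff continuous_on_eq_continuous_at holomorphic_on_imp_continuous_on)
      hence "((\<lambda>x. (x - z) * f x) \<longlongrightarrow> (z - z) * f z) (at z)" by (intro tendsto_intros isContD)
      thus ?thesis by (intro bexI[of _ 0]) auto
    qed
  qed (use per in auto)
  have "\<omega> 1 \<noteq> 0" using omega_notin_Lat[of 1] Lat_0 by auto
  hence "c1 = 0" using c(2)[of 1] by simp
  hence "f x = c0" if "x \<notin> Lat" for x using c(1)[OF that] by simp
  thus ?thesis by (rule that)
qed

lemma connected_Lat_compl: "connected (- Lat)"
  using connected_open_diff_countable[of "UNIV :: complex set" Lat] countable_Lat 
  by (simp add: Compl_eq_Diff_UNIV connected_UNIV)

text \<open>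
  The complement of the countable set of periods is connected.
\<close>
lemma constant_off_Lat:
  assumes "\<And>z. z \<notin> Lat \<Longrightarrow> (f has_field_derivative 0) (at z)" "x \<notin> Lat" "y \<notin> Lat"
  shows "f x = f y"
proof -
  have "f constant_on (- Lat)"
    by (rule has_field_derivative_0_imp_constant_on[OF _ connected_Lat_compl open_Lat_compl]) (use assms(1) in auto)
  thus ?thesis using assms unfolding constant_on_def by (metis Compl_iff)
qed

lemma bij_uminus_Lat: "bij_betw uminus (Lat - {0}) (Lat - {0})"
  by (rule bij_betw_byWitness[of _ uminus]) auto

lemma wz_minus: "wz (- z) = - wz z"
proof -
  have "(\<Sum>\<^sub>\<infinity>w\<in>Lat - {0}. 1 / (- z - w) + 1 / w + - z / w ^ 2) =
        (\<Sum>\<^sub>\<infinity>w\<in>Lat - {0}. 1 / (- z - (- w)) + 1 / (- w) + - z / (- w) ^ 2)"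
    by (rule infsum_reindex_bij_betw[OF bij_uminus_Lat, symmetric])
  also have "\<dots> = (\<Sum>\<^sub>\<infinity>w\<in>Lat - {0}. - (1 / (z - w) + 1 / w + z / w ^ 2))"
  proof (intro infsum_cong)
    fix w :: complex
    have e: "- z - (- w) = - (z - w)" by simp
    show "1 / (- z - (- w)) + 1 / (- w) + - z / (- w) ^ 2 = - (1 / (z - w) + 1 / w + z / w ^ 2)"
      unfolding e minus_divide_right[symmetric] power2_minus by simp
  qed
  also have "\<dots> = - (\<Sum>\<^sub>\<infinity>w\<in>Lat - {0}. 1 / (z - w) + 1 / w + z / w ^ 2)"
    by (rule infsum_uminus)
  finally show ?thesis unfolding weierstrass_zeta_def by simp
qed

lemma wp_minus: "wp (- z) = wp z"
proof -
  have "(\<Sum>\<^sub>\<infinity>w\<in>Lat - {0}. 1 / (- z - w) ^ 2 - 1 / w ^ 2) =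
        (\<Sum>\<^sub>\<infinity>w\<in>Lat - {0}. 1 / (- z - (- w)) ^ 2 - 1 / (- w) ^ 2)"
    by (rule infsum_reindex_bij_betw[OF bij_uminus_Lat, symmetric])
  also have "\<dots> = (\<Sum>\<^sub>\<infinity>w\<in>Lat - {0}. 1 / (z - w) ^ 2 - 1 / w ^ 2)"
    by (intro infsum_cong) (simp add: power2_commute)
  finally show ?thesis unfolding weierstrass_p_def by simp
qed

text \<open>
  The derivative \<open>- 2 \<Sum> 1 / (x - w)\<^sup>3\<close> is visibly periodic, so \<open>\<wp> (x + 2 \<omega>\<^sub>j) - \<wp> x\<close> is constant; at
  \<open>x = - \<omega>\<^sub>j\<close> it is \<open>0\<close> by parity.
\<close>
lemma wp_add_two_omega:
  assumes "j \<in> {1, 3}" "z \<notin> Lat"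
  shows "wp (z + 2 * \<omega> j) = wp z"
proof -
  have L: "2 * \<omega> j \<in> Lat" using two_omega_in_Lat assms by blast
  define v where "v = 2 * \<omega> j"
  have v: "v \<in> Lat" using L by (simp add: v_def)
  have bij: "bij_betw (\<lambda>w. w + v) Lat Lat"
    by (rule bij_betw_byWitness[of _ "\<lambda>w. w - v"]) (auto intro: Lat_add Lat_diff v)
  have "((\<lambda>x. wp (x + v) - wp x) has_field_derivative 0) (at z)" if z: "z \<notin> Lat" for z
  proof -
    have "(\<Sum>\<^sub>\<infinity>w\<in>Lat. 1 / (z + v - w) ^ 3) = (\<Sum>\<^sub>\<infinity>w\<in>Lat. 1 / (z + v - (w + v)) ^ 3)"
      by (rule infsum_reindex_bij_betw[OF bij, symmetric])
    hence "(\<Sum>\<^sub>\<infinity>w\<in>Lat. 1 / (z + v - w) ^ 3) = (\<Sum>\<^sub>\<infinity>w\<in>Lat. 1 / (z - w) ^ 3)" by simp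
    moreover have "z + v \<notin> Lat" using z v by (simp add: Lat_add_iff)
    ultimately have "((\<lambda>x. wp (x + v)) has_field_derivative (- 2 * (\<Sum>\<^sub>\<infinity>w\<in>Lat. 1 / (z - w) ^ 3))) (at z)"
      using wp_deriv[of "z + v"] by (simp add: DERIV_shift)
    from DERIV_diff[OF this wp_deriv[OF z]] show ?thesis by simp
  qed
  moreover have o: "- \<omega> j \<notin> Lat" using omega_notin_Lat[of j] assms by auto
  ultimately have "wp (z + v) - wp z = wp (- \<omega> j + v) - wp (- \<omega> j)"
    using constant_off_Lat[of "\<lambda>x. wp (x + v) - wp x"] assms(2) by blast
  thus ?thesis by (simp add: v_def wp_minus)
qed

lemma wp_add_Lat:
  assumes "w \<in> Lat" "z \<notin> Lat"
  shows "wp (z + w) = wp z"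
  using assms
proof (induction w arbitrary: z rule: Lat_induct)
  case (add v w)
  have "wp (z + (v + w)) = wp (z + v + w)" by (simp add: add_ac)
  thus ?case using add by (simp add: Lat_add_iff)
next
  case (uminus w)
  thus ?case using uminus(2)[of "z - w"] by (simp add: Lat_diff_iff)
qed (use wp_add_two_omega in auto)

lemma wz_add_Lat:
  assumes "w \<in> Lat"
  obtains a where "\<And>z. z \<notin> Lat \<Longrightarrow> wz (z + w) = wz z + a"
proof -
  have "((\<lambda>x. wz (x + w) - wz x) has_field_derivative 0) (at z)" if z: "z \<notin> Lat" for z
  proof -
    have "((\<lambda>x. wz (x + w)) has_field_derivative - wp z) (at z)"
      using wz_deriv[of "z + w"] z assms wp_add_Lat[OF assms z] by (simp add: DERIV_shift Lat_add_iff)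
    from DERIV_diff[OF this wz_deriv[OF z]] show ?thesis by simp
  qed
  hence eq: "wz (z + w) - wz z = wz (\<omega> 1 + w) - wz (\<omega> 1)" if "z \<notin> Lat" for z
    by (rule constant_off_Lat[of "\<lambda>x. wz (x + w) - wz x"]) (use that omega_notin_Lat[of 1] in auto)
  show ?thesis
  proof (rule that)
    show "wz (z + w) = wz z + (wz (\<omega> 1 + w) - wz (\<omega> 1))" if "z \<notin> Lat" for z
      unfolding eq[OF that, symmetric] by simp
  qed
qed

lemma wz_add_two_omega:
  assumes "j \<in> {1, 3}" "z \<notin> Lat"
  shows "wz (z + 2 * \<omega> j) = wz z + 2 * wz (\<omega> j)"
proof -
  obtain a where a: "\<And>z. z \<notin> Lat \<Longrightarrow> wz (z + 2 * \<omega> j) = wz z + a"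
    using wz_add_Lat[OF two_omega_in_Lat[OF assms(1)]] by blast
  have "- \<omega> j \<notin> Lat" using omega_notin_Lat[of j] assms by auto
  from a[OF this] have "a = 2 * wz (\<omega> j)" by (simp add: wz_minus)
  thus ?thesis using a assms by simp
qed

text \<open>
  The quotient of \<open>\<sigma> (z + w)\<close> and \<open>exp (a z) \<sigma> z\<close> has logarithmic derivative zero.
\<close>
lemma ws_quasi:
  assumes w: "w \<in> Lat" and a: "\<And>z. z \<notin> Lat \<Longrightarrow> wz (z + w) = wz z + a"
  obtains C where "C \<noteq> 0" "\<And>z. ws (z + w) = C * exp (a * z) * ws z"
proof -
  define F where "F = (\<lambda>z. ws (z + w) / (exp (a * z) * ws z))"
  have "(F has_field_derivative 0) (at z)" if z: "z \<notin> Lat" for z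
  proof -
    have zw: "z + w \<notin> Lat" using z w by (simp add: Lat_add_iff)
    have d1: "((\<lambda>x. ws (x + w)) has_field_derivative wz (z + w) * ws (z + w)) (at z)"
      using ws_logderiv[OF zw] by (simp add: DERIV_shift)
    have nz: "exp (a * z) * ws z \<noteq> 0" using z by (simp add: ws_eq_0_iff)
    from logderiv_divide[OF d1 logderiv_mult[OF logderiv_exp ws_logderiv[OF z]] nz] a[OF z]
    show ?thesis by (simp add: F_def)
  qed
  hence "F z = F (\<omega> 1)" if "z \<notin> Lat" for z
    by (rule constant_off_Lat) (use that omega_notin_Lat[of 1] in auto)
  hence eq: "ws (z + w) = F (\<omega> 1) * exp (a * z) * ws z" if "z \<notin> Lat" for z
  proof -
    have "ws (z + w) = F z * exp (a * z) * ws z" using that by (simp add: F_def ws_eq_0_iff)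
    thus ?thesis using \<open>\<And>z. z \<notin> Lat \<Longrightarrow> F z = F (\<omega> 1)\<close>[OF that] by simp
  qed
  have "ws (z + w) = F (\<omega> 1) * exp (a * z) * ws z" for z
    using eq[of z] ws_eq_0_iff[of z] ws_eq_0_iff[of "z + w"] Lat_add_iff[OF w, of z] by (cases "z \<in> Lat") auto
  moreover have "F (\<omega> 1) \<noteq> 0"
    using omega_notin_Lat[of 1] w by (simp add: F_def ws_eq_0_iff Lat_add_iff)
  ultimately show ?thesis using that[of "F (\<omega> 1)"] by simp
qed

lemma ws_quasi_Lat:
  assumes w: "w \<in> Lat"
  obtains C a where "C \<noteq> 0" "\<And>z. ws (z + w) = C * exp (a * z) * ws z"
proof -
  obtain a where "\<And>z. z \<notin> Lat \<Longrightarrow> wz (z + w) = wz z + a" using wz_add_Lat[OF w] by blast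
  from ws_quasi[OF w this] obtain C where "C \<noteq> 0" "\<And>z. ws (z + w) = C * exp (a * z) * ws z" by auto
  thus ?thesis by (rule that)
qed

lemma ws_add_two_omega:
  assumes "j \<in> {1, 3}"
  obtains C where "C \<noteq> 0" "\<And>z. ws (z + 2 * \<omega> j) = C * exp (2 * wz (\<omega> j) * z) * ws z"
proof -
  obtain C where "C \<noteq> 0" "\<And>z. ws (z + 2 * \<omega> j) = C * exp (2 * wz (\<omega> j) * z) * ws z"
    using ws_quasi[OF two_omega_in_Lat[OF assms] wz_add_two_omega[OF assms]] by auto
  thus ?thesis by (rule that)
qed

end

section \<open>Elliptic functions with prescribed poles\<close>

context half_periods begin

lemma ws_compose_holomorphic [holomorphic_intros]:
  "f holomorphic_on A \<Longrightarrow> (\<lambda>x. ws (f x)) holomorphic_on A"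
  using holomorphic_on_compose_gen[of f A ws UNIV] ws_holomorphic[of UNIV] by (simp add: o_def)

lemma wz_compose_holomorphic [holomorphic_intros]:
  "f holomorphic_on A \<Longrightarrow> (\<And>x. x \<in> A \<Longrightarrow> f x \<notin> Lat) \<Longrightarrow> (\<lambda>x. wz (f x)) holomorphic_on A"
  using holomorphic_on_compose_gen[of f A wz "- Lat"] wz_holomorphic by (auto simp: o_def)

lemma wp_compose_holomorphic [holomorphic_intros]:
  "f holomorphic_on A \<Longrightarrow> (\<And>x. x \<in> A \<Longrightarrow> f x \<notin> Lat) \<Longrightarrow> (\<lambda>x. wp (f x)) holomorphic_on A"
  using holomorphic_on_compose_gen[of f A wp "- Lat"] wp_holomorphic by (auto simp: o_def)

lemma ev_notin_Lat: "eventually (\<lambda>x. x \<notin> Lat) (at z)"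
  by (rule eventually_notin_discrete[OF not_islimpt_Lat])

lemma ev_notin_Lat_shift: "eventually (\<lambda>x. x - c \<notin> Lat) (at z)"
  using ev_notin_Lat[of "z + (- c)"] unfolding eventually_at_shift by simp

lemma isCont_wz: "z \<notin> Lat \<Longrightarrow> isCont wz z"
  using wz_deriv DERIV_isCont by blast

lemma isCont_wp: "z \<notin> Lat \<Longrightarrow> isCont wp z"
  using wp_deriv DERIV_isCont by blast

lemma isCont_ws: "isCont ws z"
  using ws_holomorphic[of UNIV] holomorphic_on_imp_continuous_on continuous_on_eq_continuous_at by blast

lemma isCont_shift: "isCont f (z - c) \<Longrightarrow> ((\<lambda>x. f (x - c)) \<longlongrightarrow> f (z - c)) (at z)" for f :: "complex \<Rightarrow> complex"
  by (rule isCont_tendsto_compose) (auto intro!: tendsto_intros)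

text \<open>
  The regular part of \<open>\<zeta>\<close> at \<open>0\<close>, holomorphic on the complement of the nonzero periods. At \<open>0\<close>
  itself the convention \<open>1 / 0 = 0\<close> gives the correct value, as \<open>\<zeta> 0 = 0\<close> in the sense of the series.
\<close>
definition zeta_reg :: "complex \<Rightarrow> complex" where "zeta_reg z = wz z - 1 / z"

definition zeta_reg_dom :: "complex set" where "zeta_reg_dom = - (Lat - {0})"

lemma open_zeta_reg_dom: "open zeta_reg_dom"
proof -
  have "\<not> z islimpt (Lat - {0})" for z using not_islimpt_Lat islimpt_subset by blast
  thus ?thesis unfolding zeta_reg_dom_def using not_islimpt_imp_closed by blast
qed

lemma zero_in_zeta_reg_dom [simp]: "0 \<in> zeta_reg_dom" by (simp add: zeta_reg_dom_def)

lemma Wf_nz: "z \<in> zeta_reg_dom \<Longrightarrow> W.f z \<noteq> 0" by (auto simp: Wf_eq_0_iff zeta_reg_dom_def)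

lemma zeta_reg_holomorphic: "zeta_reg holomorphic_on zeta_reg_dom"
proof -
  have "(\<lambda>z. deriv W.f z / W.f z) holomorphic_on zeta_reg_dom"
    by (intro holomorphic_intros holomorphic_deriv W.holomorphic open_zeta_reg_dom Wf_nz)
  moreover have "deriv W.f z / W.f z = zeta_reg z" if "z \<in> zeta_reg_dom" for z
    using DERIV_imp_deriv[OF Wf_logderiv[OF Wf_nz[OF that]]] Wf_nz[OF that] by (simp add: zeta_reg_def)
  ultimately show ?thesis by (rule holomorphic_transform)
qed

lemma zeta_reg_0: "zeta_reg 0 = 0"
  using wz_minus[of 0] by (simp add: zeta_reg_def)

lemma isCont_zeta_reg_0: "isCont zeta_reg 0" "isCont (deriv zeta_reg) 0"
  using zeta_reg_holomorphic holomorphic_deriv[OF zeta_reg_holomorphic open_zeta_reg_dom] open_zeta_reg_dom zero_in_zeta_reg_dom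
  by (meson continuous_on_eq_continuous_at holomorphic_on_imp_continuous_on)+

lemma wp_eq_zeta_reg:
  assumes "z \<notin> Lat"
  shows "wp z = 1 / z ^ 2 - deriv zeta_reg z"
proof -
  have "z \<noteq> 0" using assms Lat_0 by blast
  hence "((\<lambda>z. wz z - 1 / (z - 0)) has_field_derivative (- wp z - - (1 / (z - 0) ^ 2))) (at z)"
    by (intro DERIV_diff wz_deriv assms DERIV_inverse_shift)
  hence "(zeta_reg has_field_derivative (1 / z ^ 2 - wp z)) (at z)" by (simp add: zeta_reg_def[abs_def])
  thus ?thesis by (simp add: DERIV_imp_deriv)
qed

lemma lim_wz_0: "((\<lambda>x. x * wz x) \<longlongrightarrow> 1) (at 0)"
proof -
  have "((\<lambda>x. x * zeta_reg x + 1) \<longlongrightarrow> 0 * zeta_reg 0 + 1) (at 0)"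
    by (intro tendsto_intros isContD isCont_zeta_reg_0)
  hence "((\<lambda>x. x * zeta_reg x + 1) \<longlongrightarrow> 1) (at 0)" by simp
  moreover have "eventually (\<lambda>x. x * zeta_reg x + 1 = x * wz x) (at 0)"
    by (auto simp: eventually_at_filter zeta_reg_def algebra_simps)
  ultimately show ?thesis by (rule Lim_transform_eventually)
qed

lemma lim_wp_0: "((\<lambda>x. x ^ 2 * wp x) \<longlongrightarrow> 1) (at 0)"
proof -
  have "((\<lambda>x. 1 - x ^ 2 * deriv zeta_reg x) \<longlongrightarrow> 1 - 0 ^ 2 * deriv zeta_reg 0) (at 0)"
    by (intro tendsto_intros isContD isCont_zeta_reg_0)
  hence "((\<lambda>x. 1 - x ^ 2 * deriv zeta_reg x) \<longlongrightarrow> 1) (at 0)" by simp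
  moreover have "eventually (\<lambda>x. 1 - x ^ 2 * deriv zeta_reg x = x ^ 2 * wp x) (at 0)"
    using ev_notin_Lat[of 0]
  proof eventually_elim
    case (elim x)
    hence "x \<noteq> 0" using Lat_0 by blast
    thus ?case by (simp add: wp_eq_zeta_reg[OF elim] algebra_simps)
  qed
  ultimately show ?thesis by (rule Lim_transform_eventually)
qed

lemma lim_wz: "((\<lambda>x. (x - a) * wz (x - c)) \<longlongrightarrow> of_bool (a - c \<in> Lat)) (at a)"
proof (cases "a - c \<in> Lat")
  case True
  obtain k where k: "\<And>z. z \<notin> Lat \<Longrightarrow> wz (z + (a - c)) = wz z + k" using wz_add_Lat[OF True] by blast
  have "((\<lambda>x. x * wz x + x * k) \<longlongrightarrow> 1 + 0 * k) (at 0)"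
    by (intro tendsto_intros lim_wz_0)
  moreover have "eventually (\<lambda>x. x * wz x + x * k = (x + a - a) * wz (x + a - c)) (at 0)"
    using ev_notin_Lat[of 0]
  proof eventually_elim
    case (elim x)
    show ?case using k[OF elim] by (simp add: algebra_simps)
  qed
  ultimately have "((\<lambda>x. (x + a - a) * wz (x + a - c)) \<longlongrightarrow> 1 + 0 * k) (at 0)" by (rule Lim_transform_eventually)
  hence "((\<lambda>x. (x - a) * wz (x - c)) \<longlongrightarrow> 1 + 0 * k) (at (0 + a))" unfolding tendsto_at_shift .
  thus ?thesis using True by simp
next
  case False
  have "((\<lambda>x. (x - a) * wz (x - c)) \<longlongrightarrow> (a - a) * wz (a - c)) (at a)"
    by (intro tendsto_intros isCont_shift isCont_wz False)
  thus ?thesis using False by simp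
qed

lemma lim_wp: "((\<lambda>x. (x - a) ^ 2 * wp (x - c)) \<longlongrightarrow> of_bool (a - c \<in> Lat)) (at a)"
proof (cases "a - c \<in> Lat")
  case True
  have "eventually (\<lambda>x. x ^ 2 * wp x = (x + a - a) ^ 2 * wp (x + a - c)) (at 0)"
    using ev_notin_Lat[of 0]
  proof eventually_elim
    case (elim x)
    show ?case using wp_add_Lat[OF True elim] by (simp add: algebra_simps)
  qed
  hence "((\<lambda>x. (x + a - a) ^ 2 * wp (x + a - c)) \<longlongrightarrow> 1) (at 0)" by (rule Lim_transform_eventually[OF lim_wp_0])
  hence "((\<lambda>x. (x - a) ^ 2 * wp (x - c)) \<longlongrightarrow> 1) (at (0 + a))" unfolding tendsto_at_shift .
  thus ?thesis using True by simp
next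
  case False
  have "((\<lambda>x. (x - a) ^ 2 * wp (x - c)) \<longlongrightarrow> (a - a) ^ 2 * wp (a - c)) (at a)"
    by (intro tendsto_intros isCont_shift isCont_wp False)
  thus ?thesis using False by simp
qed

text \<open>
  All zeros of \<open>\<sigma>\<close> are simple.
\<close>
lemma lim_ws_inverse:
  obtains L where "((\<lambda>x. (x - a) / ws (x - c)) \<longlongrightarrow> L) (at a)" "L = 0 \<longleftrightarrow> a - c \<notin> Lat"
proof (cases "a - c \<in> Lat")
  case True
  obtain C k where C: "C \<noteq> 0" "\<And>z. ws (z + (a - c)) = C * exp (k * z) * ws z" using ws_quasi_Lat[OF True] by blast
  have "isCont W.f 0" using W.holomorphic[of UNIV] holomorphic_on_imp_continuous_on continuous_on_eq_continuous_at by blast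
  hence "((\<lambda>x. 1 / (C * exp (k * x) * W.f x)) \<longlongrightarrow> 1 / (C * exp (k * 0) * W.f 0)) (at 0)"
    using C(1) Wf_nz[of 0] by (intro tendsto_intros isContD) auto
  moreover have "eventually (\<lambda>x. 1 / (C * exp (k * x) * W.f x) = (x + a - a) / ws (x + a - c)) (at 0)"
    unfolding eventually_at_filter
  proof (intro always_eventually allI impI)
    fix x :: complex assume "x \<noteq> 0"
    thus "1 / (C * exp (k * x) * W.f x) = (x + a - a) / ws (x + a - c)"
      using C(2)[of x] by (simp add: ws_eq add_diff_eq)
  qed
  ultimately have "((\<lambda>x. (x + a - a) / ws (x + a - c)) \<longlongrightarrow> 1 / (C * exp (k * 0) * W.f 0)) (at 0)" by (rule Lim_transform_eventually)
  hence "((\<lambda>x. (x - a) / ws (x - c)) \<longlongrightarrow> 1 / (C * exp (k * 0) * W.f 0)) (at (0 + a))" unfolding tendsto_at_shift .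
  thus ?thesis using True C(1) Wf_nz[of 0] that[of "1 / (C * exp (k * 0) * W.f 0)"] by simp
next
  case False
  have "((\<lambda>x. (x - a) / ws (x - c)) \<longlongrightarrow> (a - a) / ws (a - c)) (at a)"
    using False by (intro tendsto_intros isCont_shift isCont_ws) (simp add: ws_eq_0_iff)
  thus ?thesis using False that[of 0] by simp
qed

lemma two_omega_nz: "\<omega> 1 \<noteq> 0" "\<omega> 3 \<noteq> 0"
  using omega_notin_Lat[of 1] omega_notin_Lat[of 3] Lat_0 by auto

text \<open>
  The classical identity \<open>\<wp> x - \<wp> \<delta> = - \<sigma> (x - \<delta>) \<sigma> (x + \<delta>) / (\<sigma> \<delta>\<^sup>2 \<sigma> x\<^sup>2)\<close>, up to the value of the constant.
  The quotient of sigmas is periodic. A multiple of \<open>\<wp>\<close> cancels its double pole at \<open>0\<close>; no simple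
  pole remains, because \<open>x\<^sup>2\<close> times the quotient has derivative \<open>0\<close> at \<open>0\<close>. So the difference is
  constant, and its value is found at \<open>x = \<delta>\<close>.
\<close>
lemma wp_factor:
  assumes d: "\<delta> \<notin> Lat"
  obtains C where "C \<noteq> 0" "\<And>x. x \<notin> Lat \<Longrightarrow> wp x - wp \<delta> = C * (ws (x - \<delta>) * ws (x + \<delta>) / ws x ^ 2)"
proof -
  have md: "- \<delta> \<notin> Lat" using d by simp
  define G where "G = (\<lambda>x. ws (x - \<delta>) * ws (x + \<delta>) / ws x ^ 2)"
  define A where "A = (\<lambda>x. ws (x - \<delta>) * ws (x + \<delta>) / W.f x ^ 2)"
  have nz: "ws \<delta> \<noteq> 0" "ws (- \<delta>) \<noteq> 0" "W.f 0 \<noteq> 0" using d Wf_nz[of 0] by (auto simp: ws_eq_0_iff)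
  have A0: "A 0 \<noteq> 0" using nz by (simp add: A_def)
  have dA: "(A has_field_derivative 0) (at 0)"
  proof -
    have d1: "((\<lambda>x. ws (x - \<delta>)) has_field_derivative wz (- \<delta>) * ws (0 - \<delta>)) (at 0)"
      using ws_logderiv[OF md] DERIV_shift[of ws _ 0 "- \<delta>"] by simp
    have d2: "((\<lambda>x. ws (x + \<delta>)) has_field_derivative wz \<delta> * ws (0 + \<delta>)) (at 0)"
      using ws_logderiv[OF d] DERIV_shift[of ws _ 0 "\<delta>"] by simp
    have "W.f 0 ^ 2 \<noteq> 0" using nz(3) by simp
    from logderiv_divide[OF logderiv_mult[OF d1 d2] logderiv_power[OF Wf_logderiv[OF nz(3)], of 2] this]
    show ?thesis using zeta_reg_0 by (simp add: A_def zeta_reg_def wz_minus)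
  qed
  define f where "f = (\<lambda>x. G x - A 0 * wp x)"
  have holo: "f holomorphic_on - Lat"
    unfolding f_def G_def
    by (intro holomorphic_intros) (auto simp: ws_eq_0_iff)
  have per: "f (x + 2 * \<omega> j) = f x" if j: "j \<in> {1,3}" and x: "x \<notin> Lat" for j x
  proof -
    obtain C where C: "C \<noteq> 0" "\<And>z. ws (z + 2 * \<omega> j) = C * exp (2 * wz (\<omega> j) * z) * ws z"
      using ws_add_two_omega[OF j] by blast
    have e: "exp (2 * wz (\<omega> j) * (x - \<delta>)) * exp (2 * wz (\<omega> j) * (x + \<delta>)) = exp (2 * wz (\<omega> j) * x) ^ 2"
      unfolding power2_eq_square exp_add[symmetric] by (simp add: algebra_simps)
    have "G (x + 2 * \<omega> j) = (C * exp (2 * wz (\<omega> j) * (x - \<delta>)) * ws (x - \<delta>)) * (C * exp (2 * wz (\<omega> j) * (x + \<delta>)) * ws (x + \<delta>))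
        / (C * exp (2 * wz (\<omega> j) * x) * ws x) ^ 2"
    proof -
      have e1: "x + 2 * \<omega> j - \<delta> = (x - \<delta>) + 2 * \<omega> j" and e2: "x + 2 * \<omega> j + \<delta> = (x + \<delta>) + 2 * \<omega> j" by simp_all
      show ?thesis unfolding G_def e1 e2 C(2) ..
    qed
    also have "\<dots> = (C ^ 2 * (exp (2 * wz (\<omega> j) * (x - \<delta>)) * exp (2 * wz (\<omega> j) * (x + \<delta>))) * (ws (x - \<delta>) * ws (x + \<delta>)))
        / (C ^ 2 * exp (2 * wz (\<omega> j) * x) ^ 2 * ws x ^ 2)"
      by (simp add: power2_eq_square mult_ac)
    also have "\<dots> = G x" unfolding e G_def using C(1) by simp
    finally show ?thesis unfolding f_def using wp_add_two_omega[OF j x] by simp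
  qed
  have sing0: "((\<lambda>x. x * f x) \<longlongrightarrow> 0) (at 0)"
  proof -
    have "((\<lambda>x. (A x - A 0) / (x - 0)) \<longlongrightarrow> 0) (at 0)" using dA unfolding has_field_derivative_iff by simp
    hence "((\<lambda>x. (A x - A 0) / (x - 0) + A 0 * (x * deriv zeta_reg x)) \<longlongrightarrow> 0 + A 0 * (0 * deriv zeta_reg 0)) (at 0)"
      by (intro tendsto_intros isContD isCont_zeta_reg_0)
    moreover have "eventually (\<lambda>x. (A x - A 0) / (x - 0) + A 0 * (x * deriv zeta_reg x) = x * f x) (at 0)"
      using ev_notin_Lat[of 0]
    proof eventually_elim
      case (elim x)
      hence x: "x \<noteq> 0" using Lat_0 by blast
      have "G x = A x / x ^ 2" using x by (simp add: G_def A_def ws_eq[of x] power_mult_distrib)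
      hence "f x = A x / x ^ 2 - A 0 * (1 / x ^ 2 - deriv zeta_reg x)" by (simp add: f_def wp_eq_zeta_reg[OF elim])
      moreover have "(A1 - A0) / (x - 0) + A0 * (x * p) = x * (A1 / x ^ 2 - A0 * (1 / x ^ 2 - p))" for A1 A0 p
        using x by (simp add: field_simps power2_eq_square)
      ultimately show ?case by simp
    qed
    ultimately have "((\<lambda>x. x * f x) \<longlongrightarrow> 0 + A 0 * (0 * deriv zeta_reg 0)) (at 0)" by (rule Lim_transform_eventually)
    thus ?thesis by simp
  qed
  obtain c0 where f: "\<And>x. x \<notin> Lat \<Longrightarrow> f x = c0"
    by (rule elliptic_constant[OF holo _ sing0]) (use per in auto)
  have "f \<delta> = - A 0 * wp \<delta>" by (simp add: f_def G_def ws_eq_0_iff)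
  hence c0: "c0 = - A 0 * wp \<delta>" using f[OF d] by simp
  show ?thesis
  proof (rule that[of "1 / A 0"])
    show "1 / A 0 \<noteq> 0" using A0 by simp
    fix x assume x: "x \<notin> Lat"
    have "G x - A 0 * wp x = - A 0 * wp \<delta>" using f[OF x] c0 by (simp add: f_def)
    hence "A 0 * (wp x - wp \<delta>) = G x" by (simp add: algebra_simps)
    moreover have "G x = ws (x - \<delta>) * ws (x + \<delta>) / ws x ^ 2" by (simp add: G_def)
    ultimately have "ws (x - \<delta>) * ws (x + \<delta>) / ws x ^ 2 = A 0 * (wp x - wp \<delta>)" by simp
    thus "wp x - wp \<delta> = 1 / A 0 * (ws (x - \<delta>) * ws (x + \<delta>) / ws x ^ 2)"
      using A0 by simp
  qed
qed

lemma wp_eq_iff: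
  assumes "\<delta> \<notin> Lat" "x \<notin> Lat"
  shows "wp x = wp \<delta> \<longleftrightarrow> x - \<delta> \<in> Lat \<or> x + \<delta> \<in> Lat"
proof -
  obtain C where "C \<noteq> 0" "wp x - wp \<delta> = C * (ws (x - \<delta>) * ws (x + \<delta>) / ws x ^ 2)"
    using wp_factor[OF assms(1)] assms(2) by metis
  hence "wp x - wp \<delta> = 0 \<longleftrightarrow> ws (x - \<delta>) = 0 \<or> ws (x + \<delta>) = 0" using assms(2) by (simp add: ws_eq_0_iff)
  thus ?thesis by (simp add: ws_eq_0_iff)
qed

lemma wp_logderiv:
  assumes d: "\<delta> \<notin> Lat" and x: "x \<notin> Lat" "x - \<delta> \<notin> Lat" "x + \<delta> \<notin> Lat"
  shows "deriv wp x / (wp x - wp \<delta>) = wz (x - \<delta>) + wz (x + \<delta>) - 2 * wz x"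
proof -
  obtain C where C: "C \<noteq> 0" "\<And>x. x \<notin> Lat \<Longrightarrow> wp x - wp \<delta> = C * (ws (x - \<delta>) * ws (x + \<delta>) / ws x ^ 2)"
    using wp_factor[OF d] by blast
  have d1: "((\<lambda>x. ws (x - \<delta>)) has_field_derivative wz (x - \<delta>) * ws (x - \<delta>)) (at x)"
    using ws_logderiv[OF x(2)] DERIV_shift[of ws _ x "- \<delta>"] by simp
  have d2: "((\<lambda>x. ws (x + \<delta>)) has_field_derivative wz (x + \<delta>) * ws (x + \<delta>)) (at x)"
    using ws_logderiv[OF x(3)] DERIV_shift[of ws _ x "\<delta>"] by simp
  have nz: "ws x \<noteq> 0" using x by (simp add: ws_eq_0_iff)
  have nz2: "ws x ^ 2 \<noteq> 0" using nz by simp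
  let ?q = "ws (x - \<delta>) * ws (x + \<delta>) / ws x ^ 2"
  have "((\<lambda>x. wp \<delta> + C * (ws (x - \<delta>) * ws (x + \<delta>) / ws x ^ 2)) has_field_derivative
     0 + C * ((wz (x - \<delta>) + wz (x + \<delta>) - of_nat 2 * wz x) * ?q)) (at x)"
    by (intro DERIV_add DERIV_const DERIV_cmult logderiv_divide logderiv_mult logderiv_power d1 d2 ws_logderiv x nz2)
  hence "((\<lambda>x. wp \<delta> + C * (ws (x - \<delta>) * ws (x + \<delta>) / ws x ^ 2)) has_field_derivative
     (wz (x - \<delta>) + wz (x + \<delta>) - 2 * wz x) * (C * ?q)) (at x)" by (simp add: mult_ac)
  hence "(wp has_field_derivative (wz (x - \<delta>) + wz (x + \<delta>) - 2 * wz x) * (C * ?q)) (at x)"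
  proof (rule has_field_derivative_transform_within_open[OF _ open_Lat_compl])
    show "wp \<delta> + C * (ws (y - \<delta>) * ws (y + \<delta>) / ws y ^ 2) = wp y" if "y \<in> - Lat" for y
      using that by (subst C(2)[of y, symmetric]) auto
  qed (use x in auto)
  hence "deriv wp x = (wz (x - \<delta>) + wz (x + \<delta>) - 2 * wz x) * (wp x - wp \<delta>)"
    unfolding C(2)[OF x(1)] by (rule DERIV_imp_deriv)
  moreover have "wp x - wp \<delta> \<noteq> 0" using wp_eq_iff[OF d x(1)] x by simp
  ultimately show ?thesis by simp
qed

text \<open>
  If the periods and the quasi-periods of \<open>\<zeta>\<close> were proportional, some \<open>h = \<zeta> - b x\<close> would be
  periodic, with \<open>h (\<omega>\<^sub>1) = h (\<omega>\<^sub>3) = 0\<close>. Then \<open>h\<^sup>2 - \<wp>\<close> would have no pole, hence be constant, and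
  \<open>\<wp>\<close> would take the same value at \<open>\<omega>\<^sub>1\<close> and \<open>\<omega>\<^sub>3\<close>.
\<close>
lemma legendre_nondegenerate:
  assumes ac: "\<And>j. j \<in> {1, 3} \<Longrightarrow> a * \<omega> j = c * wz (\<omega> j)"
  shows "c = 0" "a = 0"
proof -
  show c0: "c = 0"
  proof (rule ccontr)
    assume c: "c \<noteq> 0"
    define b where "b = a / c"
    define h where "h = (\<lambda>x. wz x - b * x)"
    have hj: "wz (\<omega> j) = b * \<omega> j" if "j \<in> {1,3}" for j using ac[OF that] c by (simp add: b_def field_simps)
    have hper: "h (x + 2 * \<omega> j) = h x" if "j \<in> {1,3}" "x \<notin> Lat" for j x
      using wz_add_two_omega[OF that] hj[OF that(1)] by (simp add: h_def algebra_simps)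
    define f where "f = (\<lambda>x. h x ^ 2 - wp x)"
    have holo: "f holomorphic_on - Lat"
      unfolding f_def h_def by (intro holomorphic_intros) auto
    have sing0: "((\<lambda>x. x * f x) \<longlongrightarrow> 0) (at 0)"
    proof -
      have "((\<lambda>x. 2 * (zeta_reg x - b * x) + x * (zeta_reg x - b * x) ^ 2 + x * deriv zeta_reg x) \<longlongrightarrow> 2 * (zeta_reg 0 - b * 0) + 0 * (zeta_reg 0 - b * 0) ^ 2 + 0 * deriv zeta_reg 0) (at 0)"
        by (intro tendsto_intros isContD isCont_zeta_reg_0)
      moreover have "eventually (\<lambda>x. 2 * (zeta_reg x - b * x) + x * (zeta_reg x - b * x) ^ 2 + x * deriv zeta_reg x = x * f x) (at 0)"
        using ev_notin_Lat[of 0]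
      proof eventually_elim
        case (elim x)
        hence x: "x \<noteq> 0" using Lat_0 by blast
        have "f x = (1 / x + (zeta_reg x - b * x)) ^ 2 - (1 / x ^ 2 - deriv zeta_reg x)"
          by (simp add: f_def h_def wp_eq_zeta_reg[OF elim] zeta_reg_def)
        moreover have "x * ((1 / x + k) ^ 2 - (1 / x ^ 2 - p)) = 2 * k + x * k ^ 2 + x * p" for k p
          using x by (simp add: field_simps power2_eq_square)
        ultimately show ?case by simp
      qed
      ultimately have "((\<lambda>x. x * f x) \<longlongrightarrow> 2 * (zeta_reg 0 - b * 0) + 0 * (zeta_reg 0 - b * 0) ^ 2 + 0 * deriv zeta_reg 0) (at 0)"
        by (rule Lim_transform_eventually)
      thus ?thesis by (simp add: zeta_reg_0)
    qed
    have fper: "f (x + 2 * \<omega> j) = f x" if "j \<in> {1,3}" "x \<notin> Lat" for j x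
      unfolding f_def using hper[OF that] wp_add_two_omega[OF that] by simp
    obtain c0 where c0: "\<And>x. x \<notin> Lat \<Longrightarrow> f x = c0" using elliptic_constant[OF holo fper sing0] by blast
    have n: "\<omega> 1 \<notin> Lat" "\<omega> 3 \<notin> Lat" using omega_notin_Lat[of 1] omega_notin_Lat[of 3] by auto
    have "f (\<omega> 1) = f (\<omega> 3)" using c0[OF n(1)] c0[OF n(2)] by simp
    hence "wp (\<omega> 1) = wp (\<omega> 3)" using hj[of 1] hj[of 3] by (simp add: f_def h_def)
    hence "\<omega> 1 - \<omega> 3 \<in> Lat \<or> \<omega> 1 + \<omega> 3 \<in> Lat" using wp_eq_iff[OF n(2) n(1)] by simp
    moreover have "\<omega> 1 - \<omega> 3 \<notin> Lat" using omega_diff_notin_Lat[of 1 3] by simp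
    moreover have "\<omega> 1 + \<omega> 3 = - \<omega> 2" by (simp add: omega_2)
    ultimately show False using omega_notin_Lat[of 2] by simp
  qed
  show "a = 0" using ac[of 1] c0 two_omega_nz by simp
qed

text \<open>
  Subtracting \<open>c \<zeta> (x - \<alpha>)\<close> removes the pole, at the price of the additive periods \<open>- 2 c \<eta>\<^sub>j\<close>. These
  would be the periods of a linear function, so \<open>c = 0\<close> by \<open>legendre_nondegenerate\<close>.
\<close>
lemma elliptic_one_pole:
  assumes T: "\<And>z. \<not> z islimpt T" "\<And>x. x - \<alpha> \<in> Lat \<Longrightarrow> x \<in> T" and holo: "f holomorphic_on - T"
    and per: "\<And>j x. j \<in> {1, 3} \<Longrightarrow> x \<notin> T \<Longrightarrow> x + 2 * \<omega> j \<notin> T \<Longrightarrow> f (x + 2 * \<omega> j) = f x"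
    and sing: "\<And>z. z - \<alpha> \<notin> Lat \<Longrightarrow> \<exists>w\<in>Lat. ((\<lambda>x. (x - (z + w)) * f x) \<longlongrightarrow> 0) (at (z + w))"
    and w0: "w0 \<in> Lat" and pole: "((\<lambda>x. (x - (\<alpha> + w0)) * f x) \<longlongrightarrow> c) (at (\<alpha> + w0))"
  obtains c0 where "\<And>x. x \<notin> T \<Longrightarrow> f x = c0"
proof -
  define F where "F = (\<lambda>x. f x - c * wz (x - \<alpha>))"
  have holoF: "F holomorphic_on - T"
    unfolding F_def using T(2)
    by (intro holomorphic_intros holo) auto
  obtain c1 c0 where c: "\<And>x. x \<notin> T \<Longrightarrow> F x = c1 * x + c0" "\<And>j. j \<in> {1,3} \<Longrightarrow> c1 * (2 * \<omega> j) = - c * (2 * wz (\<omega> j))"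
  proof (rule elliptic_liouville[OF T(1) holoF, of "\<lambda>j. - c * (2 * wz (\<omega> j))"])
    show "F (x + 2 * \<omega> j) = F x + - c * (2 * wz (\<omega> j))" if "j \<in> {1,3}" "x \<notin> T" "x + 2 * \<omega> j \<notin> T" for j x
    proof -
      have "x - \<alpha> \<notin> Lat" using T(2) that by blast
      from wz_add_two_omega[OF that(1) this] have "wz (x + 2 * \<omega> j - \<alpha>) = wz (x - \<alpha>) + 2 * wz (\<omega> j)"
        by (simp add: algebra_simps)
      thus ?thesis using per[OF that] by (simp add: F_def algebra_simps)
    qed
    show "\<exists>w\<in>Lat. ((\<lambda>x. (x - (z + w)) * F x) \<longlongrightarrow> 0) (at (z + w))" for z
    proof (cases "z - \<alpha> \<in> Lat")
      case True
      define b where "b = \<alpha> + w0"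
      have "\<alpha> - z \<in> Lat" using True by (simp add: Lat_diff_commute)
      hence w: "b - z \<in> Lat" using Lat_add_iff[OF w0, of "\<alpha> - z"] by (simp add: b_def algebra_simps)
      have "((\<lambda>x. (x - b) * f x - c * ((x - b) * wz (x - \<alpha>))) \<longlongrightarrow> c - c * of_bool (b - \<alpha> \<in> Lat)) (at b)"
        using pole by (intro tendsto_intros lim_wz) (simp add: b_def)
      moreover have "b - \<alpha> \<in> Lat" using w0 by (simp add: b_def)
      ultimately have "((\<lambda>x. (x - b) * F x) \<longlongrightarrow> 0) (at b)" by (simp add: F_def algebra_simps)
      thus ?thesis using w by (intro bexI[of _ "b - z"]) auto
    next
      case False
      obtain w where w: "w \<in> Lat" "((\<lambda>x. (x - (z + w)) * f x) \<longlongrightarrow> 0) (at (z + w))" using sing[OF False] by blast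
      have "((\<lambda>x. (x - (z + w)) * f x - c * ((x - (z + w)) * wz (x - \<alpha>))) \<longlongrightarrow> 0 - c * of_bool (z + w - \<alpha> \<in> Lat)) (at (z + w))"
        by (intro tendsto_intros w lim_wz)
      moreover have "z + w - \<alpha> \<notin> Lat" using False w(1) Lat_add_iff[of w "z - \<alpha>"] by (simp add: algebra_simps)
      ultimately show ?thesis using w(1) by (intro bexI[of _ w]) (auto simp: F_def algebra_simps)
    qed
  qed auto
  have "c1 * \<omega> j = - c * wz (\<omega> j)" if "j \<in> {1,3}" for j using c(2)[OF that] by simp
  from legendre_nondegenerate[OF this] have "c = 0" "c1 = 0" by auto
  hence "f x = c0" if "x \<notin> T" for x using c(1)[OF that] by (simp add: F_def)
  thus ?thesis by (rule that)
qed

end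

section \<open>Poles of solutions of a Riccati equation\<close>

lemma eventually_analytic_at_of_isolated:
  assumes "isolated_singularity_at f z"
  shows "eventually (\<lambda>x. f analytic_on {x}) (at z)"
proof -
  obtain r where r: "r > 0" "f analytic_on ball z r - {z}"
    using assms unfolding isolated_singularity_at_def by blast
  have "eventually (\<lambda>x. x \<in> ball z r - {z}) (at z)"
    using r(1) by (intro eventually_at_in_open) auto
  thus ?thesis by eventually_elim (rule analytic_on_subset[OF r(2)], auto)
qed

text \<open>
  If \<open>y\<close> is bounded at \<open>a\<close>, the equation gives \<open>l (l + 1) = 0\<close> and the limit is \<open>0\<close>. If \<open>y\<close> has a
  pole, \<open>h = 1 / y\<close> is analytic with \<open>h a = 0\<close> and satisfies \<open>h' = 1 - V h\<^sup>2\<close>. Letting \<open>x\<close> tend to \<open>a\<close>, the slope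
  \<open>m = h' a\<close> satisfies \<open>m = 1 - l (l + 1) m\<^sup>2\<close>; so \<open>m \<noteq> 0\<close>, the pole is simple, and its residue
  \<open>c = 1 / m\<close> is a root of \<open>c\<^sup>2 - c = l (l + 1)\<close>.
\<close>
lemma riccati_exponent:
  fixes l :: complex
  assumes iso: "isolated_singularity_at y a" and ness: "not_essential y a"
    and ode: "eventually (\<lambda>x. deriv y x + y x ^ 2 = V x) (at a)"
    and V: "((\<lambda>x. (x - a) ^ 2 * V x) \<longlongrightarrow> l * (l + 1)) (at a)"
  shows "\<exists>c\<in>{- l, l + 1}. ((\<lambda>x. (x - a) * y x) \<longlongrightarrow> c) (at a)"
proof -
  have ev_ana: "eventually (\<lambda>x. y analytic_on {x}) (at a)"
    by (rule eventually_analytic_at_of_isolated[OF iso])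
  consider L where "(y \<longlongrightarrow> L) (at a)" | "is_pole y a" using ness unfolding not_essential_def by blast
  thus ?thesis
  proof cases
    case 1
    obtain D where D: "(deriv y \<longlongrightarrow> D) (at a)" using removable_singularity_deriv[OF 1 iso] by blast
    have "((\<lambda>x. (x - a) ^ 2 * (deriv y x + y x ^ 2)) \<longlongrightarrow> (a - a) ^ 2 * (D + L ^ 2)) (at a)"
      by (intro tendsto_intros 1 D)
    moreover have "eventually (\<lambda>x. (x - a) ^ 2 * (deriv y x + y x ^ 2) = (x - a) ^ 2 * V x) (at a)"
      using ode by eventually_elim simp
    ultimately have "((\<lambda>x. (x - a) ^ 2 * V x) \<longlongrightarrow> (a - a) ^ 2 * (D + L ^ 2)) (at a)"
      by (rule Lim_transform_eventually)
    from V this have "l * (l + 1) = (a - a) ^ 2 * (D + L ^ 2)" by (rule LIM_unique)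
    hence "l = 0 \<or> l + 1 = 0" by simp
    hence z: "0 \<in> {- l, l + 1}" by (elim disjE) simp_all
    have "((\<lambda>x. (x - a) * y x) \<longlongrightarrow> (a - a) * L) (at a)" by (intro tendsto_intros 1)
    hence "((\<lambda>x. (x - a) * y x) \<longlongrightarrow> 0) (at a)" by simp
    thus ?thesis using z by (rule bexI)
  next
    case 2
    define h where "h = (\<lambda>x. if x = a then 0 else inverse (y x))"
    have "isolated_singularity_at (\<lambda>x. inverse (y x)) a" using iso ness by (rule isolated_singularity_at_inverse)
    moreover have "((\<lambda>x. inverse (y x)) \<longlongrightarrow> 0) (at a)"
      using 2 unfolding is_pole_def by (rule filterlim_compose[OF tendsto_inverse_0])
    ultimately have h_ana: "h analytic_on {a}" unfolding h_def by (rule removable_singularity')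
    define m where "m = deriv h a"
    have "(h has_field_derivative m) (at a)" unfolding m_def by (rule analytic_derivI[OF h_ana])
    hence hm: "((\<lambda>x. h x / (x - a)) \<longlongrightarrow> m) (at a)" unfolding has_field_derivative_iff by (simp add: h_def)
    have "deriv h analytic_on {a}" using h_ana by (rule analytic_deriv)
    hence dh: "(deriv h \<longlongrightarrow> m) (at a)" unfolding m_def using analytic_at_imp_isCont isContD by blast
    have ev: "eventually (\<lambda>x. deriv h x = 1 - ((x - a) ^ 2 * V x) * (h x / (x - a)) ^ 2) (at a)"
      using ev_ana ode non_zero_neighbour_pole[OF 2] eventually_neq_at_within[of a]
    proof eventually_elim
      case (elim x)
      have "(y has_field_derivative deriv y x) (at x)" using elim(1) by (rule analytic_derivI)
      hence "((\<lambda>x. inverse (y x)) has_field_derivative - (inverse (y x) * deriv y x * inverse (y x))) (at x)"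
        using elim(3) by (rule DERIV_inverse')
      hence "(h has_field_derivative - (inverse (y x) * deriv y x * inverse (y x))) (at x)"
      proof (rule has_field_derivative_transform_within_open)
        show "open (- {a})" "x \<in> - {a}" using elim by auto
      qed (auto simp: h_def)
      hence "deriv h x = - (inverse (y x) * deriv y x * inverse (y x))" by (rule DERIV_imp_deriv)
      also have "deriv y x = V x - y x ^ 2" using elim(2) by (simp add: algebra_simps)
      also have "- (inverse (y x) * (V x - y x ^ 2) * inverse (y x)) = 1 - V x * (inverse (y x)) ^ 2"
      proof -
        have "t * (v - u ^ 2) * t = v * t ^ 2 - (u * t) ^ 2" for t u v :: complex
          by (simp add: algebra_simps power2_eq_square)
        thus ?thesis using elim(3) by simp
      qed
      also have "inverse (y x) = h x" using elim(4) by (simp add: h_def)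
      also have "V x * h x ^ 2 = ((x - a) ^ 2 * V x) * (h x / (x - a)) ^ 2"
        using elim(4) by (simp add: power_divide)
      finally show ?case .
    qed
    have "((\<lambda>x. 1 - ((x - a) ^ 2 * V x) * (h x / (x - a)) ^ 2) \<longlongrightarrow> 1 - l * (l + 1) * m ^ 2) (at a)"
      by (intro tendsto_intros V hm)
    moreover have "((\<lambda>x. 1 - ((x - a) ^ 2 * V x) * (h x / (x - a)) ^ 2) \<longlongrightarrow> m) (at a)"
      using dh ev by (rule Lim_transform_eventually)
    ultimately have meq: "1 - l * (l + 1) * m ^ 2 = m" by (rule LIM_unique)
    hence m0: "m \<noteq> 0" by auto
    from meq have meq: "m = 1 - l * (l + 1) * m ^ 2" by simp
    have "((\<lambda>x. inverse (h x / (x - a))) \<longlongrightarrow> inverse m) (at a)" by (rule tendsto_inverse[OF hm m0])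
    moreover have "eventually (\<lambda>x. inverse (h x / (x - a)) = (x - a) * y x) (at a)"
      by (auto simp: eventually_at_filter h_def divide_inverse)
    ultimately have lim: "((\<lambda>x. (x - a) * y x) \<longlongrightarrow> inverse m) (at a)" by (rule Lim_transform_eventually)
    define c where "c = inverse m"
    have "m = inverse c" "c \<noteq> 0" using m0 by (auto simp: c_def)
    hence cm: "c * m = 1" by simp
    have "c * (c * m) = c ^ 2 - l * (l + 1) * (c * m) ^ 2"
      using arg_cong[OF meq, of "\<lambda>t. c ^ 2 * t"] by (simp add: algebra_simps power2_eq_square)
    hence "c = c ^ 2 - l * (l + 1)" by (simp add: cm)
    moreover have "c ^ 2 - l * (l + 1) - c = (c + l) * (c - (l + 1))" by (simp add: algebra_simps power2_eq_square)
    ultimately have "(c + l) * (c - (l + 1)) = 0" by simp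
    hence "c = - l \<or> c = l + 1" unfolding mult_eq_0_iff eq_neg_iff_add_eq_0 right_minus_eq .
    hence "inverse m \<in> {- l, l + 1}" unfolding c_def by simp
    with lim show ?thesis by (rule bexI)
  qed
qed

lemma isolated_singularity_power_times:
  assumes "isolated_singularity_at f z"
  shows "isolated_singularity_at (\<lambda>x. (x - z) ^ n * f x) z"
proof (rule isolated_singularity_at_times)
  show "isolated_singularity_at (\<lambda>x. (x - z) ^ n) z"
    by (rule isolated_singularity_at_analytic) (intro analytic_intros)
qed (rule assms)

lemma lim_cancel_power:
  assumes "isolated_singularity_at f z" "((\<lambda>x. (x - z) ^ Suc n * f x) \<longlongrightarrow> 0) (at z)"
  shows "\<exists>c. ((\<lambda>x. (x - z) ^ n * f x) \<longlongrightarrow> c) (at z)"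
proof (rule lim_cancel_factor)
  show "isolated_singularity_at (\<lambda>x. (x - z) ^ n * f x) z"
    by (rule isolated_singularity_power_times[OF assms(1)])
  show "((\<lambda>x. (x - z) * ((x - z) ^ n * f x)) \<longlongrightarrow> 0) (at z)" using assms(2) by (simp add: mult_ac)
qed

text \<open>
  Differentiate the analytic extension of \<open>(x - a) ^ Suc m * f x\<close>; times \<open>x - a\<close>, its derivative vanishes
  at \<open>a\<close>.
\<close>
lemma deriv_pole_limit:
  assumes iso: "isolated_singularity_at f a" and lim: "((\<lambda>x. (x - a) ^ Suc m * f x) \<longlongrightarrow> c) (at a)"
  shows "((\<lambda>x. (x - a) ^ Suc (Suc m) * deriv f x) \<longlongrightarrow> - of_nat (Suc m) * c) (at a)"
proof -
  define k where "k = (\<lambda>x. if x = a then c else (x - a) ^ Suc m * f x)"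
  have "isolated_singularity_at (\<lambda>x. (x - a) ^ Suc m * f x) a"
    by (rule isolated_singularity_power_times[OF iso])
  hence ka: "k analytic_on {a}" unfolding k_def using lim by (rule removable_singularity')
  hence dk: "(deriv k \<longlongrightarrow> deriv k a) (at a)" using analytic_deriv analytic_at_imp_isCont isContD by blast
  have ev: "eventually (\<lambda>x. (x - a) * deriv k x - of_nat (Suc m) * ((x - a) ^ Suc m * f x) = (x - a) ^ Suc (Suc m) * deriv f x) (at a)"
    using eventually_analytic_at_of_isolated[OF iso] eventually_neq_at_within[of a]
  proof eventually_elim
    case (elim x)
    have f: "(f has_field_derivative deriv f x) (at x)" using elim(1) by (rule analytic_derivI)
    have p: "((\<lambda>x. (x - a) ^ Suc m) has_field_derivative of_nat (Suc m) * (x - a) ^ m) (at x)"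
      using DERIV_power[OF DERIV_diff[OF DERIV_ident DERIV_const[of a]], of "Suc m"] by simp
    have "((\<lambda>x. (x - a) ^ Suc m * f x) has_field_derivative of_nat (Suc m) * (x - a) ^ m * f x + deriv f x * (x - a) ^ Suc m) (at x)"
      by (rule DERIV_mult[OF p f])
    hence "(k has_field_derivative of_nat (Suc m) * (x - a) ^ m * f x + deriv f x * (x - a) ^ Suc m) (at x)"
    proof (rule has_field_derivative_transform_within_open)
      show "open (- {a})" "x \<in> - {a}" using elim by auto
    qed (auto simp: k_def)
    hence "deriv k x = of_nat (Suc m) * (x - a) ^ m * f x + deriv f x * (x - a) ^ Suc m" by (rule DERIV_imp_deriv)
    moreover have "t * (N * p * u + v * (t * p)) - N * (t * p * u) = t * (t * p) * v" for t p u v N :: complex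
      by (simp add: algebra_simps)
    ultimately show ?case by (simp only: power_Suc)
  qed
  have "((\<lambda>x. (x - a) * deriv k x - of_nat (Suc m) * ((x - a) ^ Suc m * f x)) \<longlongrightarrow> (a - a) * deriv k a - of_nat (Suc m) * c) (at a)"
    by (intro tendsto_intros dk lim)
  from this ev have "((\<lambda>x. (x - a) ^ Suc (Suc m) * deriv f x) \<longlongrightarrow> (a - a) * deriv k a - of_nat (Suc m) * c) (at a)"
    by (rule Lim_transform_eventually)
  thus ?thesis by (simp only: diff_self mult_zero_left diff_0 mult_minus_left)
qed

lemma higher_deriv_pole_limit:
  assumes T: "\<And>z. \<not> z islimpt T" and holo: "f holomorphic_on - T"
    and lim: "((\<lambda>x. (x - a) ^ Suc m * f x) \<longlongrightarrow> c) (at a)" "c \<noteq> 0"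
  shows "\<exists>c'. c' \<noteq> 0 \<and> ((\<lambda>x. (x - a) ^ Suc (j + m) * (deriv ^^ j) f x) \<longlongrightarrow> c') (at a)"
proof (induction j)
  case 0
  show ?case using lim by auto
next
  case (Suc j)
  then obtain c' where c': "c' \<noteq> 0" "((\<lambda>x. (x - a) ^ Suc (j + m) * (deriv ^^ j) f x) \<longlongrightarrow> c') (at a)" by blast
  have "open (- T)" using not_islimpt_imp_closed[OF T] by (simp add: open_Compl)
  hence "(deriv ^^ j) f holomorphic_on - T" by (intro holomorphic_higher_deriv holo)
  from deriv_pole_limit[OF isolated_singularity_off_discrete[OF T this] c'(2)]
  have "((\<lambda>x. (x - a) ^ Suc (Suc j + m) * (deriv ^^ Suc j) f x) \<longlongrightarrow> - of_nat (Suc (j + m)) * c') (at a)" by simp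
  moreover have "- of_nat (Suc (j + m)) * c' \<noteq> 0" using c'(1) by (simp del: of_nat_Suc)
  ultimately show ?case by blast
qed

text \<open>
  \<open>P j\<close> has a pole of exact order \<open>j + 1 + d\<close>, so the polar terms of \<open>f\<close> of order greater than \<open>d\<close> can be
  removed one after the other, starting with the highest.
\<close>
lemma subtract_principal_part:
  assumes T: "\<And>z. \<not> z islimpt T" and P: "\<And>j. P j holomorphic_on - T"
    and Plim: "\<And>j. \<exists>p. p \<noteq> 0 \<and> ((\<lambda>x. (x - a) ^ Suc (j + d) * P j x) \<longlongrightarrow> p) (at a)"
    and f: "f holomorphic_on - T" "((\<lambda>x. (x - a) ^ (n + d) * f x) \<longlongrightarrow> c) (at a)"
  shows "\<exists>\<beta> c'. ((\<lambda>x. (x - a) ^ d * (f x - (\<Sum>j<n. \<beta> j * P j x))) \<longlongrightarrow> c') (at a)"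
  using f
proof (induction n arbitrary: f c)
  case 0
  thus ?case by auto
next
  case (Suc n)
  obtain p where p: "p \<noteq> 0" "((\<lambda>x. (x - a) ^ Suc (n + d) * P n x) \<longlongrightarrow> p) (at a)" using Plim by blast
  define f1 where "f1 = (\<lambda>x. f x - c / p * P n x)"
  have holo: "f1 holomorphic_on - T" unfolding f1_def by (intro holomorphic_intros Suc.prems P)
  have "((\<lambda>x. (x - a) ^ (Suc n + d) * f x - c / p * ((x - a) ^ Suc (n + d) * P n x)) \<longlongrightarrow> c - c / p * p) (at a)"
    by (intro tendsto_intros Suc.prems p)
  hence "((\<lambda>x. (x - a) ^ Suc (n + d) * f1 x) \<longlongrightarrow> 0) (at a)" using p(1) by (simp add: f1_def algebra_simps)
  from lim_cancel_power[OF isolated_singularity_off_discrete[OF T holo] this]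
  obtain c1 where "((\<lambda>x. (x - a) ^ (n + d) * f1 x) \<longlongrightarrow> c1) (at a)" by blast
  from Suc.IH[OF holo this] obtain \<beta> c' 
    where b: "((\<lambda>x. (x - a) ^ d * (f1 x - (\<Sum>j<n. \<beta> j * P j x))) \<longlongrightarrow> c') (at a)" by blast
  have "f1 x - (\<Sum>j<n. \<beta> j * P j x) = f x - (\<Sum>j<Suc n. (\<beta>(n := c / p)) j * P j x)" for x
    by (simp add: f1_def)
  hence "((\<lambda>x. (x - a) ^ d * (f x - (\<Sum>j<Suc n. (\<beta>(n := c / p)) j * P j x))) \<longlongrightarrow> c') (at a)"
    using b by (simp only:)
  thus ?case by blast
qed

section \<open>Elliptic functions with simple poles and integer residues\<close>

context half_periods begin

lemma ws_compose_analytic [analytic_intros]: "f analytic_on A \<Longrightarrow> (\<lambda>x. ws (f x)) analytic_on A"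
proof -
  assume f: "f analytic_on A"
  have "ws analytic_on UNIV" using ws_holomorphic[of UNIV] by (simp add: analytic_on_open)
  from analytic_on_compose_gen[OF f this] show ?thesis by (simp add: o_def)
qed

text \<open>
  \<open>A\<close> represents the poles of \<open>Y\<close> modulo the lattice, \<open>n\<close> is the function of residues, and \<open>Y\<close> is the
  corresponding sum of translates of \<open>\<zeta>\<close> plus a constant.
\<close>
definition zeta_expansion ::
  "complex set \<Rightarrow> (complex \<Rightarrow> complex) \<Rightarrow> (complex \<Rightarrow> int) \<Rightarrow> complex set \<Rightarrow> complex \<Rightarrow> bool" where
  "zeta_expansion T Y n A c0 \<longleftrightarrow> finite A \<and> (\<forall>a\<in>A. \<forall>b\<in>A. a - b \<in> Lat \<longrightarrow> a = b) \<and>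
    (\<forall>x. \<forall>a\<in>A. x - a \<in> Lat \<longrightarrow> n x = n a) \<and> (\<forall>x. n x \<noteq> 0 \<longrightarrow> (\<exists>a\<in>A. x - a \<in> Lat)) \<and>
    (\<forall>x. x \<notin> T \<longrightarrow> n x = 0 \<and> (\<forall>a\<in>A. x - a \<notin> Lat)) \<and> (\<Sum>a\<in>A. n a) = 0 \<and>
    (\<forall>x. x \<notin> T \<longrightarrow> Y x = c0 + (\<Sum>a\<in>A. of_int (n a) * wz (x - a)))"

text \<open>
  The difference \<open>e\<close> of \<open>Y\<close> and the sum of zetas has no poles, and its additive periods are
  \<open>- 2 \<eta>\<^sub>j\<close> times the sum of the residues. Liouville's theorem makes \<open>e\<close> linear, and
  \<open>legendre_nondegenerate\<close> forces its slope and the sum of the residues to vanish.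
\<close>
lemma elliptic_zeta_expansion:
  fixes n :: "complex \<Rightarrow> int"
  assumes T: "\<And>z. \<not> z islimpt T" and holo: "Y holomorphic_on - T"
    and per: "\<And>j x. j \<in> {1, 3} \<Longrightarrow> x \<notin> T \<Longrightarrow> x + 2 * \<omega> j \<notin> T \<Longrightarrow> Y (x + 2 * \<omega> j) = Y x"
    and res: "\<And>a. ((\<lambda>x. (x - a) * Y x) \<longlongrightarrow> of_int (n a)) (at a)"
  shows "\<exists>A c0. zeta_expansion T Y n A c0"
proof -
  have opT: "open (- T)" using not_islimpt_imp_closed[OF T] by (simp add: open_Compl)
  have n0: "n a = 0" if "a \<notin> T" for a
  proof -
    have "isCont Y a" using holo opT that by (meson Compl_iff continuous_on_eq_continuous_at holomorphic_on_imp_continuous_on)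
    hence "((\<lambda>x. (x - a) * Y x) \<longlongrightarrow> (a - a) * Y a) (at a)" by (intro tendsto_intros isContD)
    from res[of a] this have "(of_int (n a) :: complex) = (a - a) * Y a" by (rule LIM_unique)
    thus ?thesis by simp
  qed
  have nper: "n (a + w) = n a" if w: "w \<in> Lat" for a w
  proof -
    have "Y (x + 2 * \<omega> j) = Y x + (\<lambda>_. 0) j" if "j \<in> {1, 3}" "x \<notin> T" "x + 2 * \<omega> j \<notin> T" for j x
      using per[OF that] by simp
    from quasi_periodic_Lat[where f = Y and T = T and c = "\<lambda>_. 0", OF T this w] 
    obtain d where "\<And>z. eventually (\<lambda>x. Y (x + w) = Y x + d) (at z)" "d = 0" by blast
    hence ev: "eventually (\<lambda>x. Y (x + w) = Y x) (at a)" by simp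
    have "((\<lambda>x. (x + w - (a + w)) * Y (x + w)) \<longlongrightarrow> of_int (n (a + w))) (at a)"
      using res[of "a + w"] unfolding tendsto_at_shift .
    moreover have "eventually (\<lambda>x. (x + w - (a + w)) * Y (x + w) = (x - a) * Y x) (at a)"
      using ev by eventually_elim simp
    ultimately have "((\<lambda>x. (x - a) * Y x) \<longlongrightarrow> of_int (n (a + w))) (at a)" by (rule Lim_transform_eventually)
    from res[of a] this have "(of_int (n a) :: complex) = of_int (n (a + w))" by (rule LIM_unique)
    thus ?thesis by simp
  qed
  obtain R K where R: "R \<subseteq> K" "compact K" "\<And>z. \<exists>w\<in>Lat. z + w \<in> R" 
    "\<And>a b. a \<in> R \<Longrightarrow> b \<in> R \<Longrightarrow> a - b \<in> Lat \<Longrightarrow> a = b"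
    using fundamental_domain by blast
  define A where "A = {a \<in> R. n a \<noteq> 0}"
  have "finite (K \<inter> T)" using finite_not_islimpt_in_compact[OF R(2)] T by blast
  moreover have "A \<subseteq> K \<inter> T" unfolding A_def using R(1) n0 by blast
  ultimately have finA: "finite A" using finite_subset by blast
  have A_inj: "a = b" if "a \<in> A" "b \<in> A" "a - b \<in> Lat" for a b using R(4) that unfolding A_def by blast
  have nA: "n x = n a" if "a \<in> A" "x - a \<in> Lat" for a x
    using nper[OF that(2), of a] by simp
  have notT: "x - a \<notin> Lat" if "x \<notin> T" "a \<in> A" for x a
  proof
    assume "x - a \<in> Lat"
    hence "n x = n a" by (rule nA[OF that(2)])
    thus False using n0[OF that(1)] that(2) unfolding A_def by simp
  qed
  define e where "e = (\<lambda>x. Y x - (\<Sum>a\<in>A. of_int (n a) * wz (x - a)))"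
  have holo_e: "e holomorphic_on - T"
    unfolding e_def by (intro holomorphic_intros holo) (use notT in auto)
  define N where "N = (\<Sum>a\<in>A. n a)"
  obtain c1 c0 where c: "\<And>x. x \<notin> T \<Longrightarrow> e x = c1 * x + c0" "\<And>j. j \<in> {1,3} \<Longrightarrow> c1 * (2 * \<omega> j) = - of_int N * (2 * wz (\<omega> j))"
  proof (rule elliptic_liouville[OF T holo_e, of "\<lambda>j. - of_int N * (2 * wz (\<omega> j))"])
    show "e (x + 2 * \<omega> j) = e x + - of_int N * (2 * wz (\<omega> j))" if jx: "j \<in> {1,3}" "x \<notin> T" "x + 2 * \<omega> j \<notin> T" for j x
    proof -
      have "wz (x + 2 * \<omega> j - a) = wz (x - a) + 2 * wz (\<omega> j)" if "a \<in> A" for a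
        using wz_add_two_omega[OF jx(1) notT[OF jx(2) that]] by (simp add: algebra_simps)
      hence "(\<Sum>a\<in>A. of_int (n a) * wz (x + 2 * \<omega> j - a)) = (\<Sum>a\<in>A. of_int (n a) * wz (x - a) + of_int (n a) * (2 * wz (\<omega> j)))"
        by (intro sum.cong) (auto simp: algebra_simps)
      also have "\<dots> = (\<Sum>a\<in>A. of_int (n a) * wz (x - a)) + of_int N * (2 * wz (\<omega> j))"
        by (simp add: sum.distrib N_def flip: sum_distrib_right)
      finally show ?thesis unfolding e_def using per[OF jx] by simp
    qed
    show "\<exists>w\<in>Lat. ((\<lambda>x. (x - (z + w)) * e x) \<longlongrightarrow> 0) (at (z + w))" for z
    proof -
      obtain w where w: "w \<in> Lat" "z + w \<in> R" using R(3) by blast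
      define b where "b = z + w"
      have "((\<lambda>x. (x - b) * Y x - (\<Sum>a\<in>A. of_int (n a) * ((x - b) * wz (x - a)))) \<longlongrightarrow> 
         of_int (n b) - (\<Sum>a\<in>A. of_int (n a) * of_bool (b - a \<in> Lat))) (at b)"
        by (intro tendsto_intros res lim_wz)
      moreover have "(\<lambda>x. (x - b) * Y x - (\<Sum>a\<in>A. of_int (n a) * ((x - b) * wz (x - a)))) = (\<lambda>x. (x - b) * e x)"
        by (auto simp: e_def sum_distrib_left algebra_simps)
      moreover have "(\<Sum>a\<in>A. of_int (n a) * of_bool (b - a \<in> Lat)) = (of_int (n b) :: complex)"
      proof -
        have "(\<Sum>a\<in>A. of_int (n a) * of_bool (b - a \<in> Lat)) = (\<Sum>a\<in>A. if a = b then (of_int (n b) :: complex) else 0)"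
        proof (intro sum.cong refl)
          fix a assume a: "a \<in> A"
          show "of_int (n a) * of_bool (b - a \<in> Lat) = (if a = b then (of_int (n b) :: complex) else 0)"
            using R(4)[of b a] a w(2) by (auto simp: A_def b_def)
        qed
        also have "\<dots> = (if b \<in> A then of_int (n b) else 0)" using finA by simp
        also have "\<dots> = of_int (n b)" using w(2) by (auto simp: A_def b_def)
        finally show ?thesis .
      qed
      ultimately show ?thesis using w(1) unfolding b_def by (intro bexI[of _ w]) auto
    qed
  qed auto
  have "c1 * \<omega> j = - of_int N * wz (\<omega> j)" if "j \<in> {1,3}" for j using c(2)[OF that] by simp
  from legendre_nondegenerate[OF this] have "c1 = 0" and N0: "N = 0" by auto
  hence Y_eq: "Y x = c0 + (\<Sum>a\<in>A. of_int (n a) * wz (x - a))" if "x \<notin> T" for x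
    using c(1)[OF that] by (simp add: e_def algebra_simps)
  have exA: "\<exists>a\<in>A. z - a \<in> Lat" if "n z \<noteq> 0" for z
  proof -
    obtain w where w: "w \<in> Lat" "z + w \<in> R" using R(3) by blast
    hence "z + w \<in> A" using that nper[OF w(1), of z] by (simp add: A_def)
    moreover have "z - (z + w) \<in> Lat" using w(1) by simp
    ultimately show ?thesis by blast
  qed
  show ?thesis
    using finA A_inj nA exA notT n0 N0[unfolded N_def] Y_eq unfolding zeta_expansion_def by (intro exI[of _ A] exI[of _ c0]) blast
qed

text \<open>
  \<open>\<Lambda> = exp (c0 x) \<Prod> \<sigma> (x - a) ^ n a\<close> has the logarithmic derivative \<open>Y\<close>, as \<open>\<sigma>' / \<sigma> = \<zeta>\<close>. Its
  order at \<open>z\<close> is \<open>n z\<close>. In the multiplier, the factors that do not depend on \<open>a\<close> cancel because the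
  residues sum to zero; what is left depends on the poles only through \<open>\<alpha> = \<Sum> n a * a\<close>.
\<close>
lemma elliptic_logderiv_integrate:
  fixes n :: "complex \<Rightarrow> int"
  assumes T: "\<And>z. \<not> z islimpt T" and holo: "Y holomorphic_on - T"
    and per: "\<And>j x. j \<in> {1, 3} \<Longrightarrow> x \<notin> T \<Longrightarrow> x + 2 * \<omega> j \<notin> T \<Longrightarrow> Y (x + 2 * \<omega> j) = Y x"
    and res: "\<And>a. ((\<lambda>x. (x - a) * Y x) \<longlongrightarrow> of_int (n a)) (at a)"
  obtains \<Lambda> \<kappa> \<alpha> where "\<Lambda> nicely_meromorphic_on UNIV" 
    "\<And>z. n z \<ge> 0 \<Longrightarrow> \<Lambda> analytic_on {z}"
    "\<And>z m. n z \<ge> - int m \<Longrightarrow> \<exists>L. ((\<lambda>x. (x - z) ^ m * \<Lambda> x) \<longlongrightarrow> L) (at z)"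
    "\<And>j x. j \<in> {1, 3} \<Longrightarrow> \<Lambda> (x + 2 * \<omega> j) = exp (2 * \<omega> j * \<kappa> - 2 * wz (\<omega> j) * \<alpha>) * \<Lambda> x"
    "\<And>x. x \<notin> T \<Longrightarrow> \<Lambda> x \<noteq> 0 \<and> (\<Lambda> has_field_derivative Y x * \<Lambda> x) (at x)"
proof -
  have "\<exists>A c0. zeta_expansion T Y n A c0" by (rule elliptic_zeta_expansion[OF T holo per res])
  then obtain A c0 where "zeta_expansion T Y n A c0" by blast
  hence finA: "finite A" and A_inj: "\<And>a b. a \<in> A \<Longrightarrow> b \<in> A \<Longrightarrow> a - b \<in> Lat \<Longrightarrow> a = b"
    and nA: "\<And>a x. a \<in> A \<Longrightarrow> x - a \<in> Lat \<Longrightarrow> n x = n a" and exA: "\<And>x. n x \<noteq> 0 \<Longrightarrow> \<exists>a\<in>A. x - a \<in> Lat"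
    and notT: "\<And>x a. x \<notin> T \<Longrightarrow> a \<in> A \<Longrightarrow> x - a \<notin> Lat" and n0: "\<And>x. x \<notin> T \<Longrightarrow> n x = 0"
    and N0: "(\<Sum>a\<in>A. n a) = 0"
    and Y_eq: "\<And>x. x \<notin> T \<Longrightarrow> Y x = c0 + (\<Sum>a\<in>A. of_int (n a) * wz (x - a))"
    unfolding zeta_expansion_def by blast+
  define F where "F = (\<lambda>a x. ws (x - a) powi n a)"
  define \<Lambda> where "\<Lambda> = (\<lambda>x. exp (c0 * x) * (\<Prod>a\<in>A. F a x))"
  define \<alpha> where "\<alpha> = (\<Sum>a\<in>A. of_int (n a) * a)"
  have F_ana: "F a analytic_on {z}" if "n a \<ge> 0 \<or> z - a \<notin> Lat" for a z
    unfolding F_def using that by (intro analytic_intros) (auto simp: ws_eq_0_iff)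
  have Lam_ana: "\<Lambda> analytic_on {z}" if "n z \<ge> 0" for z
    unfolding \<Lambda>_def
  proof (intro analytic_intros F_ana)
    fix a assume "a \<in> A"
    thus "n a \<ge> 0 \<or> z - a \<notin> Lat" using nA[of a z] that by auto
  qed
  have rest: "(\<lambda>x. exp (c0 * x) * (\<Prod>a\<in>A - {b}. F a x)) analytic_on {z}" 
    "exp (c0 * z) * (\<Prod>a\<in>A - {b}. F a z) \<noteq> 0" if b: "b \<in> A" "z - b \<in> Lat" for b z
  proof -
    have ne: "z - a \<notin> Lat" if "a \<in> A - {b}" for a
    proof
      assume "z - a \<in> Lat"
      hence "z - b - (z - a) \<in> Lat" using b(2) Lat_diff by blast
      hence "a - b \<in> Lat" by simp
      thus False using A_inj[of a b] b that by auto
    qed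
    show "(\<lambda>x. exp (c0 * x) * (\<Prod>a\<in>A - {b}. F a x)) analytic_on {z}"
      by (intro analytic_intros F_ana) (use ne in auto)
    show "exp (c0 * z) * (\<Prod>a\<in>A - {b}. F a z) \<noteq> 0"
      using finA ne by (auto simp: F_def ws_eq_0_iff)
  qed
  have split: "\<Lambda> x = (exp (c0 * x) * (\<Prod>a\<in>A - {b}. F a x)) * F b x" if "b \<in> A" for b x
    unfolding \<Lambda>_def using prod.remove[OF finA that, of "\<lambda>a. F a x"] by simp
  show ?thesis
  proof (rule that[of \<Lambda> c0 \<alpha>])
    show "\<Lambda> analytic_on {z}" if "n z \<ge> 0" for z by (rule Lam_ana[OF that])
    have pole: "is_pole \<Lambda> z \<and> \<Lambda> z = 0" if nz: "n z < 0" for z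
    proof -
      obtain b where b: "b \<in> A" "z - b \<in> Lat" using exA[of z] nz by auto
      have nb: "n b < 0" using nA[OF b] nz by simp
      have "is_pole (F b) z" unfolding F_def
      proof (rule is_pole_power_int_0[OF _ _ nb])
        show "(\<lambda>x. ws (x - b)) analytic_on {z}" by (intro analytic_intros)
        have "((\<lambda>x. ws (x - b)) \<longlongrightarrow> ws (z - b)) (at z)" by (rule isCont_shift[OF isCont_ws])
        moreover have "ws (z - b) = 0" using b by (simp add: ws_eq_0_iff)
        moreover have "eventually (\<lambda>x. ws (x - b) \<noteq> 0) (at z)"
          using ev_notin_Lat_shift[of b z] by eventually_elim (simp add: ws_eq_0_iff)
        ultimately show "isolated_zero (\<lambda>x. ws (x - b)) z" unfolding isolated_zero_def by simp
      qed
      hence "is_pole (\<lambda>x. (exp (c0 * x) * (\<Prod>a\<in>A - {b}. F a x)) * F b x) z"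
        using rest[OF b] by (rule is_pole_mult_analytic_nonzero1)
      hence "is_pole \<Lambda> z" using split[OF b(1)] by (simp add: is_pole_def)
      moreover have "F b z = 0" using b nb by (simp add: F_def ws_eq_0_iff power_int_0_left_if)
      hence "\<Lambda> z = 0" using split[OF b(1)] by simp
      ultimately show ?thesis by simp
    qed
    show "\<Lambda> nicely_meromorphic_on UNIV"
    proof (rule nicely_meromorphic_onI_open)
      show "\<Lambda> analytic_on UNIV - {z. n z < 0}"
      proof -
        have "\<Lambda> analytic_on {z}" if "z \<in> UNIV - {z. n z < 0}" for z using Lam_ana that by auto
        thus ?thesis using analytic_on_analytic_at by blast
      qed
      show "is_pole \<Lambda> x \<and> \<Lambda> x = 0" if "x \<in> {z. n z < 0}" for x using pole that by blast
      show "isolated_singularity_at \<Lambda> x" for x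
      proof (rule isolated_singularity_off_discrete[OF T])
        have "\<Lambda> analytic_on {z}" if "z \<in> - T" for z using Lam_ana[of z] n0[of z] that by auto
        hence "\<Lambda> analytic_on - T" using analytic_on_analytic_at by blast
        thus "\<Lambda> holomorphic_on - T" by (rule analytic_imp_holomorphic)
      qed
    qed auto
    show "\<exists>L. ((\<lambda>x. (x - z) ^ m * \<Lambda> x) \<longlongrightarrow> L) (at z)" if nm: "n z \<ge> - int m" for z m
    proof (cases "n z \<ge> 0")
      case True
      hence "(\<Lambda> \<longlongrightarrow> \<Lambda> z) (at z)" using Lam_ana analytic_at_imp_isCont isContD by blast
      hence "((\<lambda>x. (x - z) ^ m * \<Lambda> x) \<longlongrightarrow> (z - z) ^ m * \<Lambda> z) (at z)" by (intro tendsto_intros)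
      thus ?thesis by blast
    next
      case False
      obtain b where b: "b \<in> A" "z - b \<in> Lat" using exA[of z] False by auto
      obtain L where L: "((\<lambda>x. (x - z) / ws (x - b)) \<longlongrightarrow> L) (at z)" using lim_ws_inverse by blast
      \<comment> \<open>\<open>\<sigma> ^ n b = \<sigma> ^ k / \<sigma> ^ m\<close>, and the denominator is absorbed by \<open>(x - z) ^ m\<close>\<close>
      define k where "k = nat (n b + int m)"
      have k: "n b = int k - int m" using nm nA[OF b] by (simp add: k_def)
      let ?r = "\<lambda>x. exp (c0 * x) * (\<Prod>a\<in>A - {b}. F a x)"
      have r: "(?r \<longlongrightarrow> ?r z) (at z)" using rest(1)[OF b] analytic_at_imp_isCont isContD by blast
      have "((\<lambda>x. ?r x * (((x - z) / ws (x - b)) ^ m * ws (x - b) ^ k)) \<longlongrightarrow> ?r z * (L ^ m * ws (z - b) ^ k)) (at z)"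
        by (intro tendsto_mult tendsto_power r L isCont_shift isCont_ws)
      moreover have "eventually (\<lambda>x. ?r x * (((x - z) / ws (x - b)) ^ m * ws (x - b) ^ k) = (x - z) ^ m * \<Lambda> x) (at z)"
        using ev_notin_Lat_shift[of b z]
      proof eventually_elim
        case (elim x)
        hence w0: "ws (x - b) \<noteq> 0" by (simp add: ws_eq_0_iff)
        have "F b x = ws (x - b) ^ k / ws (x - b) ^ m" unfolding F_def k using w0 by (simp add: power_int_diff)
        thus ?case unfolding split[OF b(1), of x] using w0 by (simp add: power_divide)
      qed
      ultimately have "((\<lambda>x. (x - z) ^ m * \<Lambda> x) \<longlongrightarrow> ?r z * (L ^ m * ws (z - b) ^ k)) (at z)"
        by (rule Lim_transform_eventually)
      thus ?thesis by blast
    qed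
    show "\<Lambda> (x + 2 * \<omega> j) = exp (2 * \<omega> j * c0 - 2 * wz (\<omega> j) * \<alpha>) * \<Lambda> x" if j: "j \<in> {1, 3}" for j x
    proof -
      obtain C where C: "C \<noteq> 0" "\<And>z. ws (z + 2 * \<omega> j) = C * exp (2 * wz (\<omega> j) * z) * ws z"
        using ws_add_two_omega[OF j] by blast
      define g where "g = Ln C"
      have g: "C = exp g" using C(1) by (simp add: g_def)
      have "F a (x + 2 * \<omega> j) = exp (of_int (n a) * (g + 2 * wz (\<omega> j) * (x - a))) * F a x" for a
      proof -
        have "x + 2 * \<omega> j - a = (x - a) + 2 * \<omega> j" by simp
        hence "F a (x + 2 * \<omega> j) = (exp (g + 2 * wz (\<omega> j) * (x - a)) * ws (x - a)) powi n a"
          unfolding F_def by (simp only: C(2) g exp_add)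
        thus ?thesis by (simp add: power_int_mult_distrib exp_power_int F_def)
      qed
      hence "(\<Prod>a\<in>A. F a (x + 2 * \<omega> j)) = (\<Prod>a\<in>A. exp (of_int (n a) * (g + 2 * wz (\<omega> j) * (x - a)))) * (\<Prod>a\<in>A. F a x)"
        by (simp add: prod.distrib)
      also have "(\<Prod>a\<in>A. exp (of_int (n a) * (g + 2 * wz (\<omega> j) * (x - a)))) = exp (\<Sum>a\<in>A. of_int (n a) * (g + 2 * wz (\<omega> j) * (x - a)))"
        using finA by (simp add: exp_sum)
      also have "(\<Sum>a\<in>A. of_int (n a) * (g + 2 * wz (\<omega> j) * (x - a))) = 
         (\<Sum>a\<in>A. of_int (n a) * (g + 2 * wz (\<omega> j) * x)) - (\<Sum>a\<in>A. 2 * wz (\<omega> j) * (of_int (n a) * a))"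
        unfolding sum_subtractf[symmetric] by (intro sum.cong) (auto simp: algebra_simps)
      also have "(\<Sum>a\<in>A. of_int (n a) * (g + 2 * wz (\<omega> j) * x)) = of_int (\<Sum>a\<in>A. n a) * (g + 2 * wz (\<omega> j) * x)"
        unfolding of_int_sum sum_distrib_right ..
      also have "(\<Sum>a\<in>A. 2 * wz (\<omega> j) * (of_int (n a) * a)) = 2 * wz (\<omega> j) * \<alpha>"
        unfolding \<alpha>_def sum_distrib_left ..
      finally have P: "(\<Prod>a\<in>A. F a (x + 2 * \<omega> j)) = exp (- (2 * wz (\<omega> j) * \<alpha>)) * (\<Prod>a\<in>A. F a x)"
        using N0 by simp
      have E: "exp (c0 * (x + 2 * \<omega> j)) = exp (2 * \<omega> j * c0) * exp (c0 * x)"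
        unfolding exp_add[symmetric] by (simp add: algebra_simps)
      have D: "exp (2 * \<omega> j * c0 - 2 * wz (\<omega> j) * \<alpha>) = exp (2 * \<omega> j * c0) * exp (- (2 * wz (\<omega> j) * \<alpha>))"
        unfolding exp_add[symmetric] by simp
      show ?thesis unfolding \<Lambda>_def P E D by (simp only: mult_ac)
    qed
    show "\<Lambda> x \<noteq> 0 \<and> (\<Lambda> has_field_derivative Y x * \<Lambda> x) (at x)" if x: "x \<notin> T" for x
    proof
      show "\<Lambda> x \<noteq> 0" unfolding \<Lambda>_def using finA notT[OF x] by (auto simp: F_def ws_eq_0_iff)
      have "(F a has_field_derivative (of_int (n a) * wz (x - a)) * F a x) (at x)" if a: "a \<in> A" for a
      proof -
        have na: "x - a \<notin> Lat" by (rule notT[OF x a])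
        have d: "((\<lambda>x. ws (x - a)) has_field_derivative wz (x - a) * ws (x - a)) (at x)"
          using ws_logderiv[OF na] DERIV_shift[of ws _ x "- a"] by simp
        have w0: "ws (x - a) \<noteq> 0" using na by (simp add: ws_eq_0_iff)
        have "((\<lambda>x. ws (x - a) powi n a) has_field_derivative of_int (n a) * ws (x - a) powi (n a - 1) * (wz (x - a) * ws (x - a))) (at x)"
          by (rule DERIV_power_int[OF d]) (use w0 in simp)
        also have "of_int (n a) * ws (x - a) powi (n a - 1) * (wz (x - a) * ws (x - a)) = (of_int (n a) * wz (x - a)) * F a x"
          using w0 by (simp add: F_def power_int_diff)
        finally show ?thesis unfolding F_def .
      qed
      hence "((\<lambda>x. \<Prod>a\<in>A. F a x) has_field_derivative (\<Sum>a\<in>A. of_int (n a) * wz (x - a)) * (\<Prod>a\<in>A. F a x)) (at x)"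
        by (intro logderiv_prod finA)
      from logderiv_mult[OF logderiv_exp this] show "(\<Lambda> has_field_derivative Y x * \<Lambda> x) (at x)"
        unfolding Y_eq[OF x] \<Lambda>_def .
    qed
  qed
qed

end

section \<open>The building blocks of the two expressions\<close>

lemma higher_deriv_shift:
  fixes f :: "complex \<Rightarrow> complex"
  shows "(deriv ^^ j) (\<lambda>x. f (x + w)) z = (deriv ^^ j) f (z + w)"
proof (induction j arbitrary: z)
  case (Suc j)
  have d: "deriv (\<lambda>x. h (x + w)) z = deriv h (z + w)" for h :: "complex \<Rightarrow> complex"
    unfolding deriv_def by (simp add: DERIV_shift)
  have "(deriv ^^ Suc j) (\<lambda>x. f (x + w)) z = deriv ((deriv ^^ j) (\<lambda>x. f (x + w))) z" by simp
  also have "(deriv ^^ j) (\<lambda>x. f (x + w)) = (\<lambda>z. (deriv ^^ j) f (z + w))" using Suc.IH by blast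
  also have "deriv (\<lambda>z. (deriv ^^ j) f (z + w)) z = deriv ((deriv ^^ j) f) (z + w)" by (rule d)
  finally show ?case by simp
qed auto

text \<open>
  Differentiation respects multipliers.
\<close>
lemma higher_deriv_multiplier:
  assumes holo: "f holomorphic_on S" and S: "open S" "x \<in> S"
    and eq: "\<And>y. y \<in> S \<Longrightarrow> f (y + w) = c * f y"
  shows "(deriv ^^ j) f (x + w) = c * (deriv ^^ j) f x"
proof -
  have "(deriv ^^ j) f (x + w) = (deriv ^^ j) (\<lambda>y. f (y + w)) x" by (simp add: higher_deriv_shift)
  also have "\<dots> = (deriv ^^ j) (\<lambda>y. c * f y) x"
  proof (rule higher_deriv_cong_ev)
    have "eventually (\<lambda>y. y \<in> S) (nhds x)" using S by (rule eventually_nhds_in_open)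
    thus "\<forall>\<^sub>F y in nhds x. f (y + w) = c * f y" by eventually_elim (rule eq)
  qed auto
  also have "\<dots> = c * (deriv ^^ j) f x" by (rule higher_deriv_cmult[OF holo S(2) S(1)])
  finally show ?thesis .
qed

context half_periods begin

abbreviation HP :: "complex set" where "HP \<equiv> half_period_points \<omega>"

lemma HP_iff: "x \<in> HP \<longleftrightarrow> (\<exists>i\<le>3. x + \<omega> i \<in> Lat)"
  by (simp add: half_period_points_def)

lemma notin_HP: "x \<notin> HP \<Longrightarrow> i \<le> 3 \<Longrightarrow> x + \<omega> i \<notin> Lat"
  by (auto simp: HP_iff)

lemma Lat_subset_HP: "x \<in> Lat \<Longrightarrow> x \<in> HP"
  by (auto simp: HP_iff omega_0 intro!: exI[of _ 0])

lemma ev_notin_HP: "eventually (\<lambda>x. x \<notin> HP) (at z)"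
proof -
  have "eventually (\<lambda>x. \<forall>i\<in>{..3}. x - (- \<omega> i) \<notin> Lat) (at z)"
    by (intro eventually_ball_finite ballI ev_notin_Lat_shift) auto
  thus ?thesis by eventually_elim (auto simp: HP_iff)
qed

lemma not_islimpt_HP: "\<not> z islimpt HP"
  using ev_notin_HP[of z] by (simp add: islimpt_iff_eventually)

lemma closed_HP: "closed HP" by (rule not_islimpt_imp_closed[OF not_islimpt_HP])

lemma open_HP_compl: "open (- HP)" using closed_HP by (simp add: open_Compl)

lemma HP_add_Lat: "w \<in> Lat \<Longrightarrow> x + w \<in> HP \<longleftrightarrow> x \<in> HP"
proof -
  assume w: "w \<in> Lat"
  have "x + w + \<omega> i \<in> Lat \<longleftrightarrow> x + \<omega> i \<in> Lat" for i
    using Lat_add_iff[OF w, of "x + \<omega> i"] by (simp add: add_ac)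
  thus ?thesis by (simp add: HP_iff)
qed

lemma omega_bool:
  assumes "i \<le> 3" "k \<le> 3"
  shows "- \<omega> k + \<omega> i \<in> Lat \<longleftrightarrow> i = k"
  using omega_diff_notin_Lat[of i k] assms by (cases "i = k") auto

lemma Phi_eq: "Phi \<omega> i \<alpha> x = ws (x + \<omega> i - \<alpha>) / ws (x + \<omega> i) * exp (wz \<alpha> * x)"
  by (simp add: Phi_def)

lemma Phi_holomorphic: "i \<le> 3 \<Longrightarrow> Phi \<omega> i \<alpha> holomorphic_on - HP"
  unfolding Phi_eq[abs_def] by (intro holomorphic_intros) (auto simp: ws_eq_0_iff notin_HP)

lemma Phi_analytic_at: "z + \<omega> i \<notin> Lat \<Longrightarrow> Phi \<omega> i \<alpha> analytic_on {z}"
  unfolding Phi_eq[abs_def] by (intro analytic_intros) (auto simp: ws_eq_0_iff)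

text \<open>
  The constants in the quasi-periodicity of \<open>\<sigma>\<close> cancel in the quotient, as does the shift \<open>\<omega> i\<close>: all four
  functions have the same multipliers.
\<close>
lemma Phi_quasi:
  assumes "j \<in> {1,3}"
  shows "Phi \<omega> i \<alpha> (x + 2 * \<omega> j) = exp (- 2 * wz (\<omega> j) * \<alpha> + 2 * \<omega> j * wz \<alpha>) * Phi \<omega> i \<alpha> x"
proof -
  obtain C where C: "C \<noteq> 0" "\<And>z. ws (z + 2 * \<omega> j) = C * exp (2 * wz (\<omega> j) * z) * ws z"
    using ws_add_two_omega[OF assms] by blast
  let ?e = "2 * wz (\<omega> j)" and ?y = "x + \<omega> i"
  have e1: "x + 2 * \<omega> j + \<omega> i - \<alpha> = (?y - \<alpha>) + 2 * \<omega> j" and e2: "x + 2 * \<omega> j + \<omega> i = ?y + 2 * \<omega> j" by simp_all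
  have x1: "exp (?e * (?y - \<alpha>)) = exp (- ?e * \<alpha>) * exp (?e * ?y)"
    unfolding exp_add[symmetric] by (simp add: algebra_simps)
  have x2: "exp (wz \<alpha> * (x + 2 * \<omega> j)) = exp (2 * \<omega> j * wz \<alpha>) * exp (wz \<alpha> * x)"
    unfolding exp_add[symmetric] by (simp add: algebra_simps)
  have x3: "exp (- 2 * wz (\<omega> j) * \<alpha> + 2 * \<omega> j * wz \<alpha>) = exp (- ?e * \<alpha>) * exp (2 * \<omega> j * wz \<alpha>)"
    unfolding exp_add[symmetric] by simp
  have gen: "C * (p * r) * s / (C * r * t) * (q * u) = p * q * (s / t * u)" if "r \<noteq> 0" for p q r s t u :: complex
    using that C(1) by simp
  have s1: "ws (x + 2 * \<omega> j + \<omega> i - \<alpha>) = C * exp (?e * (?y - \<alpha>)) * ws (?y - \<alpha>)" unfolding e1 C(2) ..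
  have s2: "ws (x + 2 * \<omega> j + \<omega> i) = C * exp (?e * ?y) * ws ?y" unfolding e2 C(2) ..
  show ?thesis unfolding Phi_eq s1 s2 x1 x2 x3 by (rule gen) simp
qed

lemma Phi_lim:
  assumes "i \<le> 3" "\<alpha> \<notin> Lat"
  shows "\<exists>c. c \<noteq> 0 \<and> ((\<lambda>x. (x + \<omega> i) ^ Suc 0 * Phi \<omega> i \<alpha> x) \<longlongrightarrow> c) (at (- \<omega> i))"
proof -
  obtain L where L: "((\<lambda>x. (x - (- \<omega> i)) / ws (x - (- \<omega> i))) \<longlongrightarrow> L) (at (- \<omega> i))" "L = 0 \<longleftrightarrow> - \<omega> i - (- \<omega> i) \<notin> Lat"
    by (rule lim_ws_inverse[of "- \<omega> i" "- \<omega> i"])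
  have "((\<lambda>x. (x - (- \<omega> i)) / ws (x - (- \<omega> i)) * (ws (x - (\<alpha> - \<omega> i)) * exp (wz \<alpha> * x))) \<longlongrightarrow> 
     L * (ws (- \<omega> i - (\<alpha> - \<omega> i)) * exp (wz \<alpha> * (- \<omega> i)))) (at (- \<omega> i))"
    by (intro tendsto_intros L isCont_shift isCont_ws)
  moreover have "(\<lambda>x. (x - (- \<omega> i)) / ws (x - (- \<omega> i)) * (ws (x - (\<alpha> - \<omega> i)) * exp (wz \<alpha> * x))) = (\<lambda>x. (x + \<omega> i) ^ Suc 0 * Phi \<omega> i \<alpha> x)"
  proof
    fix x
    have e: "x - (\<alpha> - \<omega> i) = x + \<omega> i - \<alpha>" by simp
    show "(x - (- \<omega> i)) / ws (x - (- \<omega> i)) * (ws (x - (\<alpha> - \<omega> i)) * exp (wz \<alpha> * x)) = (x + \<omega> i) ^ Suc 0 * Phi \<omega> i \<alpha> x"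
      unfolding e Phi_eq by simp
  qed
  moreover have "L * (ws (- \<omega> i - (\<alpha> - \<omega> i)) * exp (wz \<alpha> * (- \<omega> i))) \<noteq> 0"
    using L(2) assms(2) by (simp add: ws_eq_0_iff)
  ultimately show ?thesis by metis
qed

lemma Phi_sum_quasi:
  assumes j: "j \<in> {1,3}" and x: "x \<notin> HP"
  shows "(\<Sum>i\<le>3. \<Sum>k<n i. b i k * (deriv ^^ k) (Phi \<omega> i \<alpha>) (x + 2 * \<omega> j)) = 
    exp (- 2 * wz (\<omega> j) * \<alpha> + 2 * \<omega> j * wz \<alpha>) * (\<Sum>i\<le>3. \<Sum>k<n i. b i k * (deriv ^^ k) (Phi \<omega> i \<alpha>) x)"
proof -
  have "(deriv ^^ k) (Phi \<omega> i \<alpha>) (x + 2 * \<omega> j) = exp (- 2 * wz (\<omega> j) * \<alpha> + 2 * \<omega> j * wz \<alpha>) * (deriv ^^ k) (Phi \<omega> i \<alpha>) x"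
    if "i \<le> 3" for i k
    by (rule higher_deriv_multiplier[OF Phi_holomorphic[OF that] open_HP_compl]) (use x Phi_quasi[OF j] in auto)
  thus ?thesis unfolding sum_distrib_left by (intro sum.cong refl) (simp only: mult.left_commute atMost_iff)
qed

lemma expression_A_quasi:
  assumes A: "expression_A \<omega> lt \<Lambda> \<alpha> \<kappa> b" and j: "j \<in> {1,3}" and x: "x \<notin> HP"
  shows "\<Lambda> (x + 2 * \<omega> j) = exp (- 2 * wz (\<omega> j) * \<alpha> + 2 * \<omega> j * wz \<alpha> + 2 * \<kappa> * \<omega> j) * \<Lambda> x"
proof -
  have L: "\<Lambda> y = exp (\<kappa> * y) * (\<Sum>i\<le>3. \<Sum>k<lt i. b i k * (deriv ^^ k) (Phi \<omega> i \<alpha>) y)" if "y \<notin> HP" for y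
    using A that unfolding expression_A_def by blast
  have x': "x + 2 * \<omega> j \<notin> HP" using HP_add_Lat[OF two_omega_in_Lat[OF j]] x by blast
  have e: "exp (\<kappa> * (x + 2 * \<omega> j)) = exp (2 * \<kappa> * \<omega> j) * exp (\<kappa> * x)" unfolding exp_add[symmetric] by (simp add: algebra_simps)
  show ?thesis unfolding L[OF x] L[OF x'] Phi_sum_quasi[OF j x] e exp_add[of "- 2 * wz (\<omega> j) * \<alpha> + 2 * \<omega> j * wz \<alpha>"] 
    by (simp only: mult_ac)
qed

lemma wp_shift_holomorphic: "i \<le> 3 \<Longrightarrow> (\<lambda>y. wp (y + \<omega> i)) holomorphic_on - HP"
  by (intro holomorphic_intros) (auto simp: notin_HP)

lemma wp_shift_analytic_at: 
  assumes "z + \<omega> i \<notin> Lat"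
  shows "(\<lambda>y. wp (y + \<omega> i)) analytic_on {z}"
proof -
  have o: "open ((\<lambda>y. y + \<omega> i) -` (- Lat))"
    by (intro open_vimage open_Lat_compl continuous_intros)
  have "(\<lambda>y. wp (y + \<omega> i)) holomorphic_on ((\<lambda>y. y + \<omega> i) -` (- Lat))" by (intro holomorphic_intros) auto
  from holomorphic_on_imp_analytic_at[OF this o] show ?thesis using assms by auto
qed

lemma wp_sum_periodic:
  assumes j: "j \<in> {1,3}" and x: "x \<notin> HP"
  shows "(\<Sum>i\<le>3. \<Sum>k<n i. b i k * (deriv ^^ k) (\<lambda>y. wp (y + \<omega> i)) (x + 2 * \<omega> j)) = 
    (\<Sum>i\<le>3. \<Sum>k<n i. b i k * (deriv ^^ k) (\<lambda>y. wp (y + \<omega> i)) x)"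
proof -
  have "(deriv ^^ k) (\<lambda>y. wp (y + \<omega> i)) (x + 2 * \<omega> j) = 1 * (deriv ^^ k) (\<lambda>y. wp (y + \<omega> i)) x" if i: "i \<le> 3" for i k
  proof (rule higher_deriv_multiplier[OF wp_shift_holomorphic[OF i] open_HP_compl])
    fix y assume "y \<in> - HP"
    thus "wp (y + 2 * \<omega> j + \<omega> i) = 1 * wp (y + \<omega> i)"
      using wp_add_two_omega[OF j notin_HP[OF _ i, of y]] by (simp add: add_ac)
  qed (use x in auto)
  thus ?thesis by (intro sum.cong refl) (simp only: mult_1 atMost_iff)
qed

lemma deriv_wp_periodic: "j \<in> {1,3} \<Longrightarrow> x \<notin> Lat \<Longrightarrow> deriv wp (x + 2 * \<omega> j) = deriv wp x"
  using higher_deriv_multiplier[OF wp_holomorphic open_Lat_compl, of x "2 * \<omega> j" 1 1] wp_add_two_omega[of j] by simp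

lemma expression_B_quasi:
  assumes B: "expression_B \<omega> lt \<Lambda> \<kappa> c b cc" and j: "j \<in> {1,3}" and x: "x \<notin> HP"
  shows "\<Lambda> (x + 2 * \<omega> j) = exp (2 * \<kappa> * \<omega> j) * \<Lambda> x"
proof -
  have L: "\<Lambda> y = exp (\<kappa> * y) *
          (c + (\<Sum>i\<le>3. \<Sum>k<lt i - 1. b i k * (deriv ^^ k) (\<lambda>y. wp (y + \<omega> i)) y)
             + (\<Sum>i=1..3. cc i * deriv wp y / (wp y - wp (\<omega> i))))" if "y \<notin> HP" for y
    using B that unfolding expression_B_def by blast
  have x': "x + 2 * \<omega> j \<notin> HP" using HP_add_Lat[OF two_omega_in_Lat[OF j]] x by blast
  have xL: "x \<notin> Lat" using Lat_subset_HP x by blast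
  have e: "exp (\<kappa> * (x + 2 * \<omega> j)) = exp (2 * \<kappa> * \<omega> j) * exp (\<kappa> * x)" unfolding exp_add[symmetric] by (simp add: algebra_simps)
  show ?thesis unfolding L[OF x] L[OF x'] wp_sum_periodic[OF j x] e deriv_wp_periodic[OF j xL] wp_add_two_omega[OF j xL] 
    by (simp only: mult.assoc)
qed

end

section \<open>Expansion in derivatives of Phi\<close>

context half_periods begin

lemma HP_translate:
  assumes "z \<in> HP"
  obtains i where "i \<le> 3" "- \<omega> i - z \<in> Lat"
proof -
  obtain i where i: "i \<le> 3" "z + \<omega> i \<in> Lat" using assms by (auto simp: HP_iff)
  have "- \<omega> i - z = - (z + \<omega> i)" by simp
  hence "- \<omega> i - z \<in> Lat" using i(2) Lat_uminus by metis
  with i(1) show ?thesis by (rule that)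
qed

lemma isCont_off_HP: "f holomorphic_on - HP \<Longrightarrow> z \<notin> HP \<Longrightarrow> isCont f z"
  by (meson Compl_iff continuous_on_eq_continuous_at holomorphic_on_imp_continuous_on open_HP_compl)

text \<open>
  The four half-periods do not interact: the functions attached to one of them are analytic at the
  others.
\<close>
lemma remove_half_period_parts:
  assumes P: "\<And>i j. i \<le> 3 \<Longrightarrow> P i j holomorphic_on - HP"
    and Pan: "\<And>i j z. i \<le> 3 \<Longrightarrow> z + \<omega> i \<notin> Lat \<Longrightarrow> P i j analytic_on {z}"
    and Plim: "\<And>i j. i \<le> 3 \<Longrightarrow> \<exists>p. p \<noteq> 0 \<and> ((\<lambda>x. (x + \<omega> i) ^ Suc (j + d) * P i j x) \<longlongrightarrow> p) (at (- \<omega> i))"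
    and f: "f holomorphic_on - HP" 
    and flim: "\<And>i. i \<le> 3 \<Longrightarrow> \<exists>c. ((\<lambda>x. (x + \<omega> i) ^ (n i + d) * f x) \<longlongrightarrow> c) (at (- \<omega> i))"
  obtains \<beta> c where "\<And>i. i \<le> 3 \<Longrightarrow> ((\<lambda>x. (x + \<omega> i) ^ d * (f x - (\<Sum>i\<le>3. \<Sum>j<n i. \<beta> i j * P i j x))) \<longlongrightarrow> c i) (at (- \<omega> i))"
proof -
  have "\<exists>\<beta> c. ((\<lambda>x. (x + \<omega> i) ^ d * (f x - (\<Sum>j<n i. \<beta> j * P i j x))) \<longlongrightarrow> c) (at (- \<omega> i))" if i: "i \<le> 3" for i
  proof -
    obtain c where c: "((\<lambda>x. (x - (- \<omega> i)) ^ (n i + d) * f x) \<longlongrightarrow> c) (at (- \<omega> i))"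
      using flim[OF i] unfolding diff_minus_eq_add by blast
    have Pl: "\<exists>p. p \<noteq> 0 \<and> ((\<lambda>x. (x - (- \<omega> i)) ^ Suc (j + d) * P i j x) \<longlongrightarrow> p) (at (- \<omega> i))" for j
      unfolding diff_minus_eq_add by (rule Plim[OF i])
    from subtract_principal_part[OF not_islimpt_HP P[OF i] Pl f c]
    show ?thesis unfolding diff_minus_eq_add .
  qed
  hence "\<forall>i\<in>{..3}. \<exists>\<beta> c. ((\<lambda>x. (x + \<omega> i) ^ d * (f x - (\<Sum>j<n i. \<beta> j * P i j x))) \<longlongrightarrow> c) (at (- \<omega> i))"
    by simp
  from bchoice[OF this] obtain \<beta> where 
    "\<forall>i\<in>{..3}. \<exists>c. ((\<lambda>x. (x + \<omega> i) ^ d * (f x - (\<Sum>j<n i. \<beta> i j * P i j x))) \<longlongrightarrow> c) (at (- \<omega> i))" ..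
  from bchoice[OF this] obtain c where 
    c': "\<forall>i\<in>{..3}. ((\<lambda>x. (x + \<omega> i) ^ d * (f x - (\<Sum>j<n i. \<beta> i j * P i j x))) \<longlongrightarrow> c i) (at (- \<omega> i))" ..
  have c: "((\<lambda>x. (x + \<omega> i) ^ d * (f x - (\<Sum>j<n i. \<beta> i j * P i j x))) \<longlongrightarrow> c i) (at (- \<omega> i))" if "i \<le> 3" for i
    using c' that by simp
  have "\<exists>c'. ((\<lambda>x. (x + \<omega> k) ^ d * (f x - (\<Sum>i\<le>3. \<Sum>j<n i. \<beta> i j * P i j x))) \<longlongrightarrow> c') (at (- \<omega> k))" if k: "k \<le> 3" for k
  proof -
    let ?R = "\<lambda>x. \<Sum>i\<in>{..3} - {k}. \<Sum>j<n i. \<beta> i j * P i j x"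
    have "?R analytic_on {- \<omega> k}"
      by (intro analytic_on_sum analytic_on_mult analytic_on_const Pan) (use omega_bool k in auto)
    hence R: "(?R \<longlongrightarrow> ?R (- \<omega> k)) (at (- \<omega> k))" using analytic_at_imp_isCont isContD by blast
    have "((\<lambda>x. (x + \<omega> k) ^ d * (f x - (\<Sum>j<n k. \<beta> k j * P k j x)) - (x + \<omega> k) ^ d * ?R x) \<longlongrightarrow> c k - (- \<omega> k + \<omega> k) ^ d * ?R (- \<omega> k)) (at (- \<omega> k))"
      by (intro tendsto_diff tendsto_mult R c k tendsto_intros)
    moreover have "(x + \<omega> k) ^ d * (f x - (\<Sum>j<n k. \<beta> k j * P k j x)) - (x + \<omega> k) ^ d * ?R x = 
        (x + \<omega> k) ^ d * (f x - (\<Sum>i\<le>3. \<Sum>j<n i. \<beta> i j * P i j x))" for x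
    proof -
      have "(\<Sum>i\<le>3. \<Sum>j<n i. \<beta> i j * P i j x) = (\<Sum>j<n k. \<beta> k j * P k j x) + ?R x"
        using k by (intro sum.remove) auto
      thus ?thesis by (simp add: algebra_simps)
    qed
    ultimately have "((\<lambda>x. (x + \<omega> k) ^ d * (f x - (\<Sum>i\<le>3. \<Sum>j<n i. \<beta> i j * P i j x))) \<longlongrightarrow> c k - (- \<omega> k + \<omega> k) ^ d * ?R (- \<omega> k)) (at (- \<omega> k))"
      by (simp only:)
    thus ?thesis by blast
  qed
  hence "\<forall>k\<in>{..3}. \<exists>c. ((\<lambda>x. (x + \<omega> k) ^ d * (f x - (\<Sum>i\<le>3. \<Sum>j<n i. \<beta> i j * P i j x))) \<longlongrightarrow> c) (at (- \<omega> k))"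
    by simp
  from bchoice[OF this] obtain c' where 
    c': "\<forall>k\<in>{..3}. ((\<lambda>x. (x + \<omega> k) ^ d * (f x - (\<Sum>i\<le>3. \<Sum>j<n i. \<beta> i j * P i j x))) \<longlongrightarrow> c' k) (at (- \<omega> k))" ..
  show ?thesis
  proof (rule that)
    show "((\<lambda>x. (x + \<omega> k) ^ d * (f x - (\<Sum>i\<le>3. \<Sum>j<n i. \<beta> i j * P i j x))) \<longlongrightarrow> c' k) (at (- \<omega> k))" if "k \<le> 3" for k
      using c' that by blast
  qed
qed

text \<open>
  After subtracting the polar parts with derivatives of the \<open>\<Phi>\<^sub>i\<close>, the quotient of the remainder
  \<open>H\<close> by \<open>\<Phi>\<^sub>0\<close> is elliptic, zero at \<open>0\<close>, and its only possible poles are simple and at the zeros \<open>\<alpha> + w\<close>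
  of \<open>\<Phi>\<^sub>0\<close>. Hence it vanishes.
\<close>
lemma expression_A_exists:
  assumes \<alpha>: "\<alpha> \<notin> Lat" and holo: "\<Lambda> holomorphic_on - HP"
    and quasi: "\<And>j x. j \<in> {1, 3} \<Longrightarrow> \<Lambda> (x + 2 * \<omega> j) = exp (2 * \<omega> j * \<kappa> - 2 * wz (\<omega> j) * \<alpha>) * \<Lambda> x"
    and pole: "\<And>i. i \<le> 3 \<Longrightarrow> \<exists>c. ((\<lambda>x. (x + \<omega> i) ^ lt i * \<Lambda> x) \<longlongrightarrow> c) (at (- \<omega> i))"
  shows "\<exists>b. expression_A \<omega> lt \<Lambda> \<alpha> (\<kappa> - wz \<alpha>) b"
proof -
  define \<kappa>' where "\<kappa>' = \<kappa> - wz \<alpha>"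
  define f where "f = (\<lambda>x. exp (- \<kappa>' * x) * \<Lambda> x)"
  define P where "P = (\<lambda>i j. (deriv ^^ j) (Phi \<omega> i \<alpha>))"
  define m where "m = (\<lambda>j. exp (- 2 * wz (\<omega> j) * \<alpha> + 2 * \<omega> j * wz \<alpha>))"
  have f_holo: "f holomorphic_on - HP" unfolding f_def by (intro holomorphic_intros holo)
  have P_holo: "P i j holomorphic_on - HP" if "i \<le> 3" for i j
    unfolding P_def by (intro holomorphic_higher_deriv Phi_holomorphic that open_HP_compl)
  obtain \<beta> c where lim: "\<And>i. i \<le> 3 \<Longrightarrow> ((\<lambda>x. (x + \<omega> i) ^ 0 * (f x - (\<Sum>i\<le>3. \<Sum>j<lt i. \<beta> i j * P i j x))) \<longlongrightarrow> c i) (at (- \<omega> i))"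
  proof (rule remove_half_period_parts[of P 0 f lt])
    show "P i j analytic_on {z}" if "i \<le> 3" "z + \<omega> i \<notin> Lat" for i j z
      unfolding P_def by (intro analytic_higher_deriv Phi_analytic_at that)
    show "\<exists>p. p \<noteq> 0 \<and> ((\<lambda>x. (x + \<omega> i) ^ Suc (j + 0) * P i j x) \<longlongrightarrow> p) (at (- \<omega> i))" if i: "i \<le> 3" for i j
    proof -
      obtain c where "c \<noteq> 0" "((\<lambda>x. (x - (- \<omega> i)) ^ Suc 0 * Phi \<omega> i \<alpha> x) \<longlongrightarrow> c) (at (- \<omega> i))"
        using Phi_lim[OF i \<alpha>] by auto
      from higher_deriv_pole_limit[OF not_islimpt_HP Phi_holomorphic[OF i] this(2,1), of j]
      show ?thesis by (simp add: P_def)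
    qed
    show "\<exists>c. ((\<lambda>x. (x + \<omega> i) ^ (lt i + 0) * f x) \<longlongrightarrow> c) (at (- \<omega> i))" if i: "i \<le> 3" for i
    proof -
      obtain c where "((\<lambda>x. (x + \<omega> i) ^ lt i * \<Lambda> x) \<longlongrightarrow> c) (at (- \<omega> i))" using pole[OF i] by blast
      hence "((\<lambda>x. exp (- \<kappa>' * x) * ((x + \<omega> i) ^ lt i * \<Lambda> x)) \<longlongrightarrow> exp (- \<kappa>' * (- \<omega> i)) * c) (at (- \<omega> i))"
        by (intro tendsto_intros)
      moreover have "exp (- \<kappa>' * x) * ((x + \<omega> i) ^ lt i * \<Lambda> x) = (x + \<omega> i) ^ (lt i + 0) * f x" for x
        unfolding f_def by (simp only: mult_ac add_0_right)
      ultimately have "((\<lambda>x. (x + \<omega> i) ^ (lt i + 0) * f x) \<longlongrightarrow> exp (- \<kappa>' * (- \<omega> i)) * c) (at (- \<omega> i))"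
        by (simp only:)
      thus ?thesis by blast
    qed
  qed (use P_holo f_holo in blast)+
  define S where "S = (\<lambda>x. \<Sum>i\<le>3. \<Sum>j<lt i. \<beta> i j * P i j x)"
  define H where "H = (\<lambda>x. f x - S x)"
  have S_holo: "S holomorphic_on - HP" unfolding S_def by (intro holomorphic_intros P_holo) auto
  have H_holo: "H holomorphic_on - HP" unfolding H_def by (intro holomorphic_intros f_holo S_holo)
  have Hlim: "(H \<longlongrightarrow> c i) (at (- \<omega> i))" if "i \<le> 3" for i using lim[OF that] by (simp add: H_def S_def)
  have f_quasi: "f (x + 2 * \<omega> j) = m j * f x" if j: "j \<in> {1,3}" for j x
  proof -
    have "exp (- \<kappa>' * (x + 2 * \<omega> j)) * exp (2 * \<omega> j * \<kappa> - 2 * wz (\<omega> j) * \<alpha>) = m j * exp (- \<kappa>' * x)"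
      unfolding m_def exp_add[symmetric] \<kappa>'_def by (rule arg_cong[of _ _ exp]) (simp add: algebra_simps)
    thus ?thesis unfolding f_def quasi[OF j] by (metis mult.assoc)
  qed
  have S_quasi: "S (x + 2 * \<omega> j) = m j * S x" if "j \<in> {1,3}" "x \<notin> HP" for j x
    unfolding S_def P_def m_def by (rule Phi_sum_quasi[OF that])
  have H_quasi: "H (x + 2 * \<omega> j) = m j * H x" if "j \<in> {1,3}" "x \<notin> HP" for j x
    unfolding H_def f_quasi[OF that(1)] S_quasi[OF that] by (simp add: algebra_simps)
  \<comment> \<open>\<open>h\<close> is \<open>H / \<Phi>\<^sub>0\<close>\<close>
  define G where "G = (\<lambda>x. ws x * exp (- wz \<alpha> * x))"
  define h where "h = (\<lambda>x. H x * G x / ws (x - \<alpha>))"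
  define T where "T = HP \<union> {x. x - \<alpha> \<in> Lat}"
  have T: "\<not> z islimpt T" for z
  proof -
    have "eventually (\<lambda>x. x \<notin> T) (at z)"
      using ev_notin_HP[of z] ev_notin_Lat_shift[of \<alpha> z] by eventually_elim (auto simp: T_def)
    thus ?thesis by (simp add: islimpt_iff_eventually)
  qed
  have G_cont: "isCont G z" for z
    unfolding G_def by (intro continuous_intros isCont_ws)
  have Gt: "(G \<longlongrightarrow> G z) (at z)" for z using G_cont isContD by blast
  obtain w0 l where w0: "w0 \<in> Lat" and l: "(H \<longlongrightarrow> l) (at (\<alpha> + w0))"
  proof (cases "\<alpha> \<in> HP")
    case True
    then obtain i where i: "i \<le> 3" "- \<omega> i - \<alpha> \<in> Lat" by (rule HP_translate)
    show ?thesis by (rule that[OF i(2), of "c i"]) (use Hlim[OF i(1)] in simp)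
  next
    case False
    show ?thesis by (rule that[of 0 "H \<alpha>"]) (use isCont_off_HP[OF H_holo False] isContD in auto)
  qed
  have h_lim: "((\<lambda>x. (x - z) * h x) \<longlongrightarrow> 0) (at z)" if z: "z - \<alpha> \<notin> Lat" and l: "(H \<longlongrightarrow> l) (at z)" for z l
  proof -
    have "((\<lambda>x. (x - z) * (H x * G x / ws (x - \<alpha>))) \<longlongrightarrow> (z - z) * (l * G z / ws (z - \<alpha>))) (at z)"
      using z by (intro tendsto_intros l Gt isCont_shift isCont_ws) (simp add: ws_eq_0_iff)
    thus ?thesis by (simp add: h_def)
  qed
  define b where "b = \<alpha> + w0"
  obtain L where L: "((\<lambda>x. (x - b) / ws (x - \<alpha>)) \<longlongrightarrow> L) (at b)" by (rule lim_ws_inverse)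
  obtain c0 where c0: "\<And>x. x \<notin> T \<Longrightarrow> h x = c0"
  proof (rule elliptic_one_pole[OF T, of \<alpha> h])
    show "x \<in> T" if "x - \<alpha> \<in> Lat" for x using that by (simp add: T_def)
    show "w0 \<in> Lat" by (rule w0)
    show "h holomorphic_on - T"
      unfolding h_def G_def
      by (intro holomorphic_intros holomorphic_on_subset[OF H_holo]) (auto simp: T_def ws_eq_0_iff)
    show "h (x + 2 * \<omega> j) = h x" if j: "j \<in> {1,3}" and x: "x \<notin> T" "x + 2 * \<omega> j \<notin> T" for j x
    proof -
      obtain C where C: "C \<noteq> 0" "\<And>z. ws (z + 2 * \<omega> j) = C * exp (2 * wz (\<omega> j) * z) * ws z"
        using ws_add_two_omega[OF j] by blast
      let ?e = "2 * wz (\<omega> j)"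
      have xH: "x \<notin> HP" and xa: "x - \<alpha> \<notin> Lat" using x by (auto simp: T_def)
      have "x + 2 * \<omega> j - \<alpha> = (x - \<alpha>) + 2 * \<omega> j" by simp
      hence s1: "ws (x + 2 * \<omega> j - \<alpha>) = C * exp (?e * (x - \<alpha>)) * ws (x - \<alpha>)" using C(2) by metis
      have "(m j * H x) * (C * exp (?e * x) * ws x * exp (- wz \<alpha> * (x + 2 * \<omega> j))) * ws (x - \<alpha>) = 
        H x * (ws x * exp (- wz \<alpha> * x)) * (C * exp (?e * (x - \<alpha>)) * ws (x - \<alpha>))"
      proof -
        have "m j * exp (?e * x) * exp (- wz \<alpha> * (x + 2 * \<omega> j)) = exp (- wz \<alpha> * x) * exp (?e * (x - \<alpha>))"
          unfolding m_def exp_add[symmetric] by (rule arg_cong[of _ _ exp]) (simp add: algebra_simps)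
        hence "m j * exp (?e * x) * exp (- wz \<alpha> * (x + 2 * \<omega> j)) * (H x * C * ws x * ws (x - \<alpha>)) = 
          exp (- wz \<alpha> * x) * exp (?e * (x - \<alpha>)) * (H x * C * ws x * ws (x - \<alpha>))" by simp
        thus ?thesis by (simp only: mult_ac)
      qed
      moreover have "ws (x - \<alpha>) \<noteq> 0" using xa by (simp add: ws_eq_0_iff)
      ultimately show ?thesis unfolding h_def G_def H_quasi[OF j xH] s1 C(2)[of x] using C(1)
        by (subst frac_eq_eq) auto
    qed
    show "\<exists>w\<in>Lat. ((\<lambda>x. (x - (z + w)) * h x) \<longlongrightarrow> 0) (at (z + w))" if z: "z - \<alpha> \<notin> Lat" for z
    proof (cases "z \<in> HP")
      case True
      then obtain i where i: "i \<le> 3" "- \<omega> i - z \<in> Lat" by (rule HP_translate)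
      have "- \<omega> i - \<alpha> \<notin> Lat"
      proof
        assume "- \<omega> i - \<alpha> \<in> Lat"
        hence "- \<omega> i - \<alpha> - (- \<omega> i - z) \<in> Lat" using i(2) Lat_diff by blast
        thus False using z by simp
      qed
      from h_lim[OF this Hlim[OF i(1)]] show ?thesis using i(2) by (intro bexI[of _ "- \<omega> i - z"]) auto
    next
      case False
      hence "(H \<longlongrightarrow> H z) (at z)" using isCont_off_HP[OF H_holo] isContD by blast
      from h_lim[OF _ this] show ?thesis using z by (intro bexI[of _ 0]) auto
    qed
    have "((\<lambda>x. H x * G x * ((x - b) / ws (x - \<alpha>))) \<longlongrightarrow> l * G b * L) (at b)"
      by (intro tendsto_mult L Gt) (use l in \<open>simp add: b_def\<close>)
    thus "((\<lambda>x. (x - (\<alpha> + w0)) * h x) \<longlongrightarrow> l * G b * L) (at (\<alpha> + w0))" by (simp add: h_def mult_ac flip: b_def)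
  qed blast
  \<comment> \<open>\<open>1 / \<Phi>\<^sub>0\<close> vanishes at \<open>0\<close>, and \<open>H\<close> has a limit there\<close>
  have "c0 = 0"
  proof -
    have "((\<lambda>x. H x * G x / ws (x - \<alpha>)) \<longlongrightarrow> c 0 * G 0 / ws (0 - \<alpha>)) (at 0)"
      using \<alpha> Hlim[of 0] by (intro tendsto_divide tendsto_mult Gt isCont_shift isCont_ws) (auto simp: ws_eq_0_iff omega_0)
    moreover have "G 0 = 0" by (simp add: G_def ws_eq_0_iff)
    ultimately have "(h \<longlongrightarrow> 0) (at 0)" by (simp add: h_def[abs_def])
    moreover have "eventually (\<lambda>x. h x = c0) (at 0)"
      using eventually_notin_discrete[OF T, of 0] by eventually_elim (rule c0)
    ultimately have "((\<lambda>_. c0) \<longlongrightarrow> 0) (at (0::complex))" by (rule Lim_transform_eventually)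
    thus ?thesis by (simp add: tendsto_const_iff)
  qed
  have HT: "H x = 0" if "x \<notin> T" for x
  proof -
    have "x \<notin> Lat" "x - \<alpha> \<notin> Lat" using that Lat_subset_HP by (auto simp: T_def)
    thus ?thesis using c0[OF that] \<open>c0 = 0\<close> by (simp add: h_def G_def ws_eq_0_iff)
  qed
  have H0: "H x = 0" if x: "x \<notin> HP" for x
  proof -
    have "(H \<longlongrightarrow> H x) (at x)" using isCont_off_HP[OF H_holo x] isContD by blast
    moreover have "eventually (\<lambda>y. H y = 0) (at x)"
      using eventually_notin_discrete[OF T, of x] by eventually_elim (rule HT)
    ultimately have "((\<lambda>_. 0) \<longlongrightarrow> H x) (at x)" by (rule Lim_transform_eventually)
    thus ?thesis by (simp add: tendsto_const_iff)
  qed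
  have "\<Lambda> x = exp (\<kappa>' * x) * S x" if x: "x \<notin> HP" for x
  proof -
    have "S x = exp (- \<kappa>' * x) * \<Lambda> x" using H0[OF x] by (simp add: H_def f_def)
    thus ?thesis by (simp add: exp_minus field_simps)
  qed
  hence "expression_A \<omega> lt \<Lambda> \<alpha> \<kappa>' \<beta>"
    using \<alpha> unfolding expression_A_def S_def P_def by blast
  thus ?thesis unfolding \<kappa>'_def by blast
qed

end

section \<open>Expansion in elliptic functions\<close>

context half_periods begin

text \<open>
  Shows the simple poles of \<open>\<wp>' / (\<wp> - e\<^sub>i)\<close>: residue \<open>2\<close> at \<open>\<omega>\<^sub>i\<close>, where the first two terms both
  contribute, and \<open>- 2\<close> at \<open>0\<close>.
\<close>
lemma wp_logderiv_half:
  assumes i: "i \<in> {1..3}" and x: "x \<notin> HP"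
  shows "deriv wp x / (wp x - wp (\<omega> i)) = wz (x - \<omega> i) + wz (x - (- \<omega> i)) - 2 * wz (x - 0)"
proof -
  have i3: "i \<le> 3" using i by auto
  have a: "x + \<omega> i \<notin> Lat" by (rule notin_HP[OF x i3])
  have e: "x + \<omega> i - 2 * \<omega> i = x - \<omega> i" by simp
  have b: "x - \<omega> i \<notin> Lat" using a Lat_diff_iff[OF two_omega_in_Lat'[OF i3], of "x + \<omega> i"] unfolding e by simp
  have "x \<notin> Lat" using x Lat_subset_HP by blast
  from wp_logderiv[OF omega_notin_Lat[OF i] this b a] show ?thesis by simp
qed

text \<open>
  As \<open>\<alpha>\<close> is a period, \<open>\<sigma> (z - \<alpha>)\<close> is \<open>\<sigma> z\<close> times an exponential \<open>D exp (k z)\<close>. Comparing the two ways to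
  shift its argument by \<open>2 \<omega>\<^sub>j\<close> gives \<open>exp (- 2 \<eta>\<^sub>j \<alpha>) = exp (2 \<omega>\<^sub>j k)\<close>, so \<open>\<Lambda>\<close> has the multipliers of
  \<open>exp ((\<kappa> + k) x)\<close> and the quotient is elliptic.
\<close>
lemma expression_B_exists:
  assumes \<alpha>: "\<alpha> \<in> Lat" and holo: "\<Lambda> holomorphic_on - HP"
    and quasi: "\<And>j x. j \<in> {1, 3} \<Longrightarrow> \<Lambda> (x + 2 * \<omega> j) = exp (2 * \<omega> j * \<kappa> - 2 * wz (\<omega> j) * \<alpha>) * \<Lambda> x"
    and pole: "\<And>i. i \<le> 3 \<Longrightarrow> \<exists>c. ((\<lambda>x. (x + \<omega> i) ^ lt i * \<Lambda> x) \<longlongrightarrow> c) (at (- \<omega> i))"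
  shows "\<exists>\<kappa>' c b cc. expression_B \<omega> lt \<Lambda> \<kappa>' c b cc"
proof -
  obtain D k where D: "D \<noteq> 0" "\<And>z. ws (z + (- \<alpha>)) = D * exp (k * z) * ws z"
    using ws_quasi_Lat[of "- \<alpha>"] \<alpha> by auto
  have mult: "exp (2 * \<omega> j * k) = exp (- (2 * wz (\<omega> j) * \<alpha>))" if j: "j \<in> {1,3}" for j
  proof -
    obtain C where C: "C \<noteq> 0" "\<And>z. ws (z + 2 * \<omega> j) = C * exp (2 * wz (\<omega> j) * z) * ws z"
      using ws_add_two_omega[OF j] by blast
    let ?e = "2 * wz (\<omega> j)" and ?x = "\<omega> 1"
    have "ws (?x + 2 * \<omega> j + (- \<alpha>)) = D * exp (k * (?x + 2 * \<omega> j)) * (C * exp (?e * ?x) * ws ?x)"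
      unfolding D(2) C(2) ..
    moreover have "ws ((?x + (- \<alpha>)) + 2 * \<omega> j) = C * exp (?e * (?x + (- \<alpha>))) * (D * exp (k * ?x) * ws ?x)"
      unfolding C(2) D(2) ..
    moreover have "?x + 2 * \<omega> j + (- \<alpha>) = (?x + (- \<alpha>)) + 2 * \<omega> j" by simp
    ultimately have eq: "D * exp (k * (?x + 2 * \<omega> j)) * (C * exp (?e * ?x) * ws ?x) = C * exp (?e * (?x + (- \<alpha>))) * (D * exp (k * ?x) * ws ?x)"
      by metis
    have x1: "exp (k * (?x + 2 * \<omega> j)) = exp (2 * \<omega> j * k) * exp (k * ?x)"
      unfolding exp_add[symmetric] by (rule arg_cong[of _ _ exp]) (simp add: algebra_simps)
    have x2: "exp (?e * (?x + (- \<alpha>))) = exp (- (?e * \<alpha>)) * exp (?e * ?x)"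
      unfolding exp_add[symmetric] by (rule arg_cong[of _ _ exp]) (simp add: algebra_simps)
    have "exp (2 * \<omega> j * k) * (D * exp (k * ?x) * C * exp (?e * ?x) * ws ?x) = exp (- (?e * \<alpha>)) * (D * exp (k * ?x) * C * exp (?e * ?x) * ws ?x)"
      using eq unfolding x1 x2 by (simp only: mult_ac)
    moreover have "D * exp (k * ?x) * C * exp (?e * ?x) * ws ?x \<noteq> 0" 
      using C(1) D(1) omega_notin_Lat[of 1] by (simp add: ws_eq_0_iff)
    ultimately show ?thesis by simp
  qed
  define \<kappa>' where "\<kappa>' = \<kappa> + k"
  define f where "f = (\<lambda>x. exp (- \<kappa>' * x) * \<Lambda> x)"
  define P where "P = (\<lambda>i j. (deriv ^^ j) (\<lambda>y. wp (y + \<omega> i)))"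
  have f_holo: "f holomorphic_on - HP" unfolding f_def by (intro holomorphic_intros holo)
  have P_holo: "P i j holomorphic_on - HP" if "i \<le> 3" for i j
    unfolding P_def by (intro holomorphic_higher_deriv wp_shift_holomorphic that open_HP_compl)
  obtain \<beta> c where lim: "\<And>i. i \<le> 3 \<Longrightarrow> ((\<lambda>x. (x + \<omega> i) ^ 1 * (f x - (\<Sum>i\<le>3. \<Sum>j<lt i - 1. \<beta> i j * P i j x))) \<longlongrightarrow> c i) (at (- \<omega> i))"
  proof (rule remove_half_period_parts[of P 1 f "\<lambda>i. lt i - 1"])
    show "P i j analytic_on {z}" if "i \<le> 3" "z + \<omega> i \<notin> Lat" for i j z
      unfolding P_def by (intro analytic_higher_deriv wp_shift_analytic_at that)
    show "\<exists>p. p \<noteq> 0 \<and> ((\<lambda>x. (x + \<omega> i) ^ Suc (j + 1) * P i j x) \<longlongrightarrow> p) (at (- \<omega> i))" if i: "i \<le> 3" for i j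
    proof -
      have "((\<lambda>x. (x - (- \<omega> i)) ^ Suc 1 * wp (x + \<omega> i)) \<longlongrightarrow> 1) (at (- \<omega> i))"
        using lim_wp[of "- \<omega> i" "- \<omega> i"] by (simp add: power2_eq_square)
      from higher_deriv_pole_limit[OF not_islimpt_HP wp_shift_holomorphic[OF i] this, of j]
      show ?thesis by (simp add: P_def)
    qed
    show "\<exists>c. ((\<lambda>x. (x + \<omega> i) ^ (lt i - 1 + 1) * f x) \<longlongrightarrow> c) (at (- \<omega> i))" if i: "i \<le> 3" for i
    proof -
      obtain c where c: "((\<lambda>x. (x + \<omega> i) ^ lt i * \<Lambda> x) \<longlongrightarrow> c) (at (- \<omega> i))" using pole[OF i] by blast
      \<comment> \<open>the exponent \<open>lt i - 1 + 1\<close> is \<open>1\<close> rather than \<open>lt i\<close> if \<open>lt i = 0\<close>\<close>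
      have e: "(x + \<omega> i) ^ (lt i - 1 + 1) = (x + \<omega> i) ^ (lt i - 1 + 1 - lt i) * (x + \<omega> i) ^ lt i" for x
        unfolding power_add[symmetric] by simp
      have "((\<lambda>x. (exp (- \<kappa>' * x) * (x + \<omega> i) ^ (lt i - 1 + 1 - lt i)) * ((x + \<omega> i) ^ lt i * \<Lambda> x)) \<longlongrightarrow> 
        (exp (- \<kappa>' * (- \<omega> i)) * (- \<omega> i + \<omega> i) ^ (lt i - 1 + 1 - lt i)) * c) (at (- \<omega> i))"
        by (intro tendsto_mult c tendsto_intros)
      moreover have "(exp (- \<kappa>' * x) * (x + \<omega> i) ^ (lt i - 1 + 1 - lt i)) * ((x + \<omega> i) ^ lt i * \<Lambda> x) = (x + \<omega> i) ^ (lt i - 1 + 1) * f x" for x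
        unfolding e f_def by (simp only: mult_ac)
      ultimately show ?thesis by (auto simp only:)
    qed
  qed (use P_holo f_holo in blast)+
  define S where "S = (\<lambda>x. \<Sum>i\<le>3. \<Sum>j<lt i - 1. \<beta> i j * P i j x)"
  \<comment> \<open>the residue of \<open>\<wp>' / (\<wp> - e\<^sub>i)\<close> at \<open>\<omega> i\<close> is \<open>2\<close>\<close>
  define ct where "ct = (\<lambda>i. c i / 2)"
  define E where "E = (\<lambda>x. \<Sum>i=1..3. ct i * (wz (x - \<omega> i) + wz (x - (- \<omega> i)) - 2 * wz (x - 0)))"
  define H where "H = (\<lambda>x. f x - S x - E x)"
  have mLat: "x - \<omega> i \<notin> Lat" "x + \<omega> i \<notin> Lat" if "x \<notin> HP" "i \<in> {1..3}" for x i
  proof -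
    have i3: "i \<le> 3" using that by auto
    show a: "x + \<omega> i \<notin> Lat" by (rule notin_HP[OF that(1) i3])
    have e: "x + \<omega> i - 2 * \<omega> i = x - \<omega> i" by simp
    show "x - \<omega> i \<notin> Lat" using a Lat_diff_iff[OF two_omega_in_Lat'[OF i3], of "x + \<omega> i"] unfolding e by simp
  qed
  have S_holo: "S holomorphic_on - HP" unfolding S_def by (intro holomorphic_intros P_holo) auto
  have E_holo: "E holomorphic_on - HP" unfolding E_def 
    by (intro holomorphic_intros) (use mLat Lat_subset_HP in auto)
  have H_holo: "H holomorphic_on - HP" unfolding H_def by (intro holomorphic_intros f_holo S_holo E_holo)
  have E_lim: "((\<lambda>x. (x - a) * E x) \<longlongrightarrow> (\<Sum>i=1..3. ct i * (of_bool (a - \<omega> i \<in> Lat) + of_bool (a - (- \<omega> i) \<in> Lat) - 2 * of_bool (a - 0 \<in> Lat)))) (at a)" for a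
  proof -
    have "((\<lambda>x. \<Sum>i=1..3. ct i * ((x - a) * wz (x - \<omega> i) + (x - a) * wz (x - (- \<omega> i)) - 2 * ((x - a) * wz (x - 0)))) \<longlongrightarrow> 
      (\<Sum>i=1..3. ct i * (of_bool (a - \<omega> i \<in> Lat) + of_bool (a - (- \<omega> i) \<in> Lat) - 2 * of_bool (a - 0 \<in> Lat)))) (at a)"
      by (intro tendsto_sum tendsto_mult tendsto_add tendsto_diff tendsto_const lim_wz)
    moreover have "(\<Sum>i=1..3. ct i * ((x - a) * wz (x - \<omega> i) + (x - a) * wz (x - (- \<omega> i)) - 2 * ((x - a) * wz (x - 0)))) = (x - a) * E x" for x
      unfolding E_def sum_distrib_left by (intro sum.cong refl) (simp add: algebra_simps)
    ultimately show ?thesis by (simp only:)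
  qed
  have H_lim: "((\<lambda>x. (x - (- \<omega> p)) * H x) \<longlongrightarrow> c p - (\<Sum>i=1..3. ct i * (of_bool (- \<omega> p - \<omega> i \<in> Lat) + of_bool (- \<omega> p - (- \<omega> i) \<in> Lat) - 2 * of_bool (- \<omega> p - 0 \<in> Lat)))) (at (- \<omega> p))"
    if p: "p \<le> 3" for p
  proof -
    have "((\<lambda>x. (x + \<omega> p) ^ 1 * (f x - S x) - (x - (- \<omega> p)) * E x) \<longlongrightarrow> c p - (\<Sum>i=1..3. ct i * (of_bool (- \<omega> p - \<omega> i \<in> Lat) + of_bool (- \<omega> p - (- \<omega> i) \<in> Lat) - 2 * of_bool (- \<omega> p - 0 \<in> Lat)))) (at (- \<omega> p))"
      unfolding S_def by (intro tendsto_diff E_lim lim[OF p])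
    moreover have "(x + \<omega> p) ^ 1 * (f x - S x) - (x - (- \<omega> p)) * E x = (x - (- \<omega> p)) * H x" for x
      by (simp add: H_def algebra_simps)
    ultimately show ?thesis by (simp only:)
  qed
  have H_lim0: "((\<lambda>x. (x - (- \<omega> p)) * H x) \<longlongrightarrow> 0) (at (- \<omega> p))" if p: "p \<in> {1..3}" for p
  proof -
    have p3: "p \<le> 3" using p by auto
    have "(\<Sum>i=1..3. ct i * (of_bool (- \<omega> p - \<omega> i \<in> Lat) + of_bool (- \<omega> p - (- \<omega> i) \<in> Lat) - 2 * of_bool (- \<omega> p - 0 \<in> Lat))) = 
       (\<Sum>i=1..3. if i = p then c p else 0)"
    proof (intro sum.cong refl)
      fix i :: nat assume i: "i \<in> {1..3}"
      hence i3: "i \<le> 3" by auto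
      have a: "- \<omega> p - (- \<omega> i) \<in> Lat \<longleftrightarrow> i = p" using omega_bool[OF i3 p3] by simp
      have e: "- \<omega> p - (- \<omega> i) - 2 * \<omega> i = - \<omega> p - \<omega> i" by simp
      have b: "- \<omega> p - \<omega> i \<in> Lat \<longleftrightarrow> i = p" 
        using Lat_diff_iff[OF two_omega_in_Lat'[OF i3], of "- \<omega> p - (- \<omega> i)"] unfolding e a .
      have d: "- \<omega> p - 0 \<notin> Lat" using omega_notin_Lat[OF p] by simp
      show "ct i * (of_bool (- \<omega> p - \<omega> i \<in> Lat) + of_bool (- \<omega> p - (- \<omega> i) \<in> Lat) - 2 * of_bool (- \<omega> p - 0 \<in> Lat)) = (if i = p then c p else 0)"
        unfolding a b using d by (simp add: ct_def)
    qed
    also have "\<dots> = c p" using p by simp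
    finally show ?thesis using H_lim[OF p3] by simp
  qed
  have per_f: "f (x + 2 * \<omega> j) = f x" if j: "j \<in> {1,3}" for j x
  proof -
    have "exp (- \<kappa>' * (x + 2 * \<omega> j)) * exp (2 * \<omega> j * \<kappa> - 2 * wz (\<omega> j) * \<alpha>) = 
        exp (- \<kappa>' * (x + 2 * \<omega> j)) * (exp (2 * \<omega> j * \<kappa>) * exp (- (2 * wz (\<omega> j) * \<alpha>)))"
      unfolding exp_add[symmetric] by simp
    also have "\<dots> = exp (- \<kappa>' * x)"
      unfolding mult[OF j, symmetric] exp_add[symmetric] \<kappa>'_def by (rule arg_cong[of _ _ exp]) (simp add: algebra_simps)
    finally show ?thesis unfolding f_def quasi[OF j] by (metis mult.assoc)
  qed
  have per_S: "S (x + 2 * \<omega> j) = S x" if "j \<in> {1,3}" "x \<notin> HP" for j x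
    unfolding S_def P_def by (rule wp_sum_periodic[OF that])
  have per_E: "E (x + 2 * \<omega> j) = E x" if j: "j \<in> {1,3}" and x: "x \<notin> HP" for j x
    unfolding E_def
  proof (intro sum.cong refl)
    fix i :: nat assume i: "i \<in> {1..3}"
    have sh: "wz (x + 2 * \<omega> j - a) = wz (x - a) + 2 * wz (\<omega> j)" if "x - a \<notin> Lat" for a
    proof -
      have "x + 2 * \<omega> j - a = (x - a) + 2 * \<omega> j" by simp
      thus ?thesis using wz_add_two_omega[OF j that] by metis
    qed
    have "x - 0 \<notin> Lat" using Lat_subset_HP x by auto
    thus "ct i * (wz (x + 2 * \<omega> j - \<omega> i) + wz (x + 2 * \<omega> j - (- \<omega> i)) - 2 * wz (x + 2 * \<omega> j - 0)) = 
       ct i * (wz (x - \<omega> i) + wz (x - (- \<omega> i)) - 2 * wz (x - 0))"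
      using sh[of "\<omega> i"] sh[of "- \<omega> i"] sh[of 0] mLat[OF x i] by simp
  qed
  obtain c0 where c0: "\<And>x. x \<notin> HP \<Longrightarrow> H x = c0"
  proof (rule elliptic_one_pole[OF not_islimpt_HP, of 0 H])
    show "x \<in> HP" if "x - 0 \<in> Lat" for x using that Lat_subset_HP by simp
    show "0 \<in> Lat" by simp
    show "H (x + 2 * \<omega> j) = H x" if "j \<in> {1,3}" "x \<notin> HP" for j x
      unfolding H_def using per_f[OF that(1)] per_S[OF that] per_E[OF that] by simp
    show "((\<lambda>x. (x - (0 + 0)) * H x) \<longlongrightarrow> c 0 - (\<Sum>i=1..3. ct i * (of_bool (- \<omega> 0 - \<omega> i \<in> Lat) + of_bool (- \<omega> 0 - (- \<omega> i) \<in> Lat) - 2 * of_bool (- \<omega> 0 - 0 \<in> Lat)))) (at (0 + 0))"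
      using H_lim[of 0] by (simp add: omega_0)
    show "\<exists>w\<in>Lat. ((\<lambda>x. (x - (z + w)) * H x) \<longlongrightarrow> 0) (at (z + w))" if z: "z - 0 \<notin> Lat" for z
    proof (cases "z \<in> HP")
      case True
      then obtain i where i: "i \<le> 3" "- \<omega> i - z \<in> Lat" by (rule HP_translate)
      have "i \<noteq> 0"
      proof
        assume "i = 0"
        hence "- z \<in> Lat" using i(2) by (simp add: omega_0)
        thus False using z by simp
      qed
      hence "i \<in> {1..3}" using i(1) by auto
      from H_lim0[OF this] show ?thesis using i(2) by (intro bexI[of _ "- \<omega> i - z"]) auto
    next
      case False
      hence "(H \<longlongrightarrow> H z) (at z)" using isCont_off_HP[OF H_holo] isContD by blast
      hence "((\<lambda>x. (x - z) * H x) \<longlongrightarrow> (z - z) * H z) (at z)" by (intro tendsto_intros)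
      thus ?thesis by (intro bexI[of _ 0]) auto
    qed
  qed (use H_holo in blast)+
  have "\<Lambda> x = exp (\<kappa>' * x) * (c0 + S x + (\<Sum>i=1..3. ct i * deriv wp x / (wp x - wp (\<omega> i))))" if x: "x \<notin> HP" for x
  proof -
    have "E x = (\<Sum>i=1..3. ct i * deriv wp x / (wp x - wp (\<omega> i)))"
      unfolding E_def using wp_logderiv_half[OF _ x] by (intro sum.cong refl) (simp flip: times_divide_eq_right)
    moreover have "exp (- \<kappa>' * x) * \<Lambda> x = c0 + S x + E x" using c0[OF x] by (simp add: H_def f_def algebra_simps)
    moreover have "\<Lambda> x = exp (\<kappa>' * x) * (exp (- \<kappa>' * x) * \<Lambda> x)" by (simp add: exp_minus)
    ultimately show ?thesis by metis
  qed
  hence "expression_B \<omega> lt \<Lambda> \<kappa>' c0 \<beta> ct"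
    unfolding expression_B_def S_def P_def by blast
  thus ?thesis by blast
qed

end

section \<open>Local exponents of the differential equation\<close>

text \<open>
  A branch of a square root has half the logarithmic derivative of the radicand.
\<close>
lemma sqrt_logderiv:
  fixes p h :: "complex \<Rightarrow> complex"
  assumes U: "open U" "x \<in> U" and p: "p holomorphic_on U" "\<And>x. x \<in> U \<Longrightarrow> p x ^ 2 = h x"
    and h: "h x \<noteq> 0" "(h has_field_derivative h') (at x)"
  shows "(p has_field_derivative (h' / (2 * h x)) * p x) (at x)"
proof -
  have d: "(p has_field_derivative deriv p x) (at x)" by (rule holomorphic_derivI[OF p(1) U])
  have "((\<lambda>x. p x ^ 2) has_field_derivative 2 * (deriv p x * p x)) (at x)"
    using DERIV_power[OF d, of 2] by simp
  hence "(h has_field_derivative 2 * (deriv p x * p x)) (at x)"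
    by (rule has_field_derivative_transform_within_open[OF _ U]) (rule p(2))
  hence h': "h' = 2 * (deriv p x * p x)" using h(2) DERIV_unique by blast
  have "p x \<noteq> 0" using p(2)[OF U(2)] h(1) by auto
  hence "deriv p x = (h' / (2 * h x)) * p x"
    unfolding h' p(2)[OF U(2), symmetric] by (simp add: power2_eq_square)
  thus ?thesis using d by simp
qed

context half_periods begin

text \<open>
  Needed for \<open>z = \<delta> k\<close>: as \<open>\<delta> k\<close> is not congruent to a half-period, \<open>\<delta> k\<close> and \<open>- \<delta> k\<close> are
  incongruent.
\<close>
lemma double_in_Lat_imp_HP:
  assumes "2 * z \<in> Lat" shows "z \<in> HP"
proof -
  obtain a b where z: "z = of_coords (a, b)" using surj_of_coords by (metis surjE surj_pair)
  have add: "of_coords p + of_coords q = of_coords (p + q)" for p q using linear_add[OF linear_of_coords] by simp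
  have "2 * z = of_coords (a, b) + of_coords (a, b)" by (simp add: z)
  hence "of_coords (2 * a, 2 * b) \<in> Lat" using assms unfolding add by simp
  hence "2 * a \<in> \<int>" "2 * b \<in> \<int>" by (auto simp: of_coords_in_Lat_iff)
  then obtain m n :: int where mn: "2 * a = of_int m" "2 * b = of_int n" by (auto elim!: Ints_cases)
  have eqs: "\<omega> 0 = of_coords (0,0)" "\<omega> 1 = of_coords (1/2,0)" "\<omega> 2 = of_coords (-1/2,-1/2)" "\<omega> 3 = of_coords (0,1/2)"
    by (auto simp: of_coords_def omega_0 omega_2)
  have half: "x / 2 \<in> \<int>" if "x = of_int k" "even k" for x :: real and k
    using that by (auto elim!: evenE)
  have a: "a = of_int m / 2" and b: "b = of_int n / 2" using mn by auto
  consider "even m" "even n" | "odd m" "even n" | "odd m" "odd n" | "even m" "odd n" by blast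
  thus ?thesis
  proof cases
    case 1
    hence "a \<in> \<int>" "b \<in> \<int>" unfolding a b using half by auto
    hence "z + \<omega> 0 \<in> Lat" unfolding eqs z add by (simp add: of_coords_in_Lat_iff)
    thus ?thesis unfolding HP_iff by (intro exI[of _ 0]) simp
  next
    case 2
    have e: "a + 1/2 = of_int (m + 1) / 2" unfolding a by (simp add: field_simps)
    have "a + 1/2 \<in> \<int>" unfolding e by (rule half[OF refl]) (use 2 in simp)
    moreover have "b \<in> \<int>" unfolding b by (rule half[OF refl 2(2)])
    ultimately have "z + \<omega> 1 \<in> Lat" unfolding eqs z add by (simp add: of_coords_in_Lat_iff)
    thus ?thesis unfolding HP_iff by (intro exI[of _ 1]) simp
  next
    case 3
    have e: "a + -1/2 = of_int (m - 1) / 2" "b + -1/2 = of_int (n - 1) / 2" unfolding a b by (simp_all add: field_simps)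
    have "a + -1/2 \<in> \<int>" unfolding e(1) by (rule half[OF refl]) (use 3 in simp)
    moreover have "b + -1/2 \<in> \<int>" unfolding e(2) by (rule half[OF refl]) (use 3 in simp)
    ultimately have "z + \<omega> 2 \<in> Lat" unfolding eqs z add by (simp add: of_coords_in_Lat_iff)
    thus ?thesis unfolding HP_iff by (intro exI[of _ 2]) simp
  next
    case 4
    have e: "b + 1/2 = of_int (n + 1) / 2" unfolding b by (simp add: field_simps)
    have "b + 1/2 \<in> \<int>" unfolding e by (rule half[OF refl]) (use 4 in simp)
    moreover have "a \<in> \<int>" unfolding a by (rule half[OF refl 4(1)])
    ultimately have "z + \<omega> 3 \<in> Lat" unfolding eqs z add by (simp add: of_coords_in_Lat_iff)
    thus ?thesis unfolding HP_iff by (intro exI[of _ 3]) simp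
  qed
qed

lemma wz_meromorphic: "wz meromorphic_on UNIV"
proof -
  have ana: "ws analytic_on UNIV" using ws_compose_analytic[of "\<lambda>x. x" UNIV] by (simp add: analytic_on_ident)
  have "(\<lambda>x. deriv ws x / ws x) meromorphic_on UNIV"
    by (intro meromorphic_intros analytic_on_imp_meromorphic_on analytic_deriv ana)
  moreover have "eventually (\<lambda>x. deriv ws x / ws x = wz x) (at z)" for z
    using ev_notin_Lat[of z]
  proof eventually_elim
    case (elim x)
    have "deriv ws x = wz x * ws x" by (rule DERIV_imp_deriv[OF ws_logderiv[OF elim]])
    thus ?case using elim by (simp add: ws_eq_0_iff)
  qed
  ultimately show ?thesis using meromorphic_on_cong[of UNIV "\<lambda>x. deriv ws x / ws x" wz UNIV] by blast
qed

lemma wp_meromorphic: "wp meromorphic_on UNIV"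
proof -
  have "(\<lambda>x. - deriv wz x) meromorphic_on UNIV"
    by (intro meromorphic_intros wz_meromorphic)
  moreover have "eventually (\<lambda>x. - deriv wz x = wp x) (at z)" for z
    using ev_notin_Lat[of z] by eventually_elim (simp add: deriv_wz_and_deriv_wp)
  ultimately show ?thesis using meromorphic_on_cong[of UNIV "\<lambda>x. - deriv wz x" wp UNIV] by blast
qed

lemma wp_shift_meromorphic: "(\<lambda>x. wp (x + c)) meromorphic_on UNIV"
  by (rule meromorphic_on_compose[OF wp_meromorphic]) (auto intro!: analytic_intros)

text \<open>
  As \<open>\<delta>\<close> and \<open>- \<delta>\<close> are incongruent, \<open>\<wp> - \<wp> \<delta>\<close> has only simple zeros, and so \<open>s / (\<wp> - \<wp> \<delta>)\<close> does
  not affect the double poles of the potential.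
\<close>
lemma lim_inverse_wp:
  assumes d: "\<delta> \<notin> Lat" "2 * \<delta> \<notin> Lat"
  shows "((\<lambda>x. (x - a) ^ 2 * (s / (wp x - wp \<delta>))) \<longlongrightarrow> 0) (at a)"
proof -
  obtain C where C: "C \<noteq> 0" "\<And>x. x \<notin> Lat \<Longrightarrow> wp x - wp \<delta> = C * (ws (x - \<delta>) * ws (x + \<delta>) / ws x ^ 2)"
    using wp_factor[OF d(1)] by blast
  obtain L1 where L1: "((\<lambda>x. (x - a) / ws (x - \<delta>)) \<longlongrightarrow> L1) (at a)" "L1 = 0 \<longleftrightarrow> a - \<delta> \<notin> Lat" by (rule lim_ws_inverse)
  obtain L2 where L2: "((\<lambda>x. (x - a) / ws (x - (- \<delta>))) \<longlongrightarrow> L2) (at a)" "L2 = 0 \<longleftrightarrow> a - (- \<delta>) \<notin> Lat" by (rule lim_ws_inverse)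
  have "L1 = 0 \<or> L2 = 0"
  proof (rule ccontr)
    assume "\<not> ?thesis"
    hence "a - \<delta> \<in> Lat" "a - (- \<delta>) \<in> Lat" using L1(2) L2(2) by auto
    hence "(a - (- \<delta>)) - (a - \<delta>) \<in> Lat" by (rule Lat_diff[rotated])
    thus False using d(2) by simp
  qed
  hence L: "s / C * ws a ^ 2 * L1 * L2 = 0" by auto
  have "((\<lambda>x. s / C * ws x ^ 2 * ((x - a) / ws (x - \<delta>)) * ((x - a) / ws (x - (- \<delta>)))) \<longlongrightarrow> s / C * ws a ^ 2 * L1 * L2) (at a)"
    by (intro tendsto_mult tendsto_const tendsto_power isContD[OF isCont_ws] L1 L2)
  moreover have "eventually (\<lambda>x. s / C * ws x ^ 2 * ((x - a) / ws (x - \<delta>)) * ((x - a) / ws (x - (- \<delta>))) = (x - a) ^ 2 * (s / (wp x - wp \<delta>))) (at a)"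
    using ev_notin_Lat[of a] by eventually_elim (simp add: C(2) power2_eq_square mult_ac)
  ultimately show ?thesis unfolding L by (rule Lim_transform_eventually)
qed

end

text \<open>
  The half-periods together with the data of the potential. As \<open>\<wp>\<close> is even and takes distinct values
  at the \<open>\<delta> k\<close>, none of them the value at a half-period, the singular points are pairwise incongruent.
\<close>
locale ode_data = half_periods \<omega> for \<omega> :: "nat \<Rightarrow> complex" +
  fixes M :: nat and l r :: "nat \<Rightarrow> nat" and \<delta> s :: "nat \<Rightarrow> complex" and E :: complex
  assumes delta_notin_Lat: "\<And>k. k \<in> {1..M} \<Longrightarrow> \<delta> k \<notin> Lat"
    and wp_delta_inj: "inj_on (\<lambda>k. wp (\<delta> k)) {1..M}"
    and wp_delta_neq: "\<And>k i. k \<in> {1..M} \<Longrightarrow> i \<in> {1..3} \<Longrightarrow> wp (\<delta> k) \<noteq> wp (\<omega> i)"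
begin

abbreviation SP where "SP \<equiv> singular_points \<omega> M \<delta>"
abbreviation v where "v \<equiv> potential \<omega> l M r s \<delta>"
abbreviation u where "u \<equiv> Psi_logderiv \<omega> M r \<delta>"

lemma delta_notin_HP: "k \<in> {1..M} \<Longrightarrow> \<delta> k \<notin> HP"
proof
  assume k: "k \<in> {1..M}" and "\<delta> k \<in> HP"
  then obtain i where i: "i \<le> 3" "\<delta> k + \<omega> i \<in> Lat" by (auto simp: HP_iff)
  have "i \<noteq> 0" using i(2) delta_notin_Lat[OF k] by (metis add_0_right omega_0)
  hence i1: "i \<in> {1..3}" using i(1) by auto
  have "wp (\<delta> k) = wp (\<omega> i)"
    using wp_eq_iff[OF omega_notin_Lat[OF i1] delta_notin_Lat[OF k]] i(2) by blast
  thus False using wp_delta_neq[OF k i1] by blast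
qed

lemma uminus_HP: "- x \<in> HP \<longleftrightarrow> x \<in> HP"
proof -
  have "- y \<in> HP" if y: "y \<in> HP" for y
  proof -
    obtain i where i: "i \<le> 3" "y + \<omega> i \<in> Lat" using y by (auto simp: HP_iff)
    have "- (y + \<omega> i) + 2 * \<omega> i \<in> Lat" using i two_omega_in_Lat' Lat_add Lat_uminus by blast
    moreover have "- (y + \<omega> i) + 2 * \<omega> i = - y + \<omega> i" by simp
    ultimately show ?thesis using i(1) unfolding HP_iff by metis
  qed
  from this[of x] this[of "- x"] show ?thesis by auto
qed

lemma two_delta_notin_Lat: "k \<in> {1..M} \<Longrightarrow> 2 * \<delta> k \<notin> Lat"
  using double_in_Lat_imp_HP delta_notin_HP by blast

lemma delta_unique:
  assumes "k \<in> {1..M}" "m \<in> {1..M}" "a - \<delta> k \<in> Lat \<or> a + \<delta> k \<in> Lat" "a - \<delta> m \<in> Lat \<or> a + \<delta> m \<in> Lat"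
  shows "k = m"
proof -
  have a: "a \<notin> Lat"
  proof
    assume a: "a \<in> Lat"
    have "\<delta> k = a - (a - \<delta> k)" "\<delta> k = (a + \<delta> k) - a" by simp_all
    thus False using assms(3) a Lat_diff delta_notin_Lat[OF assms(1)] by metis
  qed
  have "wp a = wp (\<delta> k)" "wp a = wp (\<delta> m)"
    using wp_eq_iff[OF delta_notin_Lat[OF assms(1)] a] wp_eq_iff[OF delta_notin_Lat[OF assms(2)] a] assms(3,4) by auto
  thus ?thesis using wp_delta_inj assms(1,2) by (auto dest: inj_onD)
qed

lemma SP_iff: "x \<in> SP \<longleftrightarrow> x \<in> HP \<or> (\<exists>k\<in>{1..M}. x - \<delta> k \<in> Lat \<or> x + \<delta> k \<in> Lat)"
  by (auto simp: singular_points_def HP_iff)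

lemma not_islimpt_SP: "\<not> z islimpt SP"
proof -
  have "eventually (\<lambda>x. \<forall>k\<in>{1..M}. x - \<delta> k \<notin> Lat) (at z)"
    by (intro eventually_ball_finite ballI ev_notin_Lat_shift) auto
  moreover have "eventually (\<lambda>x. \<forall>k\<in>{1..M}. x - (- \<delta> k) \<notin> Lat) (at z)"
    by (intro eventually_ball_finite ballI ev_notin_Lat_shift) auto
  ultimately have "eventually (\<lambda>x. x \<notin> SP) (at z)"
    using ev_notin_HP[of z] by eventually_elim (auto simp: SP_iff)
  thus ?thesis by (simp add: islimpt_iff_eventually)
qed

lemma open_SP_compl: "open (- SP)"
  using not_islimpt_imp_closed[OF not_islimpt_SP] by (simp add: open_Compl)

lemma SP_add_Lat: "w \<in> Lat \<Longrightarrow> x + w \<in> SP \<longleftrightarrow> x \<in> SP"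
proof -
  assume w: "w \<in> Lat"
  have "x + w - d \<in> Lat \<longleftrightarrow> x - d \<in> Lat" "x + w + d \<in> Lat \<longleftrightarrow> x + d \<in> Lat" for d
    using Lat_add_iff[OF w, of "x - d"] Lat_add_iff[OF w, of "x + d"] by (simp_all add: algebra_simps)
  thus ?thesis by (simp add: SP_iff HP_add_Lat[OF w])
qed

lemma notin_SP:
  assumes "x \<notin> SP"
  shows "x \<notin> HP" "x \<notin> Lat" "k \<in> {1..M} \<Longrightarrow> x - \<delta> k \<notin> Lat" "k \<in> {1..M} \<Longrightarrow> x + \<delta> k \<notin> Lat"
    "k \<in> {1..M} \<Longrightarrow> wp x - wp (\<delta> k) \<noteq> 0"
proof -
  show "x \<notin> HP" using assms by (simp add: SP_iff)
  thus xL: "x \<notin> Lat" using Lat_subset_HP by blast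
  show a: "x - \<delta> k \<notin> Lat" "x + \<delta> k \<notin> Lat" if "k \<in> {1..M}"
    using assms that unfolding SP_iff by blast+
  show "wp x - wp (\<delta> k) \<noteq> 0" if "k \<in> {1..M}"
    using wp_eq_iff[OF delta_notin_Lat[OF that] xL] a[OF that] by simp
qed

lemma u_holomorphic: "u holomorphic_on - SP"
  unfolding Psi_logderiv_def
  by (intro holomorphic_intros holomorphic_on_subset[OF holomorphic_deriv[OF wp_holomorphic open_Lat_compl]])
     (use notin_SP in auto)

lemma u_eq:
  assumes "x \<notin> SP"
  shows "u x = (\<Sum>k=1..M. of_nat (r k) / 2 * (wz (x - \<delta> k) + wz (x - (- \<delta> k)) - 2 * wz (x - 0)))"
  unfolding Psi_logderiv_def
proof (intro sum.cong refl)
  fix k assume k: "k \<in> {1..M}"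
  have "deriv wp x / (wp x - wp (\<delta> k)) = wz (x - \<delta> k) + wz (x + \<delta> k) - 2 * wz x"
    by (rule wp_logderiv) (use notin_SP[OF assms] delta_notin_Lat k in auto)
  thus "of_nat (r k) / 2 * deriv wp x / (wp x - wp (\<delta> k)) = of_nat (r k) / 2 * (wz (x - \<delta> k) + wz (x - (- \<delta> k)) - 2 * wz (x - 0))"
    unfolding times_divide_eq_right[symmetric, of "of_nat (r k) / 2"] by simp
qed

text \<open>
  The residue of \<open>\<Psi>\<^sub>g' / \<Psi>\<^sub>g\<close> at \<open>a\<close>.
\<close>
definition u_residue :: "complex \<Rightarrow> complex" where
  "u_residue a = (\<Sum>k=1..M. of_nat (r k) / 2 * (of_bool (a - \<delta> k \<in> Lat) + of_bool (a - (- \<delta> k) \<in> Lat) - 2 * of_bool (a - 0 \<in> Lat)))"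

text \<open>
  The coefficient of \<open>1 / (x - a)\<^sup>2\<close> in the potential at \<open>a\<close>.
\<close>
definition v_coefficient :: "complex \<Rightarrow> complex" where
  "v_coefficient a = (\<Sum>i\<le>3. of_nat (l i * (l i + 1)) * of_bool (a - (- \<omega> i) \<in> Lat)) +
   (\<Sum>k=1..M. of_nat (r k) / 2 * (of_nat (r k) / 2 + 1) * (of_bool (a - \<delta> k \<in> Lat) + of_bool (a - (- \<delta> k) \<in> Lat)))"

lemma u_lim: "((\<lambda>x. (x - a) * u x) \<longlongrightarrow> u_residue a) (at a)"
proof -
  have "((\<lambda>x. \<Sum>k=1..M. of_nat (r k) / 2 * ((x - a) * wz (x - \<delta> k) + (x - a) * wz (x - (- \<delta> k)) - 2 * ((x - a) * wz (x - 0)))) \<longlongrightarrow> 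
    (\<Sum>k=1..M. of_nat (r k) / 2 * (of_bool (a - \<delta> k \<in> Lat) + of_bool (a - (- \<delta> k) \<in> Lat) - 2 * of_bool (a - 0 \<in> Lat)))) (at a)"
    by (intro tendsto_sum tendsto_mult tendsto_add tendsto_diff tendsto_const lim_wz)
  moreover have "eventually (\<lambda>x. (\<Sum>k=1..M. of_nat (r k) / 2 * ((x - a) * wz (x - \<delta> k) + (x - a) * wz (x - (- \<delta> k)) - 2 * ((x - a) * wz (x - 0)))) = (x - a) * u x) (at a)"
    using eventually_notin_discrete[OF not_islimpt_SP, of a]
  proof eventually_elim
    case (elim x)
    have "c * (t * A + t * B - 2 * (t * D)) = t * (c * (A + B - 2 * D))" for c t A B D :: complex
      by (simp add: algebra_simps)
    thus ?case unfolding u_eq[OF elim] sum_distrib_left by (intro sum.cong refl)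
  qed
  ultimately show ?thesis unfolding u_residue_def by (rule Lim_transform_eventually)
qed

lemma v_lim: "((\<lambda>x. (x - a) ^ 2 * (v x - E)) \<longlongrightarrow> v_coefficient a) (at a)"
proof -
  have "((\<lambda>x. (\<Sum>i\<le>3. of_nat (l i * (l i + 1)) * ((x - a) ^ 2 * wp (x - (- \<omega> i)))) +
     (\<Sum>k=1..M. of_nat (r k) / 2 * (of_nat (r k) / 2 + 1) * ((x - a) ^ 2 * wp (x - \<delta> k) + (x - a) ^ 2 * wp (x - (- \<delta> k))) + (x - a) ^ 2 * (s k / (wp x - wp (\<delta> k)))) - (x - a) ^ 2 * E) \<longlongrightarrow> 
   (\<Sum>i\<le>3. of_nat (l i * (l i + 1)) * of_bool (a - (- \<omega> i) \<in> Lat)) +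
   (\<Sum>k=1..M. of_nat (r k) / 2 * (of_nat (r k) / 2 + 1) * (of_bool (a - \<delta> k \<in> Lat) + of_bool (a - (- \<delta> k) \<in> Lat)) + 0) - (a - a) ^ 2 * E) (at a)"
    by (intro tendsto_diff tendsto_add tendsto_sum tendsto_mult tendsto_power tendsto_const tendsto_ident_at lim_wp 
        lim_inverse_wp delta_notin_Lat two_delta_notin_Lat)
  moreover have "(\<Sum>i\<le>3. of_nat (l i * (l i + 1)) * ((x - a) ^ 2 * wp (x - (- \<omega> i)))) +
     (\<Sum>k=1..M. of_nat (r k) / 2 * (of_nat (r k) / 2 + 1) * ((x - a) ^ 2 * wp (x - \<delta> k) + (x - a) ^ 2 * wp (x - (- \<delta> k))) + (x - a) ^ 2 * (s k / (wp x - wp (\<delta> k)))) - (x - a) ^ 2 * E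
    = (x - a) ^ 2 * (v x - E)" for x
  proof -
    have e: "t * (A + B - E) = t * A + t * B - t * E" for t A B :: complex by (simp add: algebra_simps)
    show ?thesis
      unfolding potential_def e sum_distrib_left
      by (intro arg_cong2[where f = "(-)"] arg_cong2[where f = "(+)"] sum.cong refl) (simp_all add: distrib_left mult_ac)
  qed
  ultimately show ?thesis unfolding v_coefficient_def by (simp only: add_0_right diff_self power_zero_numeral mult_zero_left diff_0_right)
qed

text \<open>
  By the incongruence of the singular points at most one indicator is \<open>1\<close>. The exponent \<open>lc\<close> is \<open>l i\<close> at
  \<open>\<omega> i\<close>, \<open>r k / 2\<close> at \<open>\<plusminus>\<delta> k\<close>, and \<open>0\<close> at regular points. At \<open>\<plusminus>\<delta> k\<close> the numbers \<open>- r k / 2\<close> and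
  \<open>r k / 2 + 1\<close> are completed by the residue \<open>r k / 2\<close> of \<open>\<Psi>\<^sub>g' / \<Psi>\<^sub>g\<close> to \<open>0\<close> and \<open>r k + 1\<close>.
\<close>
lemma exponent_integral:
  "\<exists>lc. v_coefficient a = lc * (lc + 1) \<and>
     (\<forall>c\<in>{- lc, lc + 1}. \<exists>n::int. c + u_residue a = of_int n \<and>
        (a \<notin> HP \<longrightarrow> n \<ge> 0) \<and> (\<forall>i\<le>3. a + \<omega> i \<in> Lat \<longrightarrow> n \<ge> - int (l_tilde l M r i)))"
proof -
  let ?A = "\<Sum>i\<le>3. of_nat (l i * (l i + 1)) * of_bool (a - (- \<omega> i) \<in> Lat) :: complex"
  let ?B = "\<Sum>k=1..M. of_nat (r k) / 2 * (of_nat (r k) / 2 + 1) * (of_bool (a - \<delta> k \<in> Lat) + of_bool (a - (- \<delta> k) \<in> Lat)) :: complex"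
  let ?C = "\<Sum>k=1..M. of_nat (r k) / 2 * (of_bool (a - \<delta> k \<in> Lat) + of_bool (a - (- \<delta> k) \<in> Lat) - 2 * of_bool (a - 0 \<in> Lat)) :: complex"
  consider "a \<in> HP" | k where "a \<notin> HP" "k \<in> {1..M}" "a - \<delta> k \<in> Lat \<or> a + \<delta> k \<in> Lat" | "a \<notin> SP"
    unfolding SP_iff by blast
  thus ?thesis
  proof cases
    case 1
    then obtain p where p: "p \<le> 3" "a + \<omega> p \<in> Lat" by (auto simp: HP_iff)
    have uniq: "a + \<omega> i \<in> Lat \<longleftrightarrow> i = p" if "i \<le> 3" for i
    proof
      assume "a + \<omega> i \<in> Lat"
      hence "(a + \<omega> i) - (a + \<omega> p) \<in> Lat" using p(2) Lat_diff by blast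
      thus "i = p" using omega_diff_notin_Lat[of i p] that p(1) by auto
    qed (use p in auto)
    have nd: "a - \<delta> k \<notin> Lat" "a + \<delta> k \<notin> Lat" if k: "k \<in> {1..M}" for k
    proof -
      show "a - \<delta> k \<notin> Lat"
      proof
        assume h: "a - \<delta> k \<in> Lat"
        have "\<delta> k + (a - \<delta> k) = a" by simp
        hence "\<delta> k \<in> HP" using HP_add_Lat[OF h, of "\<delta> k"] 1 by simp
        thus False using delta_notin_HP[OF k] by blast
      qed
      show "a + \<delta> k \<notin> Lat"
      proof
        assume h: "a + \<delta> k \<in> Lat"
        have "- \<delta> k + (a + \<delta> k) = a" by simp
        hence "- \<delta> k \<in> HP" using HP_add_Lat[OF h, of "- \<delta> k"] 1 by simp
        thus False using delta_notin_HP[OF k] uminus_HP by blast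
      qed
    qed
    have "?A = (\<Sum>i\<le>3. if i = p then of_nat (l p * (l p + 1)) else 0)"
      by (intro sum.cong refl) (use uniq in auto)
    hence A: "?A = of_nat (l p * (l p + 1))" using p(1) by simp
    have B: "?B = 0" by (intro sum.neutral) (use nd in auto)
    have aL: "a - 0 \<in> Lat \<longleftrightarrow> p = 0" using uniq[of 0] by (auto simp: omega_0)
    have "?C = (\<Sum>k=1..M. - of_bool (p = 0) * of_nat (r k))"
      unfolding aL by (intro sum.cong refl) (use nd in auto)
    also have "\<dots> = - of_bool (p = 0) * of_nat (\<Sum>k=1..M. r k)" by (simp add: sum_distrib_left)
    finally have C: "?C = - of_bool (p = 0) * of_nat (\<Sum>k=1..M. r k)" .
    show ?thesis unfolding v_coefficient_def u_residue_def
    proof (intro exI[of _ "of_nat (l p) :: complex"] conjI ballI)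
      show "?A + ?B = of_nat (l p) * (of_nat (l p) + 1)" unfolding A B by (simp add: algebra_simps)
      fix c :: complex assume c: "c \<in> {- of_nat (l p), of_nat (l p) + 1}"
      hence "c = of_int (- int (l p)) \<or> c = of_int (int (l p) + 1)" by simp
      then obtain m :: int where m: "c = of_int m" "m \<ge> - int (l p)"
        by (elim disjE) fastforce+
      let ?n = "m - of_bool (p = 0) * int (\<Sum>k=1..M. r k)"
      show "\<exists>n::int. c + ?C = of_int n \<and> (a \<notin> HP \<longrightarrow> n \<ge> 0) \<and> (\<forall>i\<le>3. a + \<omega> i \<in> Lat \<longrightarrow> n \<ge> - int (l_tilde l M r i))"
      proof (intro exI[of _ ?n] conjI)
        show "c + ?C = of_int ?n" unfolding C m by simp
        show "a \<notin> HP \<longrightarrow> ?n \<ge> 0" using 1 by blast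
        show "\<forall>i\<le>3. a + \<omega> i \<in> Lat \<longrightarrow> ?n \<ge> - int (l_tilde l M r i)"
          using uniq m(2) by (auto simp: l_tilde_def)
      qed
    qed
  next
    case (2 k)
    have no: "a + \<omega> i \<notin> Lat" if "i \<le> 3" for i using 2(1) that notin_HP by blast
    have A: "?A = 0" by (intro sum.neutral) (use no in auto)
    have one: "of_bool (a - \<delta> k \<in> Lat) + of_bool (a - (- \<delta> k) \<in> Lat) = (1 :: complex)"
    proof -
      have "\<not> (a - \<delta> k \<in> Lat \<and> a + \<delta> k \<in> Lat)"
      proof
        assume "a - \<delta> k \<in> Lat \<and> a + \<delta> k \<in> Lat"
        hence "(a + \<delta> k) - (a - \<delta> k) \<in> Lat" using Lat_diff by blast
        thus False using two_delta_notin_Lat[OF 2(2)] by simp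
      qed
      thus ?thesis using 2(3) by auto
    qed
    have zero: "of_bool (a - \<delta> m \<in> Lat) + of_bool (a - (- \<delta> m) \<in> Lat) = (0 :: complex)" if "m \<in> {1..M}" "m \<noteq> k" for m
      using delta_unique[OF that(1) 2(2) _ 2(3)] that(2) by auto
    have aL: "a - 0 \<notin> Lat" using 2(1) Lat_subset_HP by auto
    have "?B = (\<Sum>m=1..M. if m = k then of_nat (r k) / 2 * (of_nat (r k) / 2 + 1) else 0)"
      by (intro sum.cong refl) (use one zero in auto)
    hence B: "?B = of_nat (r k) / 2 * (of_nat (r k) / 2 + 1)" using 2(2) by simp
    have "?C = (\<Sum>m=1..M. if m = k then of_nat (r k) / 2 else 0)"
      by (intro sum.cong refl) (use one zero aL in auto)
    hence C: "?C = of_nat (r k) / 2" using 2(2) by simp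
    show ?thesis unfolding v_coefficient_def u_residue_def
    proof (intro exI[of _ "of_nat (r k) / 2 :: complex"] conjI ballI)
      show "?A + ?B = of_nat (r k) / 2 * (of_nat (r k) / 2 + 1)" unfolding A B by simp
      fix c :: complex assume c: "c \<in> {- (of_nat (r k) / 2), of_nat (r k) / 2 + 1}"
      then obtain n :: nat where "c + of_nat (r k) / 2 = of_nat n"
      proof -
        have "c + of_nat (r k) / 2 = of_nat 0 \<or> c + of_nat (r k) / 2 = of_nat (r k + 1)" using c by auto
        thus ?thesis using that by blast
      qed
      thus "\<exists>n::int. c + ?C = of_int n \<and> (a \<notin> HP \<longrightarrow> n \<ge> 0) \<and> (\<forall>i\<le>3. a + \<omega> i \<in> Lat \<longrightarrow> n \<ge> - int (l_tilde l M r i))"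
        unfolding C using no by (intro exI[of _ "int n"]) auto
    qed
  next
    case 3
    note n = notin_SP[OF 3]
    have no: "a + \<omega> i \<notin> Lat" if "i \<le> 3" for i using n(1) that notin_HP by blast
    have A: "?A = 0" by (intro sum.neutral) (use no in auto)
    have B: "?B = 0" by (intro sum.neutral) (use n in auto)
    have C: "?C = 0" by (intro sum.neutral) (use n in auto)
    show ?thesis unfolding v_coefficient_def u_residue_def
    proof (intro exI[of _ "0 :: complex"] conjI ballI)
      show "?A + ?B = 0 * (0 + 1)" unfolding A B by simp
      fix c :: complex assume c: "c \<in> {- 0, 0 + 1}"
      then obtain n :: nat where "c = of_nat n"
      proof -
        have "c = of_nat 0 \<or> c = of_nat 1" using c by auto
        thus ?thesis using that by blast
      qed
      thus "\<exists>n::int. c + ?C = of_int n \<and> (a \<notin> HP \<longrightarrow> n \<ge> 0) \<and> (\<forall>i\<le>3. a + \<omega> i \<in> Lat \<longrightarrow> n \<ge> - int (l_tilde l M r i))"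
        unfolding C using no by (intro exI[of _ "int n"]) auto
    qed
  qed
qed

end

section \<open>The product solution\<close>

text \<open>
  \<open>\<Xi>\<close> is a product of two solutions of \<open>- f'' + v f = E f\<close> with Wronskian \<open>2 q\<close> up to sign; the relation
  between \<open>\<Xi>\<close>, \<open>Q\<close> and \<open>v\<close> is the first integral of the third-order equation for \<open>\<Xi>\<close>.
\<close>
locale product_solution = ode_data \<omega> M l r \<delta> s E
  for \<omega> :: "nat \<Rightarrow> complex" and M :: nat and l r :: "nat \<Rightarrow> nat" and \<delta> s :: "nat \<Rightarrow> complex" and E :: complex +
  fixes \<Xi> :: "complex \<Rightarrow> complex" and Q q :: complex
  assumes Xi_holo: "\<Xi> holomorphic_on - SP" and Xi_mero: "\<Xi> meromorphic_on UNIV"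
    and Xi_nz: "\<exists>x. x \<notin> SP \<and> \<Xi> x \<noteq> 0"
    and Xi_per: "\<And>j x. j \<in> {1, 3} \<Longrightarrow> x \<notin> SP \<Longrightarrow> \<Xi> (x + 2 * \<omega> j) = \<Xi> x"
    and Q_eq: "\<And>x. x \<notin> SP \<Longrightarrow> Q = \<Xi> x ^ 2 * (E - v x) + 1 / 2 * \<Xi> x * (deriv ^^ 2) \<Xi> x - 1 / 4 * deriv \<Xi> x ^ 2"
    and q_eq: "q ^ 2 = - Q"
begin

definition bad_points :: "complex set" where "bad_points = SP \<union> {x. x \<notin> SP \<and> \<Xi> x = 0}"

definition f_logderiv :: "complex \<Rightarrow> complex" where "f_logderiv x = deriv \<Xi> x / (2 * \<Xi> x) + q / \<Xi> x"

definition Lambda_logderiv :: "complex \<Rightarrow> complex" where "Lambda_logderiv x = f_logderiv x + u x"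

text \<open>
  A meromorphic function that is not identically zero has isolated zeros.
\<close>
lemma not_islimpt_bad_points: "\<not> z islimpt bad_points"
proof -
  have ev_SP: "eventually (\<lambda>x. x \<notin> SP) (at z)" for z by (rule eventually_notin_discrete[OF not_islimpt_SP])
  have "\<not> (\<forall>\<^sub>\<approx>x\<in>UNIV. \<Xi> x = 0)"
  proof
    assume a: "\<forall>\<^sub>\<approx>x\<in>UNIV. \<Xi> x = 0"
    obtain x0 where x0: "x0 \<notin> SP" "\<Xi> x0 \<noteq> 0" using Xi_nz by blast
    have ev: "eventually (\<lambda>x. \<Xi> x = 0) (at x0)" using a by (simp add: eventually_cosparse_open_eq)
    have "isCont \<Xi> x0" using Xi_holo open_SP_compl x0(1)
      by (meson Compl_iff continuous_on_eq_continuous_at holomorphic_on_imp_continuous_on)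
    hence "(\<Xi> \<longlongrightarrow> \<Xi> x0) (at x0)" by (rule isContD)
    from this ev have "((\<lambda>_. 0) \<longlongrightarrow> \<Xi> x0) (at x0)" by (rule Lim_transform_eventually)
    thus False using x0(2) by (simp add: tendsto_const_iff)
  qed
  hence "\<forall>\<^sub>\<approx>x\<in>UNIV. \<Xi> x \<noteq> 0"
    using meromorphic_imp_constant_or_avoid[OF Xi_mero open_UNIV connected_UNIV, of 0] by blast
  hence "eventually (\<lambda>x. \<Xi> x \<noteq> 0) (at z)" by (simp add: eventually_cosparse_open_eq)
  with ev_SP[of z] have "eventually (\<lambda>x. x \<notin> bad_points) (at z)" by eventually_elim (simp add: bad_points_def)
  thus ?thesis by (simp add: islimpt_iff_eventually)
qed

lemma notin_bad_points: "x \<notin> bad_points \<Longrightarrow> x \<notin> SP" "x \<notin> bad_points \<Longrightarrow> \<Xi> x \<noteq> 0"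
  by (auto simp: bad_points_def)

lemma dXi: "x \<notin> SP \<Longrightarrow> (\<Xi> has_field_derivative deriv \<Xi> x) (at x)"
  using holomorphic_derivI[OF Xi_holo open_SP_compl] by simp

lemma ddXi: "x \<notin> SP \<Longrightarrow> (deriv \<Xi> has_field_derivative (deriv ^^ 2) \<Xi> x) (at x)"
  using holomorphic_derivI[OF holomorphic_deriv[OF Xi_holo open_SP_compl] open_SP_compl] by (simp add: numeral_2_eq_2)

text \<open>
  Divided by \<open>\<Xi>\<^sup>2\<close>, the definition of \<open>Q\<close> becomes the Riccati equation.
\<close>
lemma f_logderiv_riccati:
  assumes x: "x \<notin> bad_points"
  shows "deriv f_logderiv x + f_logderiv x ^ 2 = v x - E"
proof -
  note n = notin_bad_points[OF x]
  define X X1 X2 where "X = \<Xi> x" and "X1 = deriv \<Xi> x" and "X2 = (deriv ^^ 2) \<Xi> x"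
  have X0: "X \<noteq> 0" using n by (simp add: X_def)
  have d2: "((\<lambda>x. 2 * \<Xi> x) has_field_derivative 2 * X1) (at x)" unfolding X1_def by (intro DERIV_cmult dXi n)
  have "((\<lambda>x. deriv \<Xi> x / (2 * \<Xi> x)) has_field_derivative (X2 * (2 * X) - X1 * (2 * X1)) / ((2 * X) * (2 * X))) (at x)"
    unfolding X_def X1_def X2_def using n(2) by (intro DERIV_divide ddXi n DERIV_cmult dXi) auto
  moreover have "((\<lambda>x. q / \<Xi> x) has_field_derivative (0 * X - q * X1) / (X * X)) (at x)"
    unfolding X_def X1_def by (intro DERIV_divide DERIV_const dXi n)
  ultimately have "(f_logderiv has_field_derivative (X2 * (2 * X) - X1 * (2 * X1)) / ((2 * X) * (2 * X)) + (0 * X - q * X1) / (X * X)) (at x)"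
    unfolding f_logderiv_def[abs_def] by (rule DERIV_add)
  hence dy: "deriv f_logderiv x = (X2 * (2 * X) - X1 * (2 * X1)) / ((2 * X) * (2 * X)) + (0 * X - q * X1) / (X * X)" by (rule DERIV_imp_deriv)
  have yx: "f_logderiv x = X1 / (2 * X) + q / X" by (simp add: f_logderiv_def X_def X1_def)
  have a1: "(X2 * (2 * X) - X1 * (2 * X1)) / ((2 * X) * (2 * X)) * X ^ 2 = (X2 * X - X1 ^ 2) / 2"
  proof -
    have "X2 * (2 * X) - X1 * (2 * X1) = 2 * (X2 * X - X1 ^ 2)" by (simp add: power2_eq_square algebra_simps)
    moreover have "2 * D / ((2 * X) * (2 * X)) * X ^ 2 = D / 2" for D using X0 by (simp add: power2_eq_square)
    ultimately show ?thesis by (simp only:)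
  qed
  have a2: "(0 * X - q * X1) / (X * X) * X ^ 2 = - (q * X1)" using X0 by (simp add: power2_eq_square)
  have "(X1 / (2 * X) + q / X) * X = X1 / 2 + q" using X0 by (simp add: distrib_right)
  hence a3: "(X1 / (2 * X) + q / X) ^ 2 * X ^ 2 = (X1 / 2 + q) ^ 2"
    unfolding power_mult_distrib[symmetric] by simp
  have "(deriv f_logderiv x + f_logderiv x ^ 2) * X ^ 2 = (X2 * X - X1 ^ 2) / 2 + - (q * X1) + (X1 / 2 + q) ^ 2"
    unfolding dy yx distrib_right a1 a2 a3 ..
  also have "\<dots> = X2 * X / 2 - X1 ^ 2 / 4 + q ^ 2"
    by (simp add: power2_eq_square field_simps)
  also have "q ^ 2 = - (X ^ 2 * (E - v x) + 1 / 2 * X * X2 - 1 / 4 * X1 ^ 2)"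
    unfolding q_eq Q_eq[OF n(1)] X_def X1_def X2_def ..
  also have "X2 * X / 2 - X1 ^ 2 / 4 + - (X ^ 2 * (E - v x) + 1 / 2 * X * X2 - 1 / 4 * X1 ^ 2) = (v x - E) * X ^ 2"
    by (simp add: algebra_simps)
  finally show ?thesis using X0 by simp
qed

lemma f_logderiv_meromorphic: "f_logderiv meromorphic_on UNIV"
  unfolding f_logderiv_def[abs_def] by (intro meromorphic_intros Xi_mero)

lemma Lambda_logderiv_holomorphic: "Lambda_logderiv holomorphic_on - bad_points"
proof -
  have sub: "- bad_points \<subseteq> - SP" by (auto simp: bad_points_def)
  show ?thesis unfolding Lambda_logderiv_def[abs_def] f_logderiv_def
    by (intro holomorphic_on_add holomorphic_on_divide holomorphic_on_mult holomorphic_on_const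
       holomorphic_on_subset[OF u_holomorphic sub] holomorphic_on_subset[OF Xi_holo sub]
       holomorphic_on_subset[OF holomorphic_deriv[OF Xi_holo open_SP_compl] sub]) (use notin_bad_points in simp_all)
qed

lemma Lambda_logderiv_periodic:
  assumes j: "j \<in> {1, 3}" and x: "x \<notin> bad_points"
  shows "Lambda_logderiv (x + 2 * \<omega> j) = Lambda_logderiv x"
proof -
  note n = notin_bad_points[OF x]
  have "(deriv ^^ 1) \<Xi> (x + 2 * \<omega> j) = 1 * (deriv ^^ 1) \<Xi> x"
    by (rule higher_deriv_multiplier[OF Xi_holo open_SP_compl]) (use n Xi_per[OF j] in auto)
  hence d1: "deriv \<Xi> (x + 2 * \<omega> j) = deriv \<Xi> x" by simp
  note wL = notin_SP(2)[OF n(1)]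
  show ?thesis
    unfolding Lambda_logderiv_def f_logderiv_def Psi_logderiv_def d1 deriv_wp_periodic[OF j wL] Xi_per[OF j n(1)] wp_add_two_omega[OF j wL] ..
qed

lemma Lambda_logderiv_residue:
  "\<exists>n::int. ((\<lambda>x. (x - a) * Lambda_logderiv x) \<longlongrightarrow> of_int n) (at a) \<and> (a \<notin> HP \<longrightarrow> n \<ge> 0) \<and>
     (\<forall>i\<le>3. a + \<omega> i \<in> Lat \<longrightarrow> n \<ge> - int (l_tilde l M r i))"
proof -
  have mero: "f_logderiv meromorphic_on {a}" using f_logderiv_meromorphic meromorphic_on_subset by blast
  obtain lc where lc: "v_coefficient a = lc * (lc + 1)"
    "\<forall>c\<in>{- lc, lc + 1}. \<exists>n::int. c + u_residue a = of_int n \<and>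
        (a \<notin> HP \<longrightarrow> n \<ge> 0) \<and> (\<forall>i\<le>3. a + \<omega> i \<in> Lat \<longrightarrow> n \<ge> - int (l_tilde l M r i))"
    using exponent_integral[of a] by blast
  have "\<exists>c\<in>{- lc, lc + 1}. ((\<lambda>x. (x - a) * f_logderiv x) \<longlongrightarrow> c) (at a)"
  proof (rule riccati_exponent)
    show "isolated_singularity_at f_logderiv a" by (rule meromorphic_on_isolated_singularity[OF mero])
    show "not_essential f_logderiv a" by (rule meromorphic_on_not_essential[OF mero])
    show "eventually (\<lambda>x. deriv f_logderiv x + f_logderiv x ^ 2 = v x - E) (at a)"
      using eventually_notin_discrete[OF not_islimpt_bad_points, of a] by eventually_elim (rule f_logderiv_riccati)
    show "((\<lambda>x. (x - a) ^ 2 * (v x - E)) \<longlongrightarrow> lc * (lc + 1)) (at a)"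
      unfolding lc(1)[symmetric] by (rule v_lim)
  qed
  then obtain c where c: "c \<in> {- lc, lc + 1}" "((\<lambda>x. (x - a) * f_logderiv x) \<longlongrightarrow> c) (at a)" by blast
  obtain n :: int where n: "c + u_residue a = of_int n"
    "a \<notin> HP \<longrightarrow> n \<ge> 0" "\<forall>i\<le>3. a + \<omega> i \<in> Lat \<longrightarrow> n \<ge> - int (l_tilde l M r i)"
    using bspec[OF lc(2) c(1)] by blast
  have "((\<lambda>x. (x - a) * f_logderiv x + (x - a) * u x) \<longlongrightarrow> of_int n) (at a)"
    unfolding n(1)[symmetric] by (intro tendsto_add c u_lim)
  hence "((\<lambda>x. (x - a) * Lambda_logderiv x) \<longlongrightarrow> of_int n) (at a)" by (simp add: Lambda_logderiv_def distrib_left)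
  thus ?thesis using n(2,3) by blast
qed

text \<open>
  No branch is left in the logarithmic derivative of the germ.
\<close>
lemma branch_logderiv:
  assumes br: "Lambda_branch \<omega> M r \<delta> \<Xi> q U g" and x: "x \<in> U"
  shows "(g has_field_derivative Lambda_logderiv x * g x) (at x)" "g x \<noteq> 0" "x \<notin> bad_points"
proof -
  from br have U: "open U" "U \<inter> SP = {}" "\<forall>x\<in>U. \<Xi> x \<noteq> 0" unfolding Lambda_branch_def by blast+
  from br obtain p t F where
    p: "\<And>k. k \<in> {1..M} \<Longrightarrow> p k holomorphic_on U" "\<And>k x. k \<in> {1..M} \<Longrightarrow> x \<in> U \<Longrightarrow> p k x ^ 2 = wp x - wp (\<delta> k)" and
    t: "t holomorphic_on U" "\<And>x. x \<in> U \<Longrightarrow> t x ^ 2 = \<Xi> x" and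
    F: "\<And>x. x \<in> U \<Longrightarrow> (F has_field_derivative q / \<Xi> x) (at x)" and
    g: "\<And>x. x \<in> U \<Longrightarrow> g x = (\<Prod>k=1..M. p k x ^ r k) * t x * exp (F x)"
    unfolding Lambda_branch_def by blast
  have xS: "x \<notin> SP" using U x by blast
  show "x \<notin> bad_points" using U x by (auto simp: bad_points_def)
  have dwp: "(wp has_field_derivative deriv wp x) (at x)"
    using holomorphic_derivI[OF wp_holomorphic open_Lat_compl] notin_SP(2)[OF xS] by simp
  have p0: "p k x \<noteq> 0" if "k \<in> {1..M}" for k using p(2)[OF that x] notin_SP(5)[OF xS that] by auto
  have t0: "t x \<noteq> 0" using t(2)[OF x] U x by auto
  have dp: "((\<lambda>x. p k x ^ r k) has_field_derivative (of_nat (r k) / 2 * deriv wp x / (wp x - wp (\<delta> k))) * p k x ^ r k) (at x)" if k: "k \<in> {1..M}" for k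
  proof -
    have "((\<lambda>x. wp x - wp (\<delta> k)) has_field_derivative deriv wp x) (at x)"
      using DERIV_diff[OF dwp DERIV_const] by simp
    from logderiv_power[OF sqrt_logderiv[OF U(1) x p(1)[OF k] p(2)[OF k] notin_SP(5)[OF xS k] this], of "r k"]
    show ?thesis by simp
  qed
  have dP: "((\<lambda>x. \<Prod>k=1..M. p k x ^ r k) has_field_derivative u x * (\<Prod>k=1..M. p k x ^ r k)) (at x)"
    unfolding Psi_logderiv_def by (intro logderiv_prod dp) auto
  have dt: "(t has_field_derivative deriv \<Xi> x / (2 * \<Xi> x) * t x) (at x)"
    by (rule sqrt_logderiv[OF U(1) x t]) (use U x dXi[OF xS] in auto)
  have dF: "((\<lambda>x. exp (F x)) has_field_derivative q / \<Xi> x * exp (F x)) (at x)"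
    unfolding mult.commute[of "q / \<Xi> x"] by (rule DERIV_fun_exp[OF F[OF x]])
  have "((\<lambda>x. (\<Prod>k=1..M. p k x ^ r k) * t x * exp (F x)) has_field_derivative 
     Lambda_logderiv x * ((\<Prod>k=1..M. p k x ^ r k) * t x * exp (F x))) (at x)"
    using logderiv_mult[OF logderiv_mult[OF dP dt] dF] by (simp only: Lambda_logderiv_def f_logderiv_def add_ac)
  also have "(\<Prod>k=1..M. p k x ^ r k) * t x * exp (F x) = g x" using g[OF x] by simp
  finally show "(g has_field_derivative Lambda_logderiv x * g x) (at x)"
    by (rule has_field_derivative_transform_within_open[OF _ U(1) x]) (rule g[symmetric])
  show "g x \<noteq> 0" unfolding g[OF x] using p0 t0 by auto
qed

text \<open>
  On \<open>U\<close> the germ \<open>g\<close> and the global function \<open>\<Lambda>0\<close> have the same logarithmic derivative, so they are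
  proportional. At \<open>x0\<close> in \<open>U\<close> the value is nonzero, so the multiplier predicted by an expression of
  type (A) or (B) at this one point is the multiplier everywhere, half-periods included.
\<close>
lemma Lambda_exists:
  assumes br: "Lambda_branch \<omega> M r \<delta> \<Xi> q U g"
  shows "\<exists>\<Lambda>. \<Lambda> nicely_meromorphic_on UNIV \<and> (\<forall>x\<in>U. \<Lambda> x = g x) \<and>
      ((\<exists>\<alpha> \<kappa> bt. expression_A \<omega> (l_tilde l M r) \<Lambda> \<alpha> \<kappa> bt) \<or>
       (\<exists>\<kappa> c bt ct. expression_B \<omega> (l_tilde l M r) \<Lambda> \<kappa> c bt ct)) \<and>
      (\<forall>\<alpha> \<kappa> bt. expression_A \<omega> (l_tilde l M r) \<Lambda> \<alpha> \<kappa> bt \<longrightarrow>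
         (\<forall>j\<in>{1, 3}. \<forall>x. \<Lambda> (x + 2 * \<omega> j) =
            exp (- 2 * weierstrass_zeta \<omega> (\<omega> j) * \<alpha> + 2 * \<omega> j * weierstrass_zeta \<omega> \<alpha>
                 + 2 * \<kappa> * \<omega> j) * \<Lambda> x)) \<and>
      (\<forall>\<kappa> c bt ct. expression_B \<omega> (l_tilde l M r) \<Lambda> \<kappa> c bt ct \<longrightarrow>
         (\<forall>j\<in>{1, 3}. \<forall>x. \<Lambda> (x + 2 * \<omega> j) = exp (2 * \<kappa> * \<omega> j) * \<Lambda> x))"
proof -
  from br have U: "open U" "connected U" "U \<noteq> {}" unfolding Lambda_branch_def by blast+
  define n where "n = (\<lambda>a. SOME n::int. ((\<lambda>x. (x - a) * Lambda_logderiv x) \<longlongrightarrow> of_int n) (at a) \<and> (a \<notin> HP \<longrightarrow> n \<ge> 0) \<and>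
     (\<forall>i\<le>3. a + \<omega> i \<in> Lat \<longrightarrow> n \<ge> - int (l_tilde l M r i)))"
  have n: "((\<lambda>x. (x - a) * Lambda_logderiv x) \<longlongrightarrow> of_int (n a)) (at a) \<and> (a \<notin> HP \<longrightarrow> n a \<ge> 0) \<and>
     (\<forall>i\<le>3. a + \<omega> i \<in> Lat \<longrightarrow> n a \<ge> - int (l_tilde l M r i))" for a
    unfolding n_def by (rule someI_ex[OF Lambda_logderiv_residue])
  obtain \<Lambda>0 \<kappa> \<alpha> where L0: "\<Lambda>0 nicely_meromorphic_on UNIV" 
    "\<And>z. n z \<ge> 0 \<Longrightarrow> \<Lambda>0 analytic_on {z}"
    "\<And>z m. n z \<ge> - int m \<Longrightarrow> \<exists>L. ((\<lambda>x. (x - z) ^ m * \<Lambda>0 x) \<longlongrightarrow> L) (at z)"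
    "\<And>j x. j \<in> {1, 3} \<Longrightarrow> \<Lambda>0 (x + 2 * \<omega> j) = exp (2 * \<omega> j * \<kappa> - 2 * wz (\<omega> j) * \<alpha>) * \<Lambda>0 x"
    "\<And>x. x \<notin> bad_points \<Longrightarrow> \<Lambda>0 x \<noteq> 0 \<and> (\<Lambda>0 has_field_derivative Lambda_logderiv x * \<Lambda>0 x) (at x)"
    by (rule elliptic_logderiv_integrate[OF not_islimpt_bad_points Lambda_logderiv_holomorphic Lambda_logderiv_periodic, of n]) (use n in blast)+
  have dq: "((\<lambda>x. g x / \<Lambda>0 x) has_field_derivative 0) (at x)" if x: "x \<in> U" for x
    using logderiv_divide[OF branch_logderiv(1)[OF br x], of \<Lambda>0 "Lambda_logderiv x"] L0(5)[OF branch_logderiv(3)[OF br x]] by simp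
  have "(\<lambda>x. g x / \<Lambda>0 x) constant_on U"
    by (rule has_field_derivative_0_imp_constant_on[OF dq U(2,1)])
  then obtain C where C: "\<And>x. x \<in> U \<Longrightarrow> g x / \<Lambda>0 x = C" unfolding constant_on_def by blast
  define \<Lambda> where "\<Lambda> = (\<lambda>x. C * \<Lambda>0 x)"
  have Lg: "\<Lambda> x = g x" if x: "x \<in> U" for x
    using C[OF x] L0(5)[OF branch_logderiv(3)[OF br x]] by (auto simp: \<Lambda>_def field_simps)
  have quasi: "\<Lambda> (x + 2 * \<omega> j) = exp (2 * \<omega> j * \<kappa> - 2 * wz (\<omega> j) * \<alpha>) * \<Lambda> x" if "j \<in> {1, 3}" for j x
    unfolding \<Lambda>_def L0(4)[OF that] by simp
  have holo: "\<Lambda> holomorphic_on - HP"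
  proof -
    have "\<Lambda>0 analytic_on {z}" if "z \<in> - HP" for z using L0(2)[of z] n[of z] that by blast
    hence "\<Lambda>0 analytic_on - HP" using analytic_on_analytic_at by blast
    hence "\<Lambda>0 holomorphic_on - HP" by (rule analytic_imp_holomorphic)
    thus ?thesis unfolding \<Lambda>_def by (intro holomorphic_intros)
  qed
  have pole: "\<exists>c. ((\<lambda>x. (x + \<omega> i) ^ l_tilde l M r i * \<Lambda> x) \<longlongrightarrow> c) (at (- \<omega> i))" if i: "i \<le> 3" for i
  proof -
    have "- \<omega> i + \<omega> i \<in> Lat" by simp
    hence "n (- \<omega> i) \<ge> - int (l_tilde l M r i)" using n[of "- \<omega> i"] i by blast
    from L0(3)[OF this] obtain L where "((\<lambda>x. (x - (- \<omega> i)) ^ l_tilde l M r i * \<Lambda>0 x) \<longlongrightarrow> L) (at (- \<omega> i))" by blast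
    hence "((\<lambda>x. C * ((x - (- \<omega> i)) ^ l_tilde l M r i * \<Lambda>0 x)) \<longlongrightarrow> C * L) (at (- \<omega> i))" by (intro tendsto_intros)
    hence "((\<lambda>x. (x + \<omega> i) ^ l_tilde l M r i * \<Lambda> x) \<longlongrightarrow> C * L) (at (- \<omega> i))"
      unfolding diff_minus_eq_add \<Lambda>_def by (simp only: mult_ac)
    thus ?thesis by blast
  qed
  obtain x0 where x0: "x0 \<in> U" using U by blast
  have x0T: "x0 \<notin> bad_points" by (rule branch_logderiv(3)[OF br x0])
  have x0H: "x0 \<notin> HP" by (rule notin_SP(1)[OF notin_bad_points(1)[OF x0T]])
  have Lx0: "\<Lambda> x0 \<noteq> 0" unfolding Lg[OF x0] by (rule branch_logderiv(2)[OF br x0])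
  have mult: "\<Lambda> (x + 2 * \<omega> j) = m * \<Lambda> x" if j: "j \<in> {1, 3}" and m: "\<Lambda> (x0 + 2 * \<omega> j) = m * \<Lambda> x0" for j x m
    using quasi[OF j, of x0] quasi[OF j, of x] m Lx0 by simp
  show ?thesis
  proof (intro exI[of _ \<Lambda>] conjI)
    show "\<Lambda> nicely_meromorphic_on UNIV" unfolding \<Lambda>_def by (rule nicely_meromorphic_on_cmult_left[OF L0(1)])
    show "\<forall>x\<in>U. \<Lambda> x = g x" using Lg by blast
    show "(\<exists>\<alpha> \<kappa> bt. expression_A \<omega> (l_tilde l M r) \<Lambda> \<alpha> \<kappa> bt) \<or> (\<exists>\<kappa> c bt ct. expression_B \<omega> (l_tilde l M r) \<Lambda> \<kappa> c bt ct)"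
    proof (cases "\<alpha> \<in> Lat")
      case True
      from expression_B_exists[OF True holo quasi pole] show ?thesis by blast
    next
      case False
      from expression_A_exists[OF False holo quasi pole] show ?thesis by blast
    qed
    show "\<forall>\<alpha> \<kappa> bt. expression_A \<omega> (l_tilde l M r) \<Lambda> \<alpha> \<kappa> bt \<longrightarrow>
         (\<forall>j\<in>{1, 3}. \<forall>x. \<Lambda> (x + 2 * \<omega> j) =
            exp (- 2 * weierstrass_zeta \<omega> (\<omega> j) * \<alpha> + 2 * \<omega> j * weierstrass_zeta \<omega> \<alpha>
                 + 2 * \<kappa> * \<omega> j) * \<Lambda> x)"
      using mult[OF _ expression_A_quasi[OF _ _ x0H]] by blast
    show "\<forall>\<kappa> c bt ct. expression_B \<omega> (l_tilde l M r) \<Lambda> \<kappa> c bt ct \<longrightarrow>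
         (\<forall>j\<in>{1, 3}. \<forall>x. \<Lambda> (x + 2 * \<omega> j) = exp (2 * \<kappa> * \<omega> j) * \<Lambda> x)"
      using mult[OF _ expression_B_quasi[OF _ _ x0H]] by blast
  qed
qed

end

context ode_data begin

lemma Xi_form_regular:
  assumes form: "\<forall>x. x \<notin> SP \<longrightarrow>
      \<Xi> x = c0
        + (\<Sum>i\<le>3. \<Sum>j<l i. bX i j * wp (x + \<omega> i) ^ (l i - j))
        + (\<Sum>k=1..M. \<Sum>j<r k. dX k j / (wp x - wp (\<delta> k)) ^ (r k - j))"
  shows "\<Xi> holomorphic_on - SP" "\<Xi> meromorphic_on UNIV"
proof -
  let ?R = "\<lambda>x. c0
        + (\<Sum>i\<le>3. \<Sum>j<l i. bX i j * wp (x + \<omega> i) ^ (l i - j))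
        + (\<Sum>k=1..M. \<Sum>j<r k. dX k j / (wp x - wp (\<delta> k)) ^ (r k - j))"
  have "?R holomorphic_on - SP"
    by (intro holomorphic_intros) (use notin_SP notin_HP in auto)
  thus "\<Xi> holomorphic_on - SP"
    by (rule holomorphic_transform) (use form in auto)
  have "?R meromorphic_on UNIV"
    by (intro meromorphic_intros wp_shift_meromorphic wp_meromorphic)
  moreover have "eventually (\<lambda>x. ?R x = \<Xi> x) (at z)" for z
    using eventually_notin_discrete[OF not_islimpt_SP, of z] by eventually_elim (use form in auto)
  ultimately show "\<Xi> meromorphic_on UNIV" using meromorphic_on_cong[of UNIV ?R \<Xi> UNIV] by blast
qed

end

theorem theorem3p5:
  fixes \<omega> :: "nat \<Rightarrow> complex" and M :: nat and l r :: "nat \<Rightarrow> nat"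
    and b \<delta> s :: "nat \<Rightarrow> complex" and E :: complex
    and \<Xi> :: "complex \<Rightarrow> complex"
    and c0 :: complex and bX dX :: "nat \<Rightarrow> nat \<Rightarrow> complex"
    and Q q :: complex and U :: "complex set" and g :: "complex \<Rightarrow> complex"
  assumes periods: "\<omega> 0 = 0" "\<omega> 2 = - \<omega> 1 - \<omega> 3" "\<omega> 1 \<noteq> \<omega> 3" "independent {\<omega> 1, \<omega> 3}"
    and r_pos: "\<forall>k\<in>{1..M}. r k > 0"
    and b_distinct: "inj_on b {1..M}"
    and b_not_e: "\<forall>k\<in>{1..M}. \<forall>i\<in>{1..3}. b k \<noteq> weierstrass_p \<omega> (\<omega> i)"
    and delta: "\<forall>k\<in>{1..M}. \<delta> k \<notin> period_lattice \<omega> \<and> weierstrass_p \<omega> (\<delta> k) = b k"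
    and apparent: "\<forall>k\<in>{1..M}. \<forall>a\<in>{\<delta> k, - \<delta> k}.
      apparent_singularity (ode_P \<omega> M r \<delta>) (ode_R \<omega> l M r s \<delta> E) a"
    and Xi_form: "\<forall>x. x \<notin> singular_points \<omega> M \<delta> \<longrightarrow>
      \<Xi> x = c0
        + (\<Sum>i\<le>3. \<Sum>j<l i. bX i j * weierstrass_p \<omega> (x + \<omega> i) ^ (l i - j))
        + (\<Sum>k=1..M. \<Sum>j<r k. dX k j / (weierstrass_p \<omega> x - weierstrass_p \<omega> (\<delta> k)) ^ (r k - j))"
    and Xi_nonzero: "\<exists>x. x \<notin> singular_points \<omega> M \<delta> \<and> \<Xi> x \<noteq> 0"
    and Xi_even: "\<forall>x. x \<notin> singular_points \<omega> M \<delta> \<longrightarrow> \<Xi> (- x) = \<Xi> x"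
    and Xi_periodic: "\<forall>x. x \<notin> singular_points \<omega> M \<delta> \<longrightarrow>
      \<Xi> (x + 2 * \<omega> 1) = \<Xi> x \<and> \<Xi> (x + 2 * \<omega> 3) = \<Xi> x"
    and Xi_ode: "\<forall>x. x \<notin> singular_points \<omega> M \<delta> \<longrightarrow>
      (deriv ^^ 3) \<Xi> x - 4 * (potential \<omega> l M r s \<delta> x - E) * deriv \<Xi> x
        - 2 * deriv (potential \<omega> l M r s \<delta>) x * \<Xi> x = 0"
    and Q: "\<forall>x. x \<notin> singular_points \<omega> M \<delta> \<longrightarrow>
      Q = \<Xi> x ^ 2 * (E - potential \<omega> l M r s \<delta> x) + 1 / 2 * \<Xi> x * (deriv ^^ 2) \<Xi> x
            - 1 / 4 * deriv \<Xi> x ^ 2"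
    and q: "q ^ 2 = - Q"
    and branch: "Lambda_branch \<omega> M r \<delta> \<Xi> q U g"
  shows "\<exists>\<Lambda>. \<Lambda> nicely_meromorphic_on UNIV \<and> (\<forall>x\<in>U. \<Lambda> x = g x) \<and>
      ((\<exists>\<alpha> \<kappa> bt. expression_A \<omega> (l_tilde l M r) \<Lambda> \<alpha> \<kappa> bt) \<or>
       (\<exists>\<kappa> c bt ct. expression_B \<omega> (l_tilde l M r) \<Lambda> \<kappa> c bt ct)) \<and>
      (\<forall>\<alpha> \<kappa> bt. expression_A \<omega> (l_tilde l M r) \<Lambda> \<alpha> \<kappa> bt \<longrightarrow>
         (\<forall>j\<in>{1, 3}. \<forall>x. \<Lambda> (x + 2 * \<omega> j) =
            exp (- 2 * weierstrass_zeta \<omega> (\<omega> j) * \<alpha> + 2 * \<omega> j * weierstrass_zeta \<omega> \<alpha>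
                 + 2 * \<kappa> * \<omega> j) * \<Lambda> x)) \<and>
      (\<forall>\<kappa> c bt ct. expression_B \<omega> (l_tilde l M r) \<Lambda> \<kappa> c bt ct \<longrightarrow>
         (\<forall>j\<in>{1, 3}. \<forall>x. \<Lambda> (x + 2 * \<omega> j) = exp (2 * \<kappa> * \<omega> j) * \<Lambda> x))"
proof -
  have hp: "half_periods \<omega>" using periods by unfold_locales
  have od: "ode_data \<omega> M \<delta>"
  proof (intro ode_data.intro hp ode_data_axioms.intro)
    show "\<delta> k \<notin> period_lattice \<omega>" if "k \<in> {1..M}" for k using delta that by blast
    have "inj_on (\<lambda>k. weierstrass_p \<omega> (\<delta> k)) {1..M} \<longleftrightarrow> inj_on b {1..M}"
      by (rule inj_on_cong) (use delta in blast)
    thus "inj_on (\<lambda>k. weierstrass_p \<omega> (\<delta> k)) {1..M}" using b_distinct by blast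
    show "weierstrass_p \<omega> (\<delta> k) \<noteq> weierstrass_p \<omega> (\<omega> i)" if "k \<in> {1..M}" "i \<in> {1..3}" for k i
      using delta b_not_e that by metis
  qed
  interpret product_solution \<omega> M l r \<delta> s E \<Xi> Q q
  proof (intro product_solution.intro od product_solution_axioms.intro)
    show "\<Xi> holomorphic_on - singular_points \<omega> M \<delta>" "\<Xi> meromorphic_on UNIV"
      using ode_data.Xi_form_regular[OF od Xi_form] by auto
    show "\<Xi> (x + 2 * \<omega> j) = \<Xi> x" if "j \<in> {1, 3}" "x \<notin> singular_points \<omega> M \<delta>" for j x
      using Xi_periodic that by blast
  qed (use Xi_nonzero Q q in blast)+
  from branch show ?thesis by (rule Lambda_exists)
qed

end
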